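(* Let $k\ge1$, let $\alpha^0$ be a fixed probability vector on $[k]$ with $\alpha^0_a>0$ for all $a\in[k]$, and let $\boldsymbol{Q}^0$ be a fixed symmetric $k\times k$ matrix with positive entries, having no two identical columns, such that $\sum_{a,b=1}^k\alpha^0_a\alpha^0_b\boldsymbol{Q}^0_{ab}=1$. Let $(\rho_n)$ be a decreasing sequence of positive numbers such that $\rho_n\boldsymbol{Q}^0\in(0,1)^{k\times k}$ for all $n$ and $\rho_n\, n/\log(n)\to\infty$ as $n\to\infty$. For each $n$, let $\boldsymbol{A}$ be the fully observed adjacency matrix of a stochastic block model on $n$ nodes with parameters $\alpha^*=\alpha^0$ and $\boldsymbol{Q}^*=\rho_n\boldsymbol{Q}^0$, with random label function $z^*$ and matrix of connection probabilities $\boldsymbol{\Theta}^*$. Let $\widehat{z}^{VAR}$, $\widehat{z}$ and $\widehat{\boldsymbol{\Theta}}^{VAR}$ be respectively the variational label estimator, the maximum likelihood label estimator, and the variational estimator of the matrix of connection probabilities. Then $$\mathbb{P}\left(\widehat{z}^{VAR}\sim\widehat{z}\right)\to1\quad\text{as } n\to\infty.$$ Moreover, there exists a constant $C_{\boldsymbol{Q}^0}>0$ depending on $\boldsymbol{Q}^0$ such that $$\mathbb{P}\left(\left\Vert\boldsymbol{\Theta}^*-\widehat{\boldsymbol{\Theta}}^{VAR}\right\Vert_2^2\le C_{\boldsymbol{Q}^0}\,\rho_n\left(k^2+n\log(k)\right)\right)\underset{n\to\infty}{\longrightarrow}1.$$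
   Context: **Model.** $[n]=\{1,\dots,n\}$; $\mathcal{Z}_{n,k}$ is the set of all label functions $z:[n]\to[k]$. In the stochastic block model with parameters $(\alpha^*,\boldsymbol{Q}^* )$, where $\alpha^*$ is a probability vector on $[k]$ and $\boldsymbol{Q}^*\in[0,1]^{k\times k}$ is symmetric, the labels $z^*(1),\dots,z^*(n)$ are i.i.d. with $\mathbb{P}(z^*(i)=a)=\alpha^*_a$. Set $\boldsymbol{\Theta}^*_{ij}=\boldsymbol{Q}^*_{z^*(i)z^*(j)}$ for $i\ne j$ and $\boldsymbol{\Theta}^*_{ii}=0$. Conditionally on $z^*$, the entries $\boldsymbol{A}_{ij}$, $i<j$, are independent Bernoulli variables with parameters $\boldsymbol{\Theta}^*_{ij}$; $\boldsymbol{A}$ is symmetric with zero diagonal. All off-diagonal entries of $\boldsymbol{A}$ are observed. **Parameter space.** $\mathcal{Q}$ is the set of pairs $(\alpha,\boldsymbol{Q})$ where $\alpha$ is a probability vector on $[k]$ with positive entries and $\boldsymbol{Q}=\rho\boldsymbol{S}$ for some $\rho>0$ and some symmetric matrix $\boldsymbol{S}$ with positive entries such that $\sum_{a,b}\alpha_a\alpha_b\boldsymbol{S}_{ab}=1$, with $\boldsymbol{Q}\in(0,1)^{k\times k}$ (the normalization of $\boldsymbol{S}$ only serves to identify $\rho$ and $\boldsymbol{S}$ from $\boldsymbol{Q}$). Thus $\boldsymbol{Q}$ ranges over the symmetric matrices in $(0,1)^{k\times k}$. **Likelihoods.** For $z\in\mathcal{Z}_{n,k}$ and $(\alpha,\boldsymbol{Q})\in\mathcal{Q}$,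 $$\mathcal{L}(\boldsymbol{A};z,\boldsymbol{Q})=\sum_{1\le i<j\le n}\left(\boldsymbol{A}_{ij}\log(\boldsymbol{Q}_{z(i)z(j)})+(1-\boldsymbol{A}_{ij})\log(1-\boldsymbol{Q}_{z(i)z(j)})\right),$$ $$l(\boldsymbol{A};\alpha,\boldsymbol{Q})=\sum_{z\in\mathcal{Z}_{n,k}}\Big(\prod_{i\le n}\alpha_{z(i)}\Big)\exp\left(\mathcal{L}(\boldsymbol{A};z,\boldsymbol{Q})\right).$$ The posterior distribution of the labels is $\mathbb{P}(z\mid\boldsymbol{A},\alpha,\boldsymbol{Q})=\big(\prod_{i\le n}\alpha_{z(i)}\big)\exp(\mathcal{L}(\boldsymbol{A};z,\boldsymbol{Q}))/l(\boldsymbol{A};\alpha,\boldsymbol{Q})$. **Maximum likelihood estimator.** $(\widehat{\boldsymbol{Q}},\widehat{z})$ is a maximizer of $\mathcal{L}(\boldsymbol{A};z,\boldsymbol{Q})$ over $z\in\mathcal{Z}_{n,k}$ and over the matrices $\boldsymbol{Q}$ in the parameter space. **Variational estimator.** Let $\mathcal{T}$ be the set of $\tau=(\tau^1,\dots,\tau^n)$ where each $\tau^i=(\tau^i_1,\dots,\tau^i_k)$ is a probability vector on $[k]$, and let $\mathbb{P}_\tau(z)=\prod_{i\le n}\tau^i_{z(i)}$ be the corresponding product distribution on $\mathcal{Z}_{n,k}$. With $KL$ the Kullback–Leibler divergence, $$\mathcal{J}(\boldsymbol{A};\tau,\alpha,\boldsymbol{Q})=\log\left(l(\boldsymbol{A};\alpha,\boldsymbol{Q})\right)-KL\left(\mathbb{P}_\tau(\cdot)\,\Vert\,\mathbb{P}(\cdot\mid\boldsymbol{A},\alpha,\boldsymbol{Q})\right),$$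 $$(\widehat{\alpha}^{VAR},\widehat{\boldsymbol{Q}}^{VAR},\widehat{\tau}^{VAR})\in\arg\max_{(\alpha,\boldsymbol{Q})\in\mathcal{Q},\,\tau\in\mathcal{T}}\mathcal{J}(\boldsymbol{A};\tau,\alpha,\boldsymbol{Q}).$$ The variational label estimator is $\widehat{z}^{VAR}(i)\in\arg\max_{a\le k}(\widehat{\tau}^{VAR})^i_a$ for $i\le n$. For a label function $z$ write $z^{-1}(a,b)=\{(i,j):z(i)=a,\ z(j)=b,\ i\ne j\}$. For $a,b\le k$, $$\widehat{\boldsymbol{Q}}^{ML-VAR}_{ab}=\frac{\sum_{(i,j)\in(\widehat{z}^{VAR})^{-1}(a,b)}\boldsymbol{A}_{ij}}{\left|(\widehat{z}^{VAR})^{-1}(a,b)\right|},$$ and $\widehat{\boldsymbol{\Theta}}^{VAR}_{ij}=\widehat{\boldsymbol{Q}}^{ML-VAR}_{\widehat{z}^{VAR}(i),\widehat{z}^{VAR}(j)}$ for $i\ne j$, $\widehat{\boldsymbol{\Theta}}^{VAR}_{ii}=0$. **Notation.** For label functions $z,z'$, $z\sim z'$ means that there is a permutation $\sigma$ of $[k]$ with $z'(i)=\sigma(z(i))$ for all $i\in[n]$. $\Vert\boldsymbol{M}\Vert_2=\sqrt{\sum_{i,j}\boldsymbol{M}_{ij}^2}$ is the Frobenius norm. The parameters $k,\alpha^0,\boldsymbol{Q}^0$ do not depend on $n$.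
   Formalization: The second claim (the Frobenius-norm bound) is stated only for k ≥ 2: for k = 1 the bound is C ρ_n while the error is 2ρ_n(1−ρ_n)Z_n² with Z_n asymptotically standard normal, so the probability does not tend to 1 for any constant C. *)

theory Defs
  imports "HOL-Probability.Probability"
begin

section \<open>The stochastic block model\<close>

text \<open>
  The set of the \<open>k\<close> communities is a finite type \<open>'k\<close>, so \<open>k = CARD('k)\<close>; the nodes are
  \<open>{1..n}\<close>. A probability vector on the communities is a \<open>'k pmf\<close>. Label functions are
  extensional (\<open>undefined\<close> outside \<open>{1..n}\<close>), so that there are exactly \<open>k ^ n\<close> of them.
\<close>

definition labelings :: "nat \<Rightarrow> (nat \<Rightarrow> 'k::finite) set" where
  "labelings n = {1..n} \<rightarrow>\<^sub>E UNIV"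

definition node_pairs :: "nat \<Rightarrow> (nat \<times> nat) set" where
  "node_pairs n = {(i, j). 1 \<le> i \<and> i < j \<and> j \<le> n}"

definition block_matrix :: "real^'k^'k \<Rightarrow> (nat \<Rightarrow> 'k::finite) \<Rightarrow> nat \<Rightarrow> nat \<Rightarrow> real" where
  "block_matrix Q z i j = (if i = j then 0 else Q $ z i $ z j)"

definition adjacency :: "(nat \<times> nat \<Rightarrow> bool) \<Rightarrow> nat \<Rightarrow> nat \<Rightarrow> real" where
  "adjacency e i j = of_bool (i < j \<and> e (i, j) \<or> j < i \<and> e (j, i))"

text \<open>The joint law of \<open>(z\<^sup>*, A)\<close>.\<close>

definition sbm :: "nat \<Rightarrow> 'k::finite pmf \<Rightarrow> real^'k^'k
    \<Rightarrow> ((nat \<Rightarrow> 'k) \<times> (nat \<Rightarrow> nat \<Rightarrow> real)) pmf" where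
  "sbm n \<alpha> Q =
     bind_pmf (Pi_pmf {1..n} undefined (\<lambda>_. \<alpha>)) (\<lambda>z.
       map_pmf (\<lambda>e. (z, adjacency e))
         (Pi_pmf (node_pairs n) False (\<lambda>(i, j). bernoulli_pmf (block_matrix Q z i j))))"


section \<open>Likelihoods\<close>

definition param_space :: "('k::finite pmf \<times> (real^'k^'k)) set" where
  "param_space = {(\<alpha>, Q).
     (\<forall>a. 0 < pmf \<alpha> a) \<and>
     (\<exists>\<rho> S. 0 < \<rho> \<and> Q = \<rho> *\<^sub>R S \<and> transpose S = S \<and> (\<forall>a b. 0 < S $ a $ b) \<and>
        (\<Sum>a\<in>UNIV. \<Sum>b\<in>UNIV. pmf \<alpha> a * pmf \<alpha> b * S $ a $ b) = 1) \<and>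
     (\<forall>a b. 0 < Q $ a $ b \<and> Q $ a $ b < 1)}"

definition log_lik :: "nat \<Rightarrow> (nat \<Rightarrow> nat \<Rightarrow> real) \<Rightarrow> (nat \<Rightarrow> 'k::finite) \<Rightarrow> real^'k^'k \<Rightarrow> real" where
  "log_lik n A z Q = (\<Sum>(i, j)\<in>node_pairs n.
     A i j * ln (Q $ z i $ z j) + (1 - A i j) * ln (1 - Q $ z i $ z j))"

definition joint_lik :: "nat \<Rightarrow> (nat \<Rightarrow> nat \<Rightarrow> real) \<Rightarrow> 'k::finite pmf \<Rightarrow> real^'k^'k
    \<Rightarrow> (nat \<Rightarrow> 'k) \<Rightarrow> real" where
  "joint_lik n A \<alpha> Q z = (\<Prod>i\<in>{1..n}. pmf \<alpha> (z i)) * exp (log_lik n A z Q)"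

definition marginal_lik :: "nat \<Rightarrow> (nat \<Rightarrow> nat \<Rightarrow> real) \<Rightarrow> 'k::finite pmf \<Rightarrow> real^'k^'k \<Rightarrow> real" where
  "marginal_lik n A \<alpha> Q = (\<Sum>z\<in>labelings n. joint_lik n A \<alpha> Q z)"

definition posterior :: "nat \<Rightarrow> (nat \<Rightarrow> nat \<Rightarrow> real) \<Rightarrow> 'k::finite pmf \<Rightarrow> real^'k^'k
    \<Rightarrow> (nat \<Rightarrow> 'k) pmf" where
  "posterior n A \<alpha> Q =
     embed_pmf (\<lambda>z. if z \<in> labelings n then joint_lik n A \<alpha> Q z / marginal_lik n A \<alpha> Q else 0)"

lemma finite_labelings [simp]: "finite (labelings n :: (nat \<Rightarrow> 'k::finite) set)"
  unfolding labelings_def by (intro finite_PiE) auto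

lemma joint_lik_nonneg: "0 \<le> joint_lik n A \<alpha> Q z"
  unfolding joint_lik_def by (intro mult_nonneg_nonneg prod_nonneg) auto

lemma marginal_lik_pos: "0 < marginal_lik n A \<alpha> Q"
proof -
  obtain a where a: "a \<in> set_pmf \<alpha>" using set_pmf_not_empty[of \<alpha>] by blast
  define z where "z = restrict (\<lambda>_. a) {1..n}"
  have z: "z \<in> labelings n" by (simp add: z_def labelings_def)
  have "0 < joint_lik n A \<alpha> Q z"
    unfolding joint_lik_def using a
    by (intro mult_pos_pos prod_pos) (auto simp: z_def pmf_positive)
  also have "\<dots> \<le> marginal_lik n A \<alpha> Q"
    unfolding marginal_lik_def using z by (intro member_le_sum joint_lik_nonneg) auto
  finally show ?thesis .
qed

lemma pmf_posterior:
  "pmf (posterior n A \<alpha> Q) z =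
     (if z \<in> labelings n then joint_lik n A \<alpha> Q z / marginal_lik n A \<alpha> Q else 0)"
  unfolding posterior_def
proof (rule pmf_embed_pmf)
  let ?f = "\<lambda>z. if z \<in> labelings n then joint_lik n A \<alpha> Q z / marginal_lik n A \<alpha> Q else 0"
  have nn: "0 \<le> ?f z" for z
    using joint_lik_nonneg[of n A \<alpha> Q z] marginal_lik_pos[of n A \<alpha> Q] by simp
  show "0 \<le> ?f z" for z by (rule nn)
  have "(\<integral>\<^sup>+z. ennreal (?f z) \<partial>count_space UNIV) = (\<Sum>z\<in>labelings n. ennreal (?f z))"
    by (intro nn_integral_count_space') auto
  also have "\<dots> = ennreal (\<Sum>z\<in>labelings n. ?f z)"
    by (rule sum_ennreal) (rule nn)
  also have "(\<Sum>z\<in>labelings n. ?f z) = 1"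
    using marginal_lik_pos[of n A \<alpha> Q] by (simp add: marginal_lik_def flip: sum_divide_distrib)
  finally show "(\<integral>\<^sup>+z. ennreal (?f z) \<partial>count_space UNIV) = 1" by simp
qed


section \<open>Estimators\<close>

text \<open>
  The parameter sets are not closed, so for some \<open>A\<close> (for instance \<open>A = 0\<close>) no maximizer exists.
  The estimators are therefore characterized by the following predicates on a given \<open>A\<close>;
  \<open>selects P f\<close> says that \<open>f\<close> picks, for each \<open>A\<close>, one of the values allowed by
  \<open>P A\<close> whenever there is one.
\<close>

definition selects :: "('a \<Rightarrow> 'b \<Rightarrow> bool) \<Rightarrow> ('a \<Rightarrow> 'b) \<Rightarrow> bool" where
  "selects P f \<longleftrightarrow> (\<forall>A. (\<exists>z. P A z) \<longrightarrow> P A (f A))"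

definition is_mle ::
    "nat \<Rightarrow> (nat \<Rightarrow> nat \<Rightarrow> real) \<Rightarrow> (real^'k^'k) \<times> (nat \<Rightarrow> 'k::finite) \<Rightarrow> bool" where
  "is_mle n A = is_arg_max (\<lambda>(Q, z). log_lik n A z Q)
     (\<lambda>(Q, z). Q \<in> snd ` param_space \<and> z \<in> labelings n)"

definition is_mle_labels :: "nat \<Rightarrow> (nat \<Rightarrow> nat \<Rightarrow> real) \<Rightarrow> (nat \<Rightarrow> 'k::finite) \<Rightarrow> bool" where
  "is_mle_labels n A z \<longleftrightarrow> (\<exists>Q. is_mle n A (Q, z))"

definition product_law :: "nat \<Rightarrow> (nat \<Rightarrow> 'k::finite pmf) \<Rightarrow> (nat \<Rightarrow> 'k) pmf" where
  "product_law n \<tau> = Pi_pmf {1..n} undefined \<tau>"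

text \<open>The library's \<open>KL_divergence b M N\<close> is the divergence of \<open>N\<close> from \<open>M\<close>,
  usually written \<open>KL(N || M)\<close>.\<close>

definition variational_objective :: "nat \<Rightarrow> (nat \<Rightarrow> nat \<Rightarrow> real) \<Rightarrow> (nat \<Rightarrow> 'k::finite pmf)
    \<Rightarrow> 'k pmf \<Rightarrow> real^'k^'k \<Rightarrow> real" where
  "variational_objective n A \<tau> \<alpha> Q = ln (marginal_lik n A \<alpha> Q) -
     KL_divergence (exp 1) (measure_pmf (posterior n A \<alpha> Q)) (measure_pmf (product_law n \<tau>))"

definition is_variational_estimate ::
    "nat \<Rightarrow> (nat \<Rightarrow> nat \<Rightarrow> real) \<Rightarrow> 'k::finite pmf \<times> (real^'k^'k) \<times> (nat \<Rightarrow> 'k pmf) \<Rightarrow> bool" where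
  "is_variational_estimate n A = is_arg_max (\<lambda>(\<alpha>, Q, \<tau>). variational_objective n A \<tau> \<alpha> Q)
     (\<lambda>(\<alpha>, Q, \<tau>). (\<alpha>, Q) \<in> param_space)"

definition is_variational_labels :: "nat \<Rightarrow> (nat \<Rightarrow> nat \<Rightarrow> real) \<Rightarrow> (nat \<Rightarrow> 'k::finite) \<Rightarrow> bool" where
  "is_variational_labels n A z \<longleftrightarrow> z \<in> labelings n \<and>
     (\<exists>\<alpha> Q \<tau>. is_variational_estimate n A (\<alpha>, Q, \<tau>) \<and>
        (\<forall>i\<in>{1..n}. is_arg_max (pmf (\<tau> i)) (\<lambda>_. True) (z i)))"

definition block_pairs :: "nat \<Rightarrow> (nat \<Rightarrow> 'k::finite) \<Rightarrow> 'k \<Rightarrow> 'k \<Rightarrow> (nat \<times> nat) set" where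
  "block_pairs n z a b = {(i, j). i \<in> {1..n} \<and> j \<in> {1..n} \<and> z i = a \<and> z j = b \<and> i \<noteq> j}"

text \<open>The entry of a block without pairs is \<open>0 / 0 = 0\<close>; it does not occur in
  \<open>estimated_probs\<close> at nodes of the graph.\<close>

definition block_averages :: "nat \<Rightarrow> (nat \<Rightarrow> nat \<Rightarrow> real) \<Rightarrow> (nat \<Rightarrow> 'k::finite) \<Rightarrow> real^'k^'k" where
  "block_averages n A z =
     (\<chi> a b. (\<Sum>(i, j)\<in>block_pairs n z a b. A i j) / real (card (block_pairs n z a b)))"

definition estimated_probs :: "nat \<Rightarrow> (nat \<Rightarrow> nat \<Rightarrow> real) \<Rightarrow> (nat \<Rightarrow> 'k::finite)
    \<Rightarrow> nat \<Rightarrow> nat \<Rightarrow> real" where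
  "estimated_probs n A z = block_matrix (block_averages n A z) z"

definition same_up_to_relabeling :: "nat \<Rightarrow> (nat \<Rightarrow> 'k::finite) \<Rightarrow> (nat \<Rightarrow> 'k) \<Rightarrow> bool" where
  "same_up_to_relabeling n z z' \<longleftrightarrow> (\<exists>\<sigma>. bij \<sigma> \<and> (\<forall>i\<in>{1..n}. z' i = \<sigma> (z i)))"

definition frobenius_norm :: "nat \<Rightarrow> (nat \<Rightarrow> nat \<Rightarrow> real) \<Rightarrow> real" where
  "frobenius_norm n M = sqrt (\<Sum>i\<in>{1..n}. \<Sum>j\<in>{1..n}. (M i j)\<^sup>2)"

text \<open>Sanity check: on the finite label space, the divergence is the usual sum.\<close>

lemma KL_divergence_posterior:
  assumes pos: "\<And>a. 0 < pmf \<alpha> a"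
  shows "KL_divergence (exp 1) (measure_pmf (posterior n A \<alpha> Q)) (measure_pmf (product_law n \<tau>)) =
    (\<Sum>z\<in>labelings n. pmf (product_law n \<tau>) z *
       ln (pmf (product_law n \<tau>) z / pmf (posterior n A \<alpha> Q) z))"
proof -
  let ?p = "posterior n A \<alpha> Q" and ?q = "product_law n \<tau>"
  define f where "f z = pmf ?q z / pmf ?p z" for z
  have p0: "0 < pmf ?p z" if "z \<in> labelings n" for z
    using that pos marginal_lik_pos[of n A \<alpha> Q]
    by (auto simp: pmf_posterior joint_lik_def intro!: divide_pos_pos mult_pos_pos prod_pos)
  have q0: "pmf ?q z = 0" if "z \<notin> labelings n" for z
    using that unfolding product_law_def labelings_def
    by (auto simp: pmf_Pi PiE_def extensional_def)
  have fp: "pmf ?p z * f z = pmf ?q z" for z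
    using p0[of z] q0[of z] unfolding f_def by (cases "z \<in> labelings n") auto
  have fnn: "0 \<le> f z" for z by (simp add: f_def)
  have dens: "density (measure_pmf ?p) (\<lambda>z. ennreal (f z)) = measure_pmf ?q"
    unfolding measure_pmf_eq_density[of ?p] measure_pmf_eq_density[of ?q]
    by (subst density_density_eq) (auto simp: fp fnn simp flip: ennreal_mult)
  have "KL_divergence (exp 1) (measure_pmf ?p) (density (measure_pmf ?p) (\<lambda>z. ennreal (f z))) =
      (\<integral>z. f z * log (exp 1) (f z) \<partial>measure_pmf ?p)"
    by (rule sigma_finite_measure.KL_density) (auto simp: fnn intro: measure_pmf.sigma_finite_measure_axioms)
  also have "\<dots> = (\<Sum>z\<in>labelings n. (f z * log (exp 1) (f z)) * pmf ?p z)"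
    by (rule integral_measure_pmf_real)
      (auto simp: set_pmf_eq pmf_posterior split: if_splits)
  also have "\<dots> = (\<Sum>z\<in>labelings n. pmf ?q z * ln (f z))"
    by (intro sum.cong refl) (simp add: log_def flip: fp)
  finally show ?thesis unfolding dens unfolding f_def .
qed


section \<open>The asymptotic regime\<close>

definition sbm_regime :: "'k::finite pmf \<Rightarrow> real^'k^'k \<Rightarrow> (nat \<Rightarrow> real) \<Rightarrow> bool" where
  "sbm_regime \<alpha> Q \<rho> \<longleftrightarrow>
     (\<forall>a. 0 < pmf \<alpha> a) \<and>
     (\<Sum>a\<in>UNIV. \<Sum>b\<in>UNIV. pmf \<alpha> a * pmf \<alpha> b * Q $ a $ b) = 1 \<and>
     (\<forall>n\<ge>1. 0 < \<rho> n) \<and> antimono_on {1..} \<rho> \<and>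
     (\<forall>n\<ge>1. \<forall>a b. 0 < \<rho> n * Q $ a $ b \<and> \<rho> n * Q $ a $ b < 1) \<and>
     filterlim (\<lambda>n. \<rho> n * real n / ln (real n)) at_top sequentially"

end

theory Submission
  imports Defs "HOL-Real_Asymp.Real_Asymp"
begin

text \<open>
  Both label estimators recover the true labels \<open>y\<close> exactly, up to a relabeling of the
  communities, with probability tending to one; the two claims follow from this.

  Fix a competitor: labels \<open>z\<close> with a matrix \<open>Q\<close>. Let \<open>D\<close> be the sum over the pairs of nodes of the
  squared differences of the square roots of the true edge probability and of the one given by \<open>z\<close>
  and \<open>Q\<close>. Markov's inequality for the square root of the likelihood ratio shows that the competitor
  comes within a factor \<open>exp (- D / 2)\<close> of the true likelihood with probability at most
  \<open>exp (- D / 4)\<close> (\<open>hellinger_test\<close>). Since no two columns of \<open>Q0\<close> agree, \<open>D\<close> is at least a constant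
  times \<open>n \<rho>\<close> times the number \<open>d\<close> of errors of \<open>z\<close> after the best relabeling (\<open>soft_separation\<close>,
  \<open>hellinger_dist_ge_errors\<close>). For given labels the likelihood is largest at the block averages
  (\<open>log_lik_le_block_averages\<close>), which are fractions with terms at most \<open>n\<^sup>2\<close>, so polynomially many
  matrices matter; and the sum of \<open>exp (- x d)\<close> over all wrong labelings is about \<open>n k exp (- x)\<close>
  (\<open>sum_exp_errors_le\<close>). As \<open>\<rho> n / ln n\<close> diverges, a union bound over all competitors succeeds
  (\<open>prob_some_rival_le\<close>): with high probability every labeling with \<open>d\<close> errors loses at least
  \<open>g d\<close> in log-likelihood against \<open>y\<close>, where \<open>g\<close> is of order \<open>n \<rho>\<close>. This is the property
  \<open>separated\<close>, and it settles the maximum likelihood labels at once.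

  The variational objective is the mean of the log-likelihood under the product law of \<open>\<tau>\<close> plus an
  entropy term (\<open>variational_objective_eq_elbo\<close>). Let \<open>m\<close> be the total mass that \<open>\<tau>\<close> puts on wrong
  labels, after a relabeling. The mean number of errors is at least a constant times \<open>m\<close>: it
  dominates the mean number of pairs of nodes on which \<open>z\<close> and \<open>y\<close> disagree about being in the same
  community, divided by \<open>2 n\<close>, and \<open>soft_separation\<close> with the identity matrix bounds the latter
  from below. So leaving the point mass at \<open>y\<close> costs of order \<open>n \<rho> m\<close> in likelihood, while the
  entropy term gains at most \<open>(2 ln n + const) m + k / n\<close> (\<open>entropy_sum_le\<close>). A maximizer
  therefore has \<open>m \<le> 1 / 3\<close>, each \<open>\<tau> i\<close> gives its correct label more than half of the mass, and the
  most likely labels are correct. The same comparison keeps the parameters of every good candidate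
  away from \<open>0\<close> and \<open>1\<close>, so that a maximizer exists by compactness.

  Finally, the tests with \<open>z = y\<close> show that the block averages at the true labels are within
  \<open>D = O(ln n)\<close> of the true matrix (\<open>close_averages\<close>). This puts them inside \<open>(0, 1)\<close>, and it bounds the
  squared Frobenius error by \<open>O(\<rho> ln n)\<close>, which is far below \<open>\<rho> n\<close>; so even \<open>C = 1\<close> works.
\<close>

section \<open>Testing one set of edge probabilities against another\<close>

definition edge_lik :: "'e set \<Rightarrow> ('e \<Rightarrow> real) \<Rightarrow> ('e \<Rightarrow> bool) \<Rightarrow> real" where
  "edge_lik E \<theta> e = (\<Prod>x\<in>E. if e x then \<theta> x else 1 - \<theta> x)"

text \<open>
  The affinity of two Bernoulli laws is one minus half the sum of the squared root differences of
  both outcomes; keeping the outcome \<open>True\<close> alone preserves the scaling with small \<open>p\<close> and \<open>q\<close>, which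
  is what matters in sparse graphs.
\<close>

lemma bernoulli_affinity_le:
  fixes p q :: real
  assumes "0 \<le> p" "p \<le> 1" "0 \<le> q" "q \<le> 1"
  shows "sqrt (p * q) + sqrt ((1 - p) * (1 - q)) \<le> exp (- ((sqrt p - sqrt q)\<^sup>2 / 2))"
proof -
  have "sqrt (p * q) = (p + q - (sqrt p - sqrt q)\<^sup>2) / 2"
    using assms by (simp add: power2_diff real_sqrt_mult)
  moreover have "sqrt ((1 - p) * (1 - q)) \<le> ((1 - p) + (1 - q)) / 2"
    using assms by (intro arith_geo_mean_sqrt) auto
  ultimately have "sqrt (p * q) + sqrt ((1 - p) * (1 - q)) \<le> 1 + (- ((sqrt p - sqrt q)\<^sup>2 / 2))"
    by (simp add: field_simps)
  also have "\<dots> \<le> exp (- ((sqrt p - sqrt q)\<^sup>2 / 2))" by (rule exp_ge_add_one_self)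
  finally show ?thesis .
qed

text \<open>
  The square root of the likelihood ratio is a product of independent factors whose means are the
  affinities, hence has mean at most \<open>exp (- D / 2)\<close> under \<open>p\<close>; on the event it is at least
  \<open>exp (- D / 4)\<close>. The law \<open>q\<close> may charge only one of the two outcomes, which is necessary for block
  averages.
\<close>

lemma hellinger_test:
  fixes p q :: "'e \<Rightarrow> real"
  assumes fin: "finite E" and p: "\<And>x. x \<in> E \<Longrightarrow> 0 < p x \<and> p x < 1"
    and q: "\<And>x. x \<in> E \<Longrightarrow> 0 \<le> q x \<and> q x \<le> 1"
  defines "D \<equiv> (\<Sum>x\<in>E. (sqrt (p x) - sqrt (q x))\<^sup>2)"
  shows "measure_pmf.prob (Pi_pmf E False (\<lambda>x. bernoulli_pmf (p x)))
      {e. edge_lik E p e * exp (- (D / 2)) \<le> edge_lik E q e} \<le> exp (- (D / 4))"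
proof -
  let ?P = "Pi_pmf E False (\<lambda>x. bernoulli_pmf (p x))"
  define g where "g x b = sqrt (if b then q x / p x else (1 - q x) / (1 - p x))" for x b
  have g0: "0 \<le> g x b" if "x \<in> E" for x b
    using p[OF that] q[OF that] by (auto simp: g_def)
  define f where "f e = (\<Prod>x\<in>E. g x (e x))" for e
  have f0: "0 \<le> f e" for e unfolding f_def by (intro prod_nonneg) (auto simp: g0)
  have fin_set: "finite (set_pmf ?P)"
    by (rule finite_subset[OF set_Pi_pmf_subset'])
       (auto simp: fin intro!: finite_PiE_dflt)
  have "measure_pmf.expectation ?P f =
      (\<Prod>x\<in>E. measure_pmf.expectation (bernoulli_pmf (p x)) (g x))"
    unfolding f_def by (rule expectation_prod_Pi_pmf) (auto simp: fin g0 intro: integrable_measure_pmf_finite)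
  also have "\<dots> \<le> (\<Prod>x\<in>E. exp (- ((sqrt (p x) - sqrt (q x))\<^sup>2 / 2)))"
  proof (rule prod_mono, intro conjI)
    fix x assume x: "x \<in> E"
    note px = p[OF x] and qx = q[OF x]
    have sq: "r * sqrt (s / r) = sqrt (r * s)" if "0 < r" "0 \<le> s" for r s :: real
    proof -
      have "r * sqrt (s / r) = sqrt r * sqrt r * (sqrt s / sqrt r)"
        using that by (simp add: real_sqrt_divide del: real_sqrt_mult_self) (simp add: field_simps)
      also have "\<dots> = sqrt r * sqrt s" using that by (simp add: field_simps del: real_sqrt_mult_self)
      finally show ?thesis by (simp add: real_sqrt_mult)
    qed
    have eq: "measure_pmf.expectation (bernoulli_pmf (p x)) (g x) =
        sqrt (p x * q x) + sqrt ((1 - p x) * (1 - q x))"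
      using px qx sq[of "p x" "q x"] sq[of "1 - p x" "1 - q x"]
      by (simp add: g_def mult.commute)
    show "0 \<le> measure_pmf.expectation (bernoulli_pmf (p x)) (g x)"
      using px qx unfolding eq by simp
    show "measure_pmf.expectation (bernoulli_pmf (p x)) (g x)
        \<le> exp (- ((sqrt (p x) - sqrt (q x))\<^sup>2 / 2))"
      unfolding eq using px qx by (intro bernoulli_affinity_le) auto
  qed
  also have "\<dots> = exp (- (D / 2))"
    using fin by (simp add: D_def sum_divide_distrib sum_negf flip: exp_sum)
  finally have Ef: "measure_pmf.expectation ?P f \<le> exp (- (D / 2))" .
  have sub: "{e. edge_lik E p e * exp (- (D / 2)) \<le> edge_lik E q e} \<subseteq> {e. exp (- (D / 4)) \<le> f e}"
  proof safe
    fix e assume le: "edge_lik E p e * exp (- (D / 2)) \<le> edge_lik E q e"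
    have pp: "0 < edge_lik E p e" unfolding edge_lik_def using p by (intro prod_pos) auto
    have feq: "f e = sqrt (edge_lik E q e / edge_lik E p e)"
    proof -
      have "f e = sqrt (\<Prod>x\<in>E. if e x then q x / p x else (1 - q x) / (1 - p x))"
        unfolding f_def g_def by (induction E rule: infinite_finite_induct) (auto simp: real_sqrt_mult)
      also have "(\<Prod>x\<in>E. if e x then q x / p x else (1 - q x) / (1 - p x)) =
          edge_lik E q e / edge_lik E p e"
        unfolding edge_lik_def by (subst prod_dividef[symmetric]) (intro prod.cong, auto)
      finally show ?thesis .
    qed
    have "exp (- (D / 4)) = sqrt (exp (- (D / 2)))"
      by (rule real_sqrt_unique[symmetric]) (auto simp flip: exp_of_nat_mult)
    also have "\<dots> \<le> f e" unfolding feq using le pp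
      by (intro real_sqrt_le_mono) (simp add: field_simps)
    finally show "exp (- (D / 4)) \<le> f e" .
  qed
  have "measure_pmf.prob ?P {e. edge_lik E p e * exp (- (D / 2)) \<le> edge_lik E q e}
      \<le> measure_pmf.prob ?P {e. exp (- (D / 4)) \<le> f e}"
    by (rule measure_pmf.finite_measure_mono[OF sub]) auto
  also have "\<dots> \<le> measure_pmf.expectation ?P f / exp (- (D / 4))"
    using integral_Markov_inequality_measure[of "measure_pmf ?P" f "{}" "exp (- (D / 4))"]
    by (simp add: f0 integrable_measure_pmf_finite[OF fin_set])
  also have "\<dots> \<le> exp (- (D / 2)) / exp (- (D / 4))" by (intro divide_right_mono Ef) auto
  also have "\<dots> = exp (- (D / 4))" by (simp flip: exp_diff)
  finally show ?thesis .
qed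

section \<open>Sums over labelings\<close>

definition errors :: "nat \<Rightarrow> (nat \<Rightarrow> 'k) \<Rightarrow> (nat \<Rightarrow> 'k) \<Rightarrow> nat" where
  "errors n z y = card {i \<in> {1..n}. z i \<noteq> y i}"

lemma errors_eq_0_iff: "errors n z y = 0 \<longleftrightarrow> (\<forall>i\<in>{1..n}. z i = y i)"
  unfolding errors_def by auto

text \<open>
  The weight \<open>exp (- x d)\<close> is a product over the nodes, so the sum over all labelings factorizes
  into \<open>(1 + (k - 1) exp (- x)) ^ n\<close>; the labeling without errors contributes the \<open>1\<close> that is subtracted.
\<close>

lemma sum_exp_errors_le:
  fixes y :: "nat \<Rightarrow> 'k::finite"
  shows "(\<Sum>z\<in>{z\<in>labelings n. errors n z y \<noteq> 0}. exp (- (x * real (errors n z y))))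
    \<le> exp (real n * (real CARD('k) * exp (- x))) - 1"
proof -
  define c where "c i a = (if a \<noteq> y i then exp (- x) else 1)" for i a
  have ex: "exp (- (x * real (errors n z y))) = (\<Prod>i\<in>{1..n}. c i (z i))" for z
  proof -
    have "(\<Prod>i\<in>{1..n}. c i (z i)) = (\<Prod>i\<in>{i\<in>{1..n}. z i \<noteq> y i}. exp (- x))"
      unfolding c_def by (subst prod.inter_filter) auto
    also have "\<dots> = exp (- (x * real (errors n z y)))"
      by (simp add: errors_def mult.commute flip: exp_of_nat_mult)
    finally show ?thesis by simp
  qed
  let ?y = "restrict y {1..n}"
  have y: "?y \<in> labelings n" "errors n ?y y = 0"
    by (auto simp: labelings_def errors_eq_0_iff)
  have "1 + (\<Sum>z\<in>{z\<in>labelings n. errors n z y \<noteq> 0}. exp (- (x * real (errors n z y))))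
      = (\<Sum>z\<in>insert ?y {z\<in>labelings n. errors n z y \<noteq> 0}. exp (- (x * real (errors n z y))))"
    using y by (subst sum.insert) auto
  also have "\<dots> \<le> (\<Sum>z\<in>labelings n. exp (- (x * real (errors n z y))))"
    using y by (intro sum_mono2) auto
  also have "\<dots> = (\<Prod>i\<in>{1..n}. \<Sum>a\<in>UNIV. c i a)"
    unfolding ex labelings_def by (subst prod_sum_PiE) auto
  also have "\<dots> \<le> (\<Prod>i\<in>{1..n}. exp (real CARD('k) * exp (- x)))"
  proof (rule prod_mono, intro conjI)
    fix i
    show "0 \<le> sum (c i) UNIV" by (intro sum_nonneg) (auto simp: c_def)
    have "sum (c i) UNIV = c i (y i) + sum (c i) (UNIV - {y i})"
      by (rule sum.remove) auto
    also have "sum (c i) (UNIV - {y i}) = (\<Sum>a\<in>UNIV - {y i}. exp (- x))"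
      by (intro sum.cong) (auto simp: c_def)
    also have "\<dots> \<le> (\<Sum>a\<in>(UNIV :: 'k set). exp (- x))" by (intro sum_mono2) auto
    also have "c i (y i) + \<dots> = 1 + real CARD('k) * exp (- x)" by (simp add: c_def)
    also have "\<dots> \<le> exp (real CARD('k) * exp (- x))" by (rule exp_ge_add_one_self)
    finally show "sum (c i) UNIV \<le> exp (real CARD('k) * exp (- x))" by simp
  qed
  also have "\<dots> = exp (real n * (real CARD('k) * exp (- x)))"
    by (simp flip: exp_of_nat_mult)
  finally show ?thesis by simp
qed

section \<open>Separation of labelings\<close>

text \<open>
  The key combinatorial estimate. Each node \<open>i\<close> carries a true label \<open>z i\<close> and a random label with
  law \<open>\<tau> i\<close>; the right-hand side is the mean squared error when the matrix \<open>w\<close> at the true labels is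
  fitted by a matrix \<open>v\<close> at independent random labels.

  Let \<open>M c a\<close> be the mass that the nodes of class \<open>a\<close> put on the label \<open>c\<close>, and let \<open>s a\<close> be a label
  with \<open>M (s a) a \<ge> 2 \<mu>\<close>, where \<open>\<mu>\<close> has order \<open>n\<close>. If \<open>s\<close> merges two classes, or if it is a bijection
  but \<open>v\<close> differs from \<open>w\<close> by \<open>\<delta> / 2\<close> somewhere along \<open>s\<close>, the error has order \<open>n\<^sup>2\<close>. Otherwise \<open>v\<close> agrees
  with \<open>w\<close> along \<open>s\<close> up to \<open>\<delta> / 2\<close>; then mass of a class \<open>a\<close> on the label of another class \<open>a'\<close> sees an
  error of at least \<open>\<delta> / 2\<close> against a whole class \<open>b\<close> that distinguishes \<open>a\<close> from \<open>a'\<close>.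

  It is used twice: with point masses \<open>\<tau>\<close> to compare labelings, and with the identity matrix for \<open>w\<close>
  and \<open>v\<close> to compare a variational law \<open>\<tau>\<close> with the true labels.
\<close>

lemma soft_separation:
  fixes w v :: "'k::finite \<Rightarrow> 'k \<Rightarrow> real" and \<tau> :: "'v \<Rightarrow> 'k \<Rightarrow> real" and z :: "'v \<Rightarrow> 'k"
  assumes fin: "finite V"
    and tau0: "\<And>i a. i \<in> V \<Longrightarrow> 0 \<le> \<tau> i a" and tau1: "\<And>i. i \<in> V \<Longrightarrow> (\<Sum>a\<in>UNIV. \<tau> i a) = 1"
    and beta: "0 < \<beta>" "\<beta> \<le> 1" and delta: "0 < \<delta>"
    and sizes: "\<And>a. \<beta> * real (card V) \<le> real (card {i\<in>V. z i = a})"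
    and big: "2 * real CARD('k) \<le> \<beta> * real (card V)"
    and sep: "\<And>a a'. a \<noteq> a' \<Longrightarrow> \<exists>b. \<delta> \<le> \<bar>w a b - w a' b\<bar>"
  shows "\<exists>\<sigma>. bij \<sigma> \<and>
    \<beta>\<^sup>2 * \<delta>\<^sup>2 / (8 * (real CARD('k))\<^sup>2) * real (card V) * (\<Sum>i\<in>V. 1 - \<tau> i (\<sigma> (z i)))
      \<le> (\<Sum>i\<in>V. \<Sum>j\<in>V-{i}. \<Sum>c\<in>UNIV. \<Sum>d\<in>UNIV. \<tau> i c * \<tau> j d * (w (z i) (z j) - v c d)\<^sup>2)"
proof -
  let ?k = "real CARD('k)" and ?n = "real (card V)"
  have k1: "1 \<le> ?k" by (simp add: Suc_leI)
  define \<mu> where "\<mu> = \<beta> * ?n / (2 * ?k)"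
  have mu1: "1 \<le> \<mu>" using big k1 by (simp add: \<mu>_def field_simps)
  have npos: "0 < ?n" using big k1 beta by (smt (verit) zero_less_mult_pos)
  define cls where "cls a = {i\<in>V. z i = a}" for a
  have fcls [simp]: "finite (cls a)" for a using fin by (simp add: cls_def)
  define M where "M c a = (\<Sum>i\<in>cls a. \<tau> i c)" for c a
  have M0: "0 \<le> M c a" for c a unfolding M_def by (intro sum_nonneg tau0) (auto simp: cls_def)
  have tau_le1: "\<tau> i a \<le> 1" if "i \<in> V" for i a
    using member_le_sum[of a UNIV "\<tau> i"] tau0[OF that] tau1[OF that] by auto
  have Msum: "(\<Sum>c\<in>UNIV. M c a) = real (card (cls a))" for a
    unfolding M_def by (subst sum.swap) (simp add: tau1 cls_def)
  have sumV: "(\<Sum>i\<in>V. f i) = (\<Sum>a\<in>UNIV. \<Sum>i\<in>cls a. f i)" for f :: "'v \<Rightarrow> real"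
    unfolding cls_def by (rule sum.group[symmetric]) (auto simp: fin)
  have "\<exists>c. 2 * \<mu> \<le> M c a" for a
  proof (rule ccontr)
    assume "\<nexists>c. 2 * \<mu> \<le> M c a"
    then have "(\<Sum>c\<in>UNIV. M c a) < (\<Sum>c\<in>(UNIV::'k set). 2 * \<mu>)"
      by (intro sum_strict_mono) (auto simp: not_le)
    then show False using sizes[of a] k1 by (simp add: Msum \<mu>_def cls_def)
  qed
  then obtain s where s: "\<And>a. 2 * \<mu> \<le> M (s a) a" by metis
  define S where "S = (\<Sum>i\<in>V. \<Sum>j\<in>V-{i}. \<Sum>c\<in>UNIV. \<Sum>d\<in>UNIV. \<tau> i c * \<tau> j d * (w (z i) (z j) - v c d)\<^sup>2)"
  \<comment> \<open>A node is not paired with itself, which costs at most \<open>1\<close> of the mass \<open>M d b\<close>.\<close>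
  define t where "t a b c d = M c a * max 0 (M d b - 1) * (w a b - v c d)\<^sup>2" for a b c d
  have t0: "0 \<le> t a b c d" for a b c d unfolding t_def by (simp add: M0)
  have S_ge: "(\<Sum>a\<in>UNIV. \<Sum>c\<in>UNIV. \<Sum>b\<in>UNIV. \<Sum>d\<in>UNIV. t a b c d) \<le> S"
  proof -
    have one: "max 0 (M d b - 1) \<le> (\<Sum>j\<in>cls b - {i}. \<tau> j d)" for i b d
    proof -
      have "M d b \<le> (\<Sum>j\<in>cls b - {i}. \<tau> j d) + 1"
      proof (cases "i \<in> cls b")
        case True
        then show ?thesis unfolding M_def
          using tau_le1[of i d] by (subst sum.remove[of _ i]) (auto simp: cls_def fin)
      next
        case False
        then show ?thesis by (simp add: M_def)
      qed
      moreover have "0 \<le> (\<Sum>j\<in>cls b - {i}. \<tau> j d)" by (intro sum_nonneg tau0) (auto simp: cls_def)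
      ultimately show ?thesis by simp
    qed
    have inner: "(\<Sum>j\<in>V-{i}. f j) = (\<Sum>b\<in>UNIV. \<Sum>j\<in>cls b - {i}. f j)" for f :: "'v \<Rightarrow> real" and i
    proof -
      have "(\<Sum>b\<in>UNIV. \<Sum>j\<in>{x \<in> V - {i}. z x = b}. f j) = (\<Sum>j\<in>V-{i}. f j)"
        by (rule sum.group) (auto simp: fin)
      moreover have "{x \<in> V - {i}. z x = b} = cls b - {i}" for b by (auto simp: cls_def)
      ultimately show ?thesis by simp
    qed
    have "(\<Sum>a\<in>UNIV. \<Sum>c\<in>UNIV. \<Sum>b\<in>UNIV. \<Sum>d\<in>UNIV. t a b c d)
       = (\<Sum>a\<in>UNIV. \<Sum>i\<in>cls a. \<Sum>c\<in>UNIV. \<Sum>b\<in>UNIV. \<Sum>d\<in>UNIV.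
            \<tau> i c * max 0 (M d b - 1) * (w a b - v c d)\<^sup>2)"
      unfolding t_def M_def[of _ a for a]
      by (subst (2) sum.swap) (simp add: sum_distrib_left sum_distrib_right M_def sum.swap[of _ _ "cls _"])
    also have "\<dots> \<le> (\<Sum>a\<in>UNIV. \<Sum>i\<in>cls a. \<Sum>c\<in>UNIV. \<Sum>b\<in>UNIV. \<Sum>d\<in>UNIV.
            \<tau> i c * (\<Sum>j\<in>cls b - {i}. \<tau> j d) * (w a b - v c d)\<^sup>2)"
      by (intro sum_mono mult_right_mono mult_left_mono one tau0) (auto simp: cls_def)
    also have "\<dots> = (\<Sum>a\<in>UNIV. \<Sum>i\<in>cls a. \<Sum>b\<in>UNIV. \<Sum>j\<in>cls b - {i}. \<Sum>c\<in>UNIV. \<Sum>d\<in>UNIV.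
            \<tau> i c * \<tau> j d * (w a b - v c d)\<^sup>2)"
    proof (rule sum.cong[OF refl], rule sum.cong[OF refl])
      fix a i
      have "(\<Sum>c\<in>UNIV. \<Sum>b\<in>UNIV. \<Sum>d\<in>UNIV. \<tau> i c * (\<Sum>j\<in>cls b - {i}. \<tau> j d) * (w a b - v c d)\<^sup>2)
         = (\<Sum>c\<in>UNIV. \<Sum>b\<in>UNIV. \<Sum>d\<in>UNIV. \<Sum>j\<in>cls b - {i}. \<tau> i c * \<tau> j d * (w a b - v c d)\<^sup>2)"
        by (simp add: sum_distrib_left sum_distrib_right)
      also have "\<dots> = (\<Sum>c\<in>UNIV. \<Sum>b\<in>UNIV. \<Sum>j\<in>cls b - {i}. \<Sum>d\<in>UNIV. \<tau> i c * \<tau> j d * (w a b - v c d)\<^sup>2)"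
        by (intro sum.cong refl sum.swap)
      also have "\<dots> = (\<Sum>b\<in>UNIV. \<Sum>c\<in>UNIV. \<Sum>j\<in>cls b - {i}. \<Sum>d\<in>UNIV. \<tau> i c * \<tau> j d * (w a b - v c d)\<^sup>2)"
        by (rule sum.swap)
      also have "\<dots> = (\<Sum>b\<in>UNIV. \<Sum>j\<in>cls b - {i}. \<Sum>c\<in>UNIV. \<Sum>d\<in>UNIV. \<tau> i c * \<tau> j d * (w a b - v c d)\<^sup>2)"
        by (intro sum.cong refl sum.swap)
      finally show "(\<Sum>c\<in>UNIV. \<Sum>b\<in>UNIV. \<Sum>d\<in>UNIV. \<tau> i c * (\<Sum>j\<in>cls b - {i}. \<tau> j d) * (w a b - v c d)\<^sup>2)
         = (\<Sum>b\<in>UNIV. \<Sum>j\<in>cls b - {i}. \<Sum>c\<in>UNIV. \<Sum>d\<in>UNIV. \<tau> i c * \<tau> j d * (w a b - v c d)\<^sup>2)" .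
    qed
    also have "\<dots> = S"
      unfolding S_def sumV inner by (intro sum.cong refl) (auto simp: cls_def)
    finally show ?thesis .
  qed
  define Sac where "Sac a c = (\<Sum>b\<in>UNIV. \<Sum>d\<in>UNIV. t a b c d)" for a c
  have Sac0: "0 \<le> Sac a c" for a c unfolding Sac_def by (intro sum_nonneg t0)
  have t_Sac: "t a b c d \<le> Sac a c" for a b c d
  proof -
    have "t a b c d \<le> (\<Sum>d\<in>UNIV. t a b c d)" by (rule member_le_sum) (auto simp: t0)
    also have "\<dots> \<le> Sac a c" unfolding Sac_def by (rule member_le_sum) (auto simp: t0 intro: sum_nonneg)
    finally show ?thesis .
  qed
  have S_Sac: "(\<Sum>a\<in>UNIV. \<Sum>c\<in>UNIV. Sac a c) \<le> S" using S_ge by (simp add: Sac_def)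
  have Sac_S: "(\<Sum>a\<in>X. Sac a c) \<le> S" for X c
  proof -
    have "(\<Sum>a\<in>X. Sac a c) \<le> (\<Sum>a\<in>UNIV. Sac a c)" by (intro sum_mono2) (auto simp: Sac0)
    also have "\<dots> \<le> (\<Sum>a\<in>UNIV. \<Sum>c\<in>UNIV. Sac a c)"
      by (intro sum_mono member_le_sum) (auto simp: Sac0)
    finally show ?thesis using S_Sac by simp
  qed
  have ts: "M c a * \<mu> * (w a b - v c (s b))\<^sup>2 \<le> t a b c (s b)" for a b c
    unfolding t_def using s[of b] mu1 by (intro mult_right_mono mult_left_mono M0) auto
  \<comment> \<open>The misplaced mass is at most \<open>n\<close>, so a loss of order \<open>n\<^sup>2\<close> is enough, whatever
    \<open>\<sigma>\<close> is.\<close>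
  have whole: ?thesis if le: "\<mu>\<^sup>2 * \<delta>\<^sup>2 / 2 \<le> S" and bij: "bij \<sigma>" for \<sigma> :: "'k \<Rightarrow> 'k"
  proof (intro exI[of _ \<sigma>] conjI bij)
    have "(\<Sum>i\<in>V. 1 - \<tau> i (\<sigma> (z i))) \<le> (\<Sum>i\<in>V. 1)"
      by (intro sum_mono) (simp add: tau0)
    then have "\<beta>\<^sup>2 * \<delta>\<^sup>2 / (8 * ?k\<^sup>2) * ?n * (\<Sum>i\<in>V. 1 - \<tau> i (\<sigma> (z i)))
      \<le> \<beta>\<^sup>2 * \<delta>\<^sup>2 / (8 * ?k\<^sup>2) * ?n * ?n"
      by (intro mult_left_mono) auto
    also have "\<dots> = \<mu>\<^sup>2 * \<delta>\<^sup>2 / 2" by (simp add: \<mu>_def power2_eq_square)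
    finally show "\<beta>\<^sup>2 * \<delta>\<^sup>2 / (8 * ?k\<^sup>2) * ?n * (\<Sum>i\<in>V. 1 - \<tau> i (\<sigma> (z i))) \<le> (\<Sum>i\<in>V. \<Sum>j\<in>V-{i}. \<Sum>c\<in>UNIV. \<Sum>d\<in>UNIV. \<tau> i c * \<tau> j d * (w (z i) (z j) - v c d)\<^sup>2)"
      using le unfolding S_def by (rule order_trans)
  qed
  show ?thesis
  proof (cases "inj s")
    case False
    then obtain a a' where aa: "a \<noteq> a'" "s a = s a'" by (auto simp: inj_def)
    then obtain b where b: "\<delta> \<le> \<bar>w a b - w a' b\<bar>" using sep by blast
    define x where "x = v (s a) (s b)"
    have "\<delta>\<^sup>2 \<le> (w a b - w a' b)\<^sup>2" using b delta by (metis abs_le_square_iff abs_of_pos)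
    also have "\<dots> \<le> 2 * ((w a b - x)\<^sup>2 + (w a' b - x)\<^sup>2)"
      using zero_le_power2[of "(w a b - x) + (w a' b - x)"] by (simp add: power2_eq_square algebra_simps)
    finally have dd: "\<delta>\<^sup>2 \<le> 2 * ((w a b - x)\<^sup>2 + (w a' b - x)\<^sup>2)" .
    have one: "\<mu> * \<mu> * (w e b - x)\<^sup>2 \<le> Sac e (s a)" if "s e = s a" for e
    proof -
      have "\<mu> \<le> M (s a) e" using s[of e] mu1 that by simp
      then have "\<mu> * \<mu> * (w e b - x)\<^sup>2 \<le> M (s a) e * \<mu> * (w e b - x)\<^sup>2"
        using mu1 by (intro mult_right_mono) auto
      also have "\<dots> \<le> Sac e (s a)" unfolding x_def by (rule order_trans[OF ts t_Sac])
      finally show ?thesis .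
    qed
    have "\<mu>\<^sup>2 * \<delta>\<^sup>2 / 2 \<le> \<mu>\<^sup>2 * ((w a b - x)\<^sup>2 + (w a' b - x)\<^sup>2)"
      using mult_left_mono[OF dd, of "\<mu>\<^sup>2"] by (simp add: algebra_simps)
    also have "\<dots> \<le> (\<Sum>e\<in>{a,a'}. Sac e (s a))"
      using one[of a] one[of a'] aa by (simp add: power2_eq_square algebra_simps)
    also have "\<dots> \<le> S" by (rule Sac_S)
    finally show ?thesis by (rule whole[of id]) (rule bij_id)
  next
    case True
    then have bij: "bij s" by (simp add: finite_UNIV_inj_surj bij_def)
    show ?thesis
    proof (cases "\<exists>a b. \<delta> / 2 \<le> \<bar>w a b - v (s a) (s b)\<bar>")
      case True
      then obtain a b where ab: "\<delta> / 2 \<le> \<bar>w a b - v (s a) (s b)\<bar>" by blast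
      have sq: "\<delta>\<^sup>2 / 4 \<le> (w a b - v (s a) (s b))\<^sup>2"
        using power_mono[OF ab, of 2] delta by (simp add: power_divide)
      have "\<mu>\<^sup>2 * \<delta>\<^sup>2 / 2 = 2 * \<mu> * \<mu> * (\<delta>\<^sup>2 / 4)" by (simp add: power2_eq_square)
      also have "\<dots> \<le> M (s a) a * \<mu> * (w a b - v (s a) (s b))\<^sup>2"
        using s[of a] mu1 sq M0[of "s a" a] by (intro mult_mono) auto
      also have "\<dots> \<le> Sac a (s a)" by (rule order_trans[OF ts t_Sac])
      also have "\<dots> \<le> S" using Sac_S[of "s a" "{a}"] by simp
      finally show ?thesis using bij by (rule whole)
    next
      case False
      \<comment> \<open>Misplaced mass is penalized by a class \<open>b\<close> that distinguishes \<open>a\<close> from the class that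
        owns the label \<open>c\<close>.\<close>
      have mis: "M c a * (\<mu> * (\<delta>\<^sup>2 / 4)) \<le> Sac a c" if "c \<noteq> s a" for a c
      proof -
        obtain a' where a': "c = s a'" using bij by (metis bij_pointE)
        with that have "a \<noteq> a'" by auto
        then obtain b where b: "\<delta> \<le> \<bar>w a b - w a' b\<bar>" using sep by blast
        have "\<bar>w a' b - v c (s b)\<bar> < \<delta> / 2" using False a' by (auto simp: not_le)
        then have "\<delta> / 2 \<le> \<bar>w a b - v c (s b)\<bar>" using b by arith
        then have "\<delta>\<^sup>2 / 4 \<le> (w a b - v c (s b))\<^sup>2"
          using power_mono[of "\<delta>/2" "\<bar>w a b - v c (s b)\<bar>" 2] delta by (simp add: power_divide)
        then have "M c a * (\<mu> * (\<delta>\<^sup>2 / 4)) \<le> M c a * (\<mu> * (w a b - v c (s b))\<^sup>2)"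
          using mu1 by (intro mult_left_mono M0) auto
        also have "\<dots> = M c a * \<mu> * (w a b - v c (s b))\<^sup>2" by simp
        also have "\<dots> \<le> Sac a c" by (rule order_trans[OF ts t_Sac])
        finally show ?thesis .
      qed
      have "(\<Sum>i\<in>V. 1 - \<tau> i (s (z i))) = (\<Sum>a\<in>UNIV. \<Sum>i\<in>cls a. 1 - \<tau> i (s a))"
        unfolding sumV by (intro sum.cong refl) (auto simp: cls_def)
      also have "\<dots> = (\<Sum>a\<in>UNIV. \<Sum>i\<in>cls a. \<Sum>c\<in>UNIV-{s a}. \<tau> i c)"
      proof (intro sum.cong refl)
        fix a i assume "i \<in> cls a"
        then have "(\<Sum>c\<in>UNIV. \<tau> i c) = 1" by (intro tau1) (auto simp: cls_def)
        then show "1 - \<tau> i (s a) = (\<Sum>c\<in>UNIV-{s a}. \<tau> i c)"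
          by (subst (asm) sum.remove[of _ "s a"]) auto
      qed
      also have "\<dots> = (\<Sum>a\<in>UNIV. \<Sum>c\<in>UNIV-{s a}. M c a)"
        unfolding M_def by (intro sum.cong refl sum.swap)
      finally have m: "(\<Sum>i\<in>V. 1 - \<tau> i (s (z i))) = (\<Sum>a\<in>UNIV. \<Sum>c\<in>UNIV-{s a}. M c a)" .
      have "\<beta>\<^sup>2 * \<delta>\<^sup>2 / (8 * ?k\<^sup>2) * ?n \<le> \<mu> * (\<delta>\<^sup>2 / 4)"
      proof -
        have "\<beta>\<^sup>2 / ?k\<^sup>2 \<le> \<beta> / ?k"
          using beta order_trans[OF beta(2) k1] by (simp add: power2_eq_square field_simps)
        then have "\<beta>\<^sup>2 / ?k\<^sup>2 * (\<delta>\<^sup>2 * ?n / 8) \<le> \<beta> / ?k * (\<delta>\<^sup>2 * ?n / 8)"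
          by (intro mult_right_mono) auto
        then show ?thesis by (simp add: \<mu>_def algebra_simps)
      qed
      then have "\<beta>\<^sup>2 * \<delta>\<^sup>2 / (8 * ?k\<^sup>2) * ?n * (\<Sum>i\<in>V. 1 - \<tau> i (s (z i)))
         \<le> \<mu> * (\<delta>\<^sup>2 / 4) * (\<Sum>i\<in>V. 1 - \<tau> i (s (z i)))"
        by (intro mult_right_mono sum_nonneg) (simp_all add: tau_le1)
      also have "\<dots> = (\<Sum>a\<in>UNIV. \<Sum>c\<in>UNIV-{s a}. M c a * (\<mu> * (\<delta>\<^sup>2 / 4)))"
        unfolding m by (subst mult.commute) (simp only: sum_distrib_right)
      also have "\<dots> \<le> (\<Sum>a\<in>UNIV. \<Sum>c\<in>UNIV-{s a}. Sac a c)"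
        by (intro sum_mono mis) auto
      also have "\<dots> \<le> (\<Sum>a\<in>UNIV. \<Sum>c\<in>UNIV. Sac a c)"
        by (intro sum_mono sum_mono2) (auto simp: Sac0)
      also have "\<dots> \<le> S" by (rule S_Sac)
      finally show ?thesis using bij by (auto simp: S_def)
    qed
  qed
qed

section \<open>Block averages maximize the likelihood\<close>

abbreviation admissible :: "real^'k::finite^'k \<Rightarrow> bool" where
  "admissible Q \<equiv> transpose Q = Q \<and> (\<forall>a b. 0 < Q $ a $ b \<and> Q $ a $ b < 1)"

lemma transpose_eq_iff: "transpose Q = Q \<longleftrightarrow> (\<forall>a b. Q $ a $ b = Q $ b $ a)"
  by (auto simp: transpose_def vec_eq_iff)

text \<open>
  The factorization \<open>Q = \<rho> S\<close> only fixes the scale: \<open>\<rho>\<close> is the mean of \<open>Q\<close> under \<open>\<alpha>\<close>.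
\<close>

lemma param_space_iff:
  "(\<alpha>, Q) \<in> param_space \<longleftrightarrow> (\<forall>a. 0 < pmf \<alpha> a) \<and> admissible Q"
proof
  assume "(\<alpha>, Q) \<in> param_space"
  then show "(\<forall>a. 0 < pmf \<alpha> a) \<and> admissible Q"
    by (auto simp: param_space_def transpose_eq_iff)
next
  assume *: "(\<forall>a. 0 < pmf \<alpha> a) \<and> admissible Q"
  define \<rho> where "\<rho> = (\<Sum>a\<in>UNIV. \<Sum>b\<in>UNIV. pmf \<alpha> a * pmf \<alpha> b * Q $ a $ b)"
  have "0 < \<rho>" unfolding \<rho>_def using * by (intro sum_pos mult_pos_pos) auto
  moreover have "(\<Sum>a\<in>UNIV. \<Sum>b\<in>UNIV. pmf \<alpha> a * pmf \<alpha> b * (Q $ a $ b / \<rho>)) = \<rho> / \<rho>"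
    by (subst (2) \<rho>_def) (simp add: sum_divide_distrib)
  ultimately show "(\<alpha>, Q) \<in> param_space"
    using * unfolding param_space_def
    by (auto simp: transpose_eq_iff intro!: exI[of _ \<rho>] exI[of _ "(1/\<rho>) *\<^sub>R Q"])
qed

lemma snd_param_space: "(Q :: real^'k::finite^'k) \<in> snd ` param_space \<longleftrightarrow> admissible Q"
proof
  assume "Q \<in> snd ` param_space"
  then show "admissible Q" by (force simp: param_space_iff)
next
  assume "admissible Q"
  moreover have "0 < pmf (pmf_of_set (UNIV :: 'k set)) a" for a by simp
  ultimately have "(pmf_of_set UNIV, Q) \<in> param_space" unfolding param_space_iff by blast
  then show "Q \<in> snd ` param_space" by force
qed

text \<open>
  The likelihood sums over \<open>i < j\<close>, but the block averages and the Frobenius norm see ordered pairs,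
  which split into blocks without a case distinction; all sums are moved there.
\<close>

definition ordered_pairs :: "nat \<Rightarrow> (nat \<times> nat) set" where
  "ordered_pairs n = {(i, j). i \<in> {1..n} \<and> j \<in> {1..n} \<and> i \<noteq> j}"

lemma finite_node_pairs [simp]: "finite (node_pairs n)"
  by (rule finite_subset[of _ "{1..n} \<times> {1..n}"]) (auto simp: node_pairs_def)

lemma finite_ordered_pairs [simp]: "finite (ordered_pairs n)"
  by (rule finite_subset[of _ "{1..n} \<times> {1..n}"]) (auto simp: ordered_pairs_def)

lemma finite_block_pairs [simp]: "finite (block_pairs n z a b)"
  by (rule finite_subset[OF _ finite_ordered_pairs[of n]]) (auto simp: ordered_pairs_def block_pairs_def)

lemma sum_ordered_pairs_nested:
  "(\<Sum>(i, j)\<in>ordered_pairs n. f i j) = (\<Sum>i\<in>{1..n}. \<Sum>j\<in>{1..n}-{i}. f i j)"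
  by (subst sum.Sigma) (auto simp: ordered_pairs_def intro!: sum.cong)

lemma sum_ordered_pairs_symmetric:
  fixes f :: "nat \<Rightarrow> nat \<Rightarrow> real"
  assumes "\<And>i j. f i j = f j i"
  shows "(\<Sum>(i, j)\<in>ordered_pairs n. f i j) = 2 * (\<Sum>(i, j)\<in>node_pairs n. f i j)"
proof -
  let ?F = "\<lambda>(i, j). f i j" and ?N = "node_pairs n"
  have "ordered_pairs n = ?N \<union> prod.swap ` ?N"
    by (force simp: ordered_pairs_def node_pairs_def image_iff)
  then have "sum ?F (ordered_pairs n) = sum ?F ?N + sum ?F (prod.swap ` ?N)"
    by (simp only:) (rule sum.union_disjoint[OF finite_node_pairs finite_imageI[OF finite_node_pairs]],
        auto simp: node_pairs_def)
  also have "sum ?F (prod.swap ` ?N) = sum (?F \<circ> prod.swap) ?N"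
    by (rule sum.reindex) simp
  also have "?F \<circ> prod.swap = ?F" using assms by (auto simp: fun_eq_iff)
  finally show ?thesis by simp
qed

lemma sum_ordered_pairs_blocks:
  "(\<Sum>x\<in>ordered_pairs n. f x) = (\<Sum>a\<in>UNIV. \<Sum>b\<in>UNIV. \<Sum>x\<in>block_pairs n (z :: nat \<Rightarrow> 'k::finite) a b. f x)"
proof -
  have "(\<Sum>x\<in>ordered_pairs n. f x) =
     (\<Sum>c\<in>(UNIV::('k \<times> 'k) set). \<Sum>x\<in>{x\<in>ordered_pairs n. (case x of (i, j) \<Rightarrow> (z i, z j)) = c}. f x)"
    by (rule sum.group[symmetric]) auto
  also have "\<dots> = (\<Sum>c\<in>UNIV \<times> UNIV. \<Sum>x\<in>block_pairs n z (fst c) (snd c). f x)"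
    by (intro sum.cong) (auto simp: block_pairs_def ordered_pairs_def)
  also have "\<dots> = (\<Sum>a\<in>UNIV. \<Sum>b\<in>UNIV. \<Sum>x\<in>block_pairs n z a b. f x)"
    by (simp only: sum.cartesian_product') (simp add: sum.cartesian_product)
  finally show ?thesis .
qed

lemma adjacency_sym: "adjacency e i j = adjacency e j i"
  by (auto simp: adjacency_def)

lemma adjacency_cases: "adjacency e i j = 0 \<or> adjacency e i j = 1"
  by (auto simp: adjacency_def)

lemma adjacency_node_pair: "(i, j) \<in> node_pairs n \<Longrightarrow> adjacency e i j = of_bool (e (i, j))"
  by (auto simp: adjacency_def node_pairs_def)

lemma block_pairs_swap: "block_pairs n z b a = prod.swap ` block_pairs n z a b"
  by (force simp: block_pairs_def image_iff)

lemma card_block_pairs_swap: "card (block_pairs n z b a) = card (block_pairs n z a b)"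
  by (subst block_pairs_swap) (rule card_image, simp)

lemma transpose_block_averages:
  "transpose (block_averages n (adjacency e) z) = block_averages n (adjacency e) z"
proof -
  have "(\<Sum>(i, j)\<in>block_pairs n z b a. adjacency e i j) = (\<Sum>(i, j)\<in>block_pairs n z a b. adjacency e i j)" for a b
    by (subst block_pairs_swap, subst sum.reindex) (auto simp: adjacency_sym intro!: sum.cong)
  then show ?thesis by (simp add: transpose_eq_iff block_averages_def card_block_pairs_swap)
qed

lemma block_averages_eq:
  "block_averages n (adjacency e) z $ a $ b =
     real (card {(i, j) \<in> block_pairs n z a b. adjacency e i j = 1}) / real (card (block_pairs n z a b))"
proof -
  have "(\<Sum>(i, j)\<in>block_pairs n z a b. adjacency e i j)
     = (\<Sum>x\<in>block_pairs n z a b. of_bool (case x of (i, j) \<Rightarrow> adjacency e i j = 1))"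
  proof (intro sum.cong refl)
    fix x :: "nat \<times> nat"
    obtain i j where "x = (i, j)" by fastforce
    then show "(case x of (i, j) \<Rightarrow> adjacency e i j) = of_bool (case x of (i, j) \<Rightarrow> adjacency e i j = 1)"
      using adjacency_cases[of e i j] by auto
  qed
  also have "\<dots> = real (card {(i, j) \<in> block_pairs n z a b. adjacency e i j = 1})"
  proof -
    have "{(i, j) \<in> block_pairs n z a b. adjacency e i j = 1} =
        block_pairs n z a b \<inter> {x. case x of (i, j) \<Rightarrow> adjacency e i j = 1}" by auto
    then show ?thesis by (simp only: sum_of_bool_eq finite_block_pairs)
  qed
  finally show ?thesis by (simp add: block_averages_def)
qed

text \<open>
  A finite set that contains all block averages at \<open>n\<close> nodes, so that a union bound over the matrices becomes
  possible. The fraction \<open>0 / 0 = 0\<close> of an empty block is included.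
\<close>

definition average_grid :: "nat \<Rightarrow> (real^'k::finite^'k) set" where
  "average_grid n = {Q. transpose Q = Q \<and>
     (\<forall>a b. Q $ a $ b \<in> (\<lambda>(x, y). real x / real y) ` {(x, y). x \<le> y \<and> y \<le> n\<^sup>2})}"

lemma average_grid_bounds: "Q \<in> average_grid n \<Longrightarrow> 0 \<le> Q $ a $ b \<and> Q $ a $ b \<le> 1"
proof -
  assume "Q \<in> average_grid n"
  then have "Q $ a $ b \<in> (\<lambda>(x, y). real x / real y) ` {(x, y). x \<le> y \<and> y \<le> n\<^sup>2}"
    unfolding average_grid_def by blast
  then show ?thesis by (auto simp: divide_le_eq_1)
qed

lemma block_averages_in_grid: "block_averages n (adjacency e) z \<in> average_grid n"
proof -
  have "card {(i, j) \<in> block_pairs n z a b. adjacency e i j = 1} \<le> card (block_pairs n z a b)" for a b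
    by (rule card_mono) auto
  moreover have "card (block_pairs n z a b) \<le> n\<^sup>2" for a b
  proof -
    have "card (block_pairs n z a b) \<le> card ({1..n} \<times> {1..n})"
      by (rule card_mono) (auto simp: block_pairs_def)
    then show ?thesis by (simp add: power2_eq_square)
  qed
  ultimately show ?thesis
    unfolding average_grid_def by (force simp: transpose_block_averages block_averages_eq)
qed

lemma average_grid_card:
  "finite (average_grid n :: (real^'k::finite^'k) set)"
  "card (average_grid n :: (real^'k^'k) set) \<le> ((n\<^sup>2 + 1)\<^sup>2) ^ (CARD('k)\<^sup>2)"
proof -
  let ?G = "(\<lambda>(x, y). real x / real y) ` {(x, y). x \<le> y \<and> y \<le> n\<^sup>2}"
  have fin: "finite {(x :: nat, y). x \<le> y \<and> y \<le> n\<^sup>2}"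
    by (rule finite_subset[of _ "{..n\<^sup>2} \<times> {..n\<^sup>2}"]) auto
  have "card ?G \<le> card {(x :: nat, y). x \<le> y \<and> y \<le> n\<^sup>2}" by (rule card_image_le[OF fin])
  also have "\<dots> \<le> card ({..n\<^sup>2} \<times> {..n\<^sup>2})" by (rule card_mono) auto
  also have "\<dots> = (n\<^sup>2 + 1)\<^sup>2" by (simp add: power2_eq_square)
  finally have G: "card ?G \<le> (n\<^sup>2 + 1)\<^sup>2" .
  let ?c = "\<lambda>Q :: real^'k^'k. (\<lambda>(a, b). Q $ a $ b)"
  have inj: "inj ?c" by (auto simp: inj_def fun_eq_iff vec_eq_iff)
  have sub: "?c ` average_grid n \<subseteq> (UNIV :: ('k \<times> 'k) set) \<rightarrow>\<^sub>E ?G"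
    by (auto simp: average_grid_def)
  have finE: "finite ((UNIV :: ('k \<times> 'k) set) \<rightarrow>\<^sub>E ?G)" by (intro finite_PiE) (use fin in auto)
  show "finite (average_grid n :: (real^'k^'k) set)"
    using finite_subset[OF sub finE] finite_imageD inj inj_on_subset by blast
  have "card (average_grid n :: (real^'k^'k) set) = card (?c ` average_grid n)"
    by (rule card_image[symmetric]) (rule inj_on_subset[OF inj], simp)
  also have "\<dots> \<le> card ((UNIV :: ('k \<times> 'k) set) \<rightarrow>\<^sub>E ?G)" by (rule card_mono[OF finE sub])
  also have "\<dots> = card ?G ^ (CARD('k)\<^sup>2)" by (simp add: card_PiE power2_eq_square)
  also have "\<dots> \<le> ((n\<^sup>2 + 1)\<^sup>2) ^ (CARD('k)\<^sup>2)" by (rule power_mono[OF G]) simp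
  finally show "card (average_grid n :: (real^'k^'k) set) \<le> ((n\<^sup>2 + 1)\<^sup>2) ^ (CARD('k)\<^sup>2)" .
qed

text \<open>
  The true or candidate probabilities in the form that \<open>edge_lik\<close> takes. On matrices with entries
  \<open>0\<close> or \<open>1\<close> the likelihood \<open>edge_lik\<close> is meaningful, whereas \<open>log_lik\<close> relies on \<open>ln 0 = 0\<close>; the next
  lemmas say where the two agree.
\<close>

definition sbm_edge_prob :: "real^'k^'k \<Rightarrow> (nat \<Rightarrow> 'k::finite) \<Rightarrow> nat \<times> nat \<Rightarrow> real" where
  "sbm_edge_prob Q z = (\<lambda>(i, j). Q $ z i $ z j)"

lemma edge_lik_eq_exp_log_lik:
  assumes pos: "\<And>i j. (i, j) \<in> node_pairs n \<Longrightarrow> 0 < (if e (i, j) then Q $ z i $ z j else 1 - Q $ z i $ z j)"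
  shows "edge_lik (node_pairs n) (sbm_edge_prob Q z) e = exp (log_lik n (adjacency e) z Q)"
proof -
  have "exp (log_lik n (adjacency e) z Q) = (\<Prod>(i, j)\<in>node_pairs n.
     exp (adjacency e i j * ln (Q $ z i $ z j) + (1 - adjacency e i j) * ln (1 - Q $ z i $ z j)))"
    unfolding log_lik_def by (subst exp_sum) (auto intro!: prod.cong)
  also have "\<dots> = edge_lik (node_pairs n) (sbm_edge_prob Q z) e"
    unfolding edge_lik_def sbm_edge_prob_def
  proof (intro prod.cong refl, clarify)
    fix i j assume ij: "(i, j) \<in> node_pairs n"
    show "exp (adjacency e i j * ln (Q $ z i $ z j) + (1 - adjacency e i j) * ln (1 - Q $ z i $ z j)) =
        (if e (i, j) then Q $ z i $ z j else 1 - Q $ z i $ z j)"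
      using pos[OF ij] by (auto simp: adjacency_node_pair[OF ij] split: if_splits)
  qed
  finally show ?thesis by simp
qed

lemma edge_lik_admissible:
  assumes "admissible Q"
  shows "edge_lik (node_pairs n) (sbm_edge_prob Q z) e = exp (log_lik n (adjacency e) z Q)"
  using assms by (intro edge_lik_eq_exp_log_lik) auto

text \<open>
  An observed edge makes the average of its block positive and a missing edge keeps it below one, so
  no logarithm of zero enters the log-likelihood at the block averages.
\<close>

lemma block_averages_factor_pos:
  fixes z :: "nat \<Rightarrow> 'k::finite" and e :: "nat \<times> nat \<Rightarrow> bool"
  assumes "i \<in> {1..n}" "j \<in> {1..n}" "i \<noteq> j"
  defines "q \<equiv> block_averages n (adjacency e) z $ z i $ z j"
  shows "adjacency e i j = 1 \<Longrightarrow> 0 < q" "adjacency e i j = 0 \<Longrightarrow> q < 1"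
proof -
  let ?B = "block_pairs n z (z i) (z j)" and ?S = "{(x, y) \<in> block_pairs n z (z i) (z j). adjacency e x y = 1}"
  have ij: "(i, j) \<in> ?B" using assms by (auto simp: block_pairs_def)
  have fS: "finite ?S" by (rule finite_subset[of _ ?B]) auto
  have B: "0 < card ?B" using ij by (auto simp: card_gt_0_iff)
  { assume "adjacency e i j = 1"
    then have "(i, j) \<in> ?S" using ij by auto
    then have "0 < card ?S" using fS by (auto simp: card_gt_0_iff)
    then show "0 < q" using B by (simp add: q_def block_averages_eq) }
  { assume "adjacency e i j = 0"
    then have "(i, j) \<notin> ?S" by auto
    then have "card ?S < card ?B" using ij by (intro psubset_card_mono) auto
    then show "q < 1" using B by (simp add: q_def block_averages_eq) }
qed

lemma edge_lik_block_averages: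
  fixes z :: "nat \<Rightarrow> 'k::finite" and e :: "nat \<times> nat \<Rightarrow> bool" and n :: nat
  defines "Q \<equiv> block_averages n (adjacency e) z"
  shows "edge_lik (node_pairs n) (sbm_edge_prob Q z) e = exp (log_lik n (adjacency e) z Q)"
  using block_averages_factor_pos[of _ n _ e z] unfolding Q_def
  by (intro edge_lik_eq_exp_log_lik) (force simp: node_pairs_def adjacency_def)

definition edge_log_lik :: "real \<Rightarrow> real \<Rightarrow> real" where
  "edge_log_lik x q = x * ln q + (1 - x) * ln (1 - q)"

lemma log_lik_ordered:
  assumes "transpose Q = Q"
  shows "2 * log_lik n (adjacency e) z Q =
    (\<Sum>(i, j)\<in>ordered_pairs n. edge_log_lik (adjacency e i j) (Q $ z i $ z j))"
  unfolding log_lik_def edge_log_lik_def using assms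
  by (intro sum_ordered_pairs_symmetric[symmetric]) (simp add: adjacency_sym transpose_eq_iff)

text \<open>
  Gibbs' inequality, block by block. The bound \<open>ln x - ln y \<le> x / y - 1\<close> turns each block into a sum
  that telescopes to \<open>0\<close> when the average \<open>q\<close> is strictly between \<open>0\<close> and \<open>1\<close>, and to something
  negative when it is \<open>0\<close> or \<open>1\<close>.
\<close>

lemma log_lik_le_block_averages:
  assumes Q: "admissible Q"
  shows "log_lik n (adjacency e) z Q \<le> log_lik n (adjacency e) z (block_averages n (adjacency e) z)"
proof -
  let ?A = "adjacency e" and ?Q = "block_averages n (adjacency e) z"
  have "2 * log_lik n ?A z Q - 2 * log_lik n ?A z ?Q = (\<Sum>x\<in>ordered_pairs n. case x of (i, j) \<Rightarrow>
     edge_log_lik (?A i j) (Q $ z i $ z j) - edge_log_lik (?A i j) (?Q $ z i $ z j))"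
    using Q by (simp add: log_lik_ordered transpose_block_averages sum_subtractf case_prod_beta)
  also have "\<dots> = (\<Sum>a\<in>UNIV. \<Sum>b\<in>UNIV. \<Sum>x\<in>block_pairs n z a b. case x of (i, j) \<Rightarrow>
     edge_log_lik (?A i j) (Q $ z i $ z j) - edge_log_lik (?A i j) (?Q $ z i $ z j))"
    by (rule sum_ordered_pairs_blocks)
  also have "\<dots> \<le> (\<Sum>a\<in>(UNIV::'a set). \<Sum>b\<in>(UNIV::'a set). 0)"
  proof (intro sum_mono)
    fix a b
    let ?B = "block_pairs n z a b"
    define p q where "p = Q $ a $ b" and "q = ?Q $ a $ b"
    have p: "0 < p" "p < 1" using Q by (auto simp: p_def)
    let ?N = "real (card ?B)" and ?S = "\<Sum>(i, j)\<in>?B. ?A i j"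
    have N0: "?B = {} \<or> 0 < ?N" by (auto simp: card_gt_0_iff)
    have q: "?S = ?N * q" using N0 by (auto simp: q_def block_averages_def)
    have q01: "0 \<le> q" "q \<le> 1"
      using average_grid_bounds[OF block_averages_in_grid[of n e z]] by (auto simp: q_def)
    have "(\<Sum>(i, j)\<in>?B. edge_log_lik (?A i j) (Q $ z i $ z j) - edge_log_lik (?A i j) (?Q $ z i $ z j))
       \<le> (\<Sum>(i, j)\<in>?B. ?A i j * (p / q) + (1 - ?A i j) * ((1 - p) / (1 - q)) - 1)"
    proof (rule sum_mono, clarify)
      fix i j assume ij: "(i, j) \<in> ?B"
      then have z: "z i = a" "z j = b" and ij': "i \<in> {1..n}" "j \<in> {1..n}" "i \<noteq> j"
        by (auto simp: block_pairs_def)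
      note f = block_averages_factor_pos[OF ij', of e z, unfolded z, folded q_def]
      have lnle: "ln x - ln y \<le> x / y - 1" if "0 < x" "0 < y" for x y :: real
        using ln_le_minus_one[of "x / y"] that by (simp add: ln_div)
      show "edge_log_lik (?A i j) (Q $ z i $ z j) - edge_log_lik (?A i j) (?Q $ z i $ z j)
         \<le> ?A i j * (p / q) + (1 - ?A i j) * ((1 - p) / (1 - q)) - 1"
        using adjacency_cases[of e i j] f lnle[of p q] lnle[of "1 - p" "1 - q"] p
        unfolding z p_def[symmetric] q_def[symmetric] edge_log_lik_def by auto
    qed
    also have "\<dots> = ?S * (p / q) + (?N - ?S) * ((1 - p) / (1 - q)) - ?N"
      by (simp add: case_prod_beta sum.distrib sum_subtractf sum_distrib_right sum_divide_distrib left_diff_distrib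
          flip: sum_divide_distrib)
    also have "\<dots> = ?N * (q * (p / q) + (1 - q) * ((1 - p) / (1 - q)) - 1)"
    proof -
      have "N * q * r + (N - N * q) * t - N = N * (q * r + (1 - q) * t - 1)" for N q r t :: real
        by (simp add: algebra_simps)
      then show ?thesis unfolding q .
    qed
    also have "\<dots> \<le> 0"
    proof (rule mult_nonneg_nonpos)
      show "q * (p / q) + (1 - q) * ((1 - p) / (1 - q)) - 1 \<le> 0"
        using p q01 by (cases "q = 0"; cases "q = 1") auto
    qed simp
    finally show "(\<Sum>(i, j)\<in>?B. edge_log_lik (?A i j) (Q $ z i $ z j) - edge_log_lik (?A i j) (?Q $ z i $ z j)) \<le> 0" .
  qed
  finally show ?thesis by simp
qed

section \<open>Separated likelihoods and maximum likelihood labels\<close>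

definition hellinger_dist :: "nat \<Rightarrow> real^'k^'k \<Rightarrow> (nat \<Rightarrow> 'k::finite) \<Rightarrow> real^'k^'k \<Rightarrow> (nat \<Rightarrow> 'k) \<Rightarrow> real" where
  "hellinger_dist n P y Q z =
     (\<Sum>x\<in>node_pairs n. (sqrt (sbm_edge_prob P y x) - sqrt (sbm_edge_prob Q z x))\<^sup>2)"

lemma hellinger_dist_ordered:
  assumes "transpose P = P" "transpose Q = Q"
  shows "2 * hellinger_dist n P y Q z =
    (\<Sum>(i, j)\<in>ordered_pairs n. (sqrt (P $ y i $ y j) - sqrt (Q $ z i $ z j))\<^sup>2)"
proof -
  have "hellinger_dist n P y Q z = (\<Sum>(i, j)\<in>node_pairs n. (sqrt (P $ y i $ y j) - sqrt (Q $ z i $ z j))\<^sup>2)"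
    by (auto simp: hellinger_dist_def sbm_edge_prob_def intro!: sum.cong)
  then show ?thesis
    using assms by (subst sum_ordered_pairs_symmetric) (auto simp: transpose_eq_iff)
qed

definition balanced :: "real \<Rightarrow> nat \<Rightarrow> (nat \<Rightarrow> 'k) \<Rightarrow> bool" where
  "balanced \<beta> n z \<longleftrightarrow> (\<forall>a. \<beta> * real n \<le> real (card {i\<in>{1..n}. z i = a}))"

definition separation_const :: "real \<Rightarrow> real \<Rightarrow> real \<Rightarrow> real" where
  "separation_const k \<beta> \<delta> = \<beta>\<^sup>2 * \<delta>\<^sup>2 / (8 * k\<^sup>2)"

lemma sum_of_bool_point:
  fixes f :: "'k::finite \<Rightarrow> real"
  shows "(\<Sum>c\<in>UNIV. of_bool (a = c) * f c) = f a"
  by (subst sum.remove[of _ a]) auto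

lemma sum_not_label_eq_errors:
  "(\<Sum>i\<in>{1..n}. 1 - of_bool (z i = y i)) = real (errors n z y)"
proof -
  have "(\<Sum>i\<in>{1..n}. 1 - of_bool (z i = y i) :: real) = (\<Sum>i\<in>{1..n}. of_bool (z i \<noteq> y i))"
    by (intro sum.cong) auto
  also have "\<dots> = real (errors n z y)"
    by (simp add: errors_def Int_def)
  finally show ?thesis .
qed

text \<open>
  This is \<open>soft_separation\<close> for point masses. Dividing both matrices by \<open>\<rho>\<close> before taking square
  roots makes the gap \<open>\<delta>\<close> independent of the sparsity.
\<close>

lemma hellinger_dist_ge_errors:
  fixes Q0 Q :: "real^'k::finite^'k"
  assumes sym: "transpose Q0 = Q0" "transpose Q = Q"
    and rho: "0 < \<rho>" and beta: "0 < \<beta>" "\<beta> \<le> 1" and delta: "0 < \<delta>"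
    and bal: "balanced \<beta> n y" and big: "2 * real CARD('k) \<le> \<beta> * real n"
    and sep: "\<And>a a'. a \<noteq> a' \<Longrightarrow> \<exists>b. \<delta> \<le> \<bar>sqrt (Q0 $ a $ b) - sqrt (Q0 $ a' $ b)\<bar>"
  shows "\<exists>\<sigma> :: 'k \<Rightarrow> 'k. bij \<sigma> \<and> \<rho> / 2 * separation_const (real CARD('k)) \<beta> \<delta> * real n * real (errors n z (\<sigma> \<circ> y))
    \<le> hellinger_dist n (\<rho> *\<^sub>R Q0) y Q z"
proof -
  let ?w = "\<lambda>a b. sqrt (Q0 $ a $ b)" and ?v = "\<lambda>a b. sqrt (Q $ a $ b / \<rho>)"
  let ?\<tau> = "\<lambda>i a. of_bool (z i = a) :: real"
  obtain \<sigma> where \<sigma>: "bij \<sigma>" and le: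
    "\<beta>\<^sup>2 * \<delta>\<^sup>2 / (8 * (real CARD('k))\<^sup>2) * real (card {1..n}) * (\<Sum>i\<in>{1..n}. 1 - ?\<tau> i (\<sigma> (y i)))
      \<le> (\<Sum>i\<in>{1..n}. \<Sum>j\<in>{1..n}-{i}. \<Sum>c\<in>UNIV. \<Sum>d\<in>UNIV. ?\<tau> i c * ?\<tau> j d * (?w (y i) (y j) - ?v c d)\<^sup>2)"
    using soft_separation[of "{1..n}" ?\<tau> \<beta> \<delta> y ?w ?v] assms by (auto simp: balanced_def)
  have "(\<Sum>i\<in>{1..n}. \<Sum>j\<in>{1..n}-{i}. \<Sum>c\<in>UNIV. \<Sum>d\<in>UNIV. ?\<tau> i c * ?\<tau> j d * (?w (y i) (y j) - ?v c d)\<^sup>2)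
     = (\<Sum>i\<in>{1..n}. \<Sum>j\<in>{1..n}-{i}. (?w (y i) (y j) - ?v (z i) (z j))\<^sup>2)"
    by (simp only: mult.assoc sum_of_bool_point flip: sum_distrib_left)
  also have "\<dots> = (\<Sum>(i, j)\<in>ordered_pairs n. (?w (y i) (y j) - ?v (z i) (z j))\<^sup>2)"
    by (rule sum_ordered_pairs_nested[symmetric])
  finally have eq: "(\<Sum>i\<in>{1..n}. \<Sum>j\<in>{1..n}-{i}. \<Sum>c\<in>UNIV. \<Sum>d\<in>UNIV. ?\<tau> i c * ?\<tau> j d * (?w (y i) (y j) - ?v c d)\<^sup>2)
     = (\<Sum>(i, j)\<in>ordered_pairs n. (?w (y i) (y j) - ?v (z i) (z j))\<^sup>2)" .
  have scale: "\<rho> * (sqrt p - sqrt (q / \<rho>))\<^sup>2 = (sqrt (\<rho> * p) - sqrt q)\<^sup>2" for p q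
  proof -
    have "\<rho> * (sqrt p - sqrt (q / \<rho>))\<^sup>2 = (sqrt \<rho> * (sqrt p - sqrt (q / \<rho>)))\<^sup>2"
      using rho by (simp add: power_mult_distrib)
    also have "sqrt \<rho> * (sqrt p - sqrt (q / \<rho>)) = sqrt (\<rho> * p) - sqrt q"
      using rho by (simp add: real_sqrt_mult real_sqrt_divide right_diff_distrib)
    finally show ?thesis .
  qed
  have "\<rho> * (\<Sum>(i, j)\<in>ordered_pairs n. (?w (y i) (y j) - ?v (z i) (z j))\<^sup>2)
      = (\<Sum>(i, j)\<in>ordered_pairs n. (sqrt ((\<rho> *\<^sub>R Q0) $ y i $ y j) - sqrt (Q $ z i $ z j))\<^sup>2)"
    by (simp only: sum_distrib_left case_prod_beta scale) (simp add: case_prod_beta)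
  also have "\<dots> = 2 * hellinger_dist n (\<rho> *\<^sub>R Q0) y Q z"
    using sym by (intro hellinger_dist_ordered[symmetric]) (auto simp: transpose_eq_iff)
  finally have "\<rho> * (separation_const (real CARD('k)) \<beta> \<delta> * real n * real (errors n z (\<sigma> \<circ> y)))
      \<le> 2 * hellinger_dist n (\<rho> *\<^sub>R Q0) y Q z"
    using mult_left_mono[OF le[unfolded eq], of \<rho>] rho sum_not_label_eq_errors[of z "\<sigma> \<circ> y" n]
    by (simp add: separation_const_def)
  then show ?thesis using \<sigma> by (intro exI[of _ \<sigma>]) (simp add: mult_ac)
qed

text \<open>
  The outcome of the union bound. The relabeling may depend on the competitor \<open>z\<close> and \<open>Q\<close>.
\<close>

definition separated :: "nat \<Rightarrow> (nat \<Rightarrow> nat \<Rightarrow> real) \<Rightarrow> (nat \<Rightarrow> 'k::finite) \<Rightarrow> real \<Rightarrow> bool" where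
  "separated n A y g \<longleftrightarrow> (\<forall>z\<in>labelings n. \<forall>Q. admissible Q \<longrightarrow> (\<exists>\<sigma> :: 'k \<Rightarrow> 'k. bij \<sigma> \<and>
     log_lik n A z Q \<le> log_lik n A y (block_averages n A y) - g * real (errors n z (\<sigma> \<circ> y))))"

lemma same_up_to_relabeling_sym:
  assumes "same_up_to_relabeling n z z'" shows "same_up_to_relabeling n z' z"
proof -
  obtain \<sigma> where "bij \<sigma>" "\<forall>i\<in>{1..n}. z' i = \<sigma> (z i)"
    using assms by (auto simp: same_up_to_relabeling_def)
  then show ?thesis unfolding same_up_to_relabeling_def
    by (intro exI[of _ "inv \<sigma>"]) (simp add: bij_imp_bij_inv bij_is_inj)
qed

lemma same_up_to_relabeling_trans:
  assumes "same_up_to_relabeling n z z'" "same_up_to_relabeling n z' z''"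
  shows "same_up_to_relabeling n z z''"
proof -
  obtain \<sigma> \<tau> where "bij \<sigma>" "\<forall>i\<in>{1..n}. z' i = \<sigma> (z i)" "bij \<tau>" "\<forall>i\<in>{1..n}. z'' i = \<tau> (z' i)"
    using assms by (auto simp: same_up_to_relabeling_def)
  then show ?thesis unfolding same_up_to_relabeling_def
    by (intro exI[of _ "\<tau> \<circ> \<sigma>"]) (simp add: bij_comp)
qed

lemma same_up_to_relabeling_iff_errors:
  "same_up_to_relabeling n y z \<longleftrightarrow> (\<exists>\<sigma> :: 'k::finite \<Rightarrow> 'k. bij \<sigma> \<and> errors n z (\<sigma> \<circ> y) = 0)"
  by (simp add: same_up_to_relabeling_def errors_eq_0_iff)

lemma estimated_probs_relabel:
  assumes "same_up_to_relabeling n y z" "i \<in> {1..n}" "j \<in> {1..n}"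
  shows "estimated_probs n A z i j = estimated_probs n A y i j"
proof -
  obtain \<sigma> where \<sigma>: "bij \<sigma>" "\<forall>i\<in>{1..n}. z i = \<sigma> (y i)"
    using assms by (auto simp: same_up_to_relabeling_def)
  have "block_pairs n z (\<sigma> a) (\<sigma> b) = block_pairs n y a b" for a b
    using \<sigma> bij_is_inj[OF \<sigma>(1)] by (auto simp: block_pairs_def inj_eq)
  then show ?thesis
    using \<sigma> assms(2,3) by (simp add: estimated_probs_def block_matrix_def block_averages_def)
qed

lemma log_lik_relabel_le:
  assumes same: "same_up_to_relabeling n y z" and Q: "admissible Q"
  shows "log_lik n (adjacency e) z Q \<le> log_lik n (adjacency e) y (block_averages n (adjacency e) y)"
proof -
  obtain \<sigma> where \<sigma>: "bij \<sigma>" "\<forall>i\<in>{1..n}. z i = \<sigma> (y i)"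
    using same by (auto simp: same_up_to_relabeling_def)
  define Q' where "Q' = (\<chi> a b. Q $ \<sigma> a $ \<sigma> b)"
  have "log_lik n (adjacency e) z Q = log_lik n (adjacency e) y Q'"
    unfolding log_lik_def Q'_def using \<sigma> by (intro sum.cong) (auto simp: node_pairs_def)
  also have "\<dots> \<le> log_lik n (adjacency e) y (block_averages n (adjacency e) y)"
    using Q by (intro log_lik_le_block_averages) (auto simp: Q'_def transpose_eq_iff)
  finally show ?thesis .
qed

text \<open>
  Competitors that lose all tests are separated from \<open>y\<close>: an arbitrary \<open>Q\<close> is dominated by the
  block averages at \<open>z\<close>, these are on the grid and lose their test against the true matrix, which in
  turn is dominated by the block averages at \<open>y\<close>. Relabelings of \<open>y\<close> have no errors and are compared
  directly.
\<close>

lemma separatedI: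
  fixes Q0 :: "real^'k::finite^'k"
  assumes P: "admissible (\<rho> *\<^sub>R Q0)" and rho: "0 < \<rho>"
    and beta: "0 < \<beta>" "\<beta> \<le> 1" and delta: "0 < \<delta>"
    and bal: "balanced \<beta> n y" and big: "2 * real CARD('k) \<le> \<beta> * real n"
    and sep: "\<And>a a'. a \<noteq> a' \<Longrightarrow> \<exists>b. \<delta> \<le> \<bar>sqrt (Q0 $ a $ b) - sqrt (Q0 $ a' $ b)\<bar>"
    and test: "\<And>z Q. z \<in> labelings n \<Longrightarrow> \<not> same_up_to_relabeling n y z \<Longrightarrow> Q \<in> average_grid n \<Longrightarrow>
      edge_lik (node_pairs n) (sbm_edge_prob Q z) e \<le> edge_lik (node_pairs n) (sbm_edge_prob (\<rho> *\<^sub>R Q0) y) e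
         * exp (- (hellinger_dist n (\<rho> *\<^sub>R Q0) y Q z / 2))"
  shows "separated n (adjacency e) y (\<rho> / 4 * separation_const (real CARD('k)) \<beta> \<delta> * real n)"
  unfolding separated_def
proof (intro ballI allI impI)
  fix z :: "nat \<Rightarrow> 'k" and Q :: "real^'k^'k"
  let ?A = "adjacency e" and ?P = "\<rho> *\<^sub>R Q0"
  let ?L = "log_lik n ?A y (block_averages n ?A y)" and ?g = "\<rho> / 4 * separation_const (real CARD('k)) \<beta> \<delta> * real n"
  assume z: "z \<in> labelings n" and Q: "admissible Q"
  show "\<exists>\<sigma>. bij \<sigma> \<and> log_lik n ?A z Q \<le> ?L - ?g * real (errors n z (\<sigma> \<circ> y))"
  proof (cases "same_up_to_relabeling n y z")
    case True
    then obtain \<sigma> where "bij \<sigma>" "errors n z (\<sigma> \<circ> y) = 0" by (auto simp: same_up_to_relabeling_iff_errors)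
    then show ?thesis using log_lik_relabel_le[OF True Q] by auto
  next
    case False
    define Q' where "Q' = block_averages n ?A z"
    have Q': "Q' \<in> average_grid n" "transpose Q' = Q'"
      by (auto simp: Q'_def block_averages_in_grid transpose_block_averages)
    have symQ0: "transpose Q0 = Q0" using P rho by (auto simp: transpose_eq_iff)
    obtain \<sigma> where \<sigma>: "bij \<sigma>" and D: "\<rho> / 2 * separation_const (real CARD('k)) \<beta> \<delta> * real n * real (errors n z (\<sigma> \<circ> y))
        \<le> hellinger_dist n ?P y Q' z"
      using hellinger_dist_ge_errors[OF symQ0 Q'(2) rho beta delta bal big sep] by metis
    have "exp (log_lik n ?A z Q') \<le> exp (log_lik n ?A y ?P) * exp (- (hellinger_dist n ?P y Q' z / 2))"
      using test[OF z False Q'(1)] edge_lik_block_averages[of n e z] edge_lik_admissible[OF P, of n y e]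
      by (simp add: Q'_def)
    then have "log_lik n ?A z Q' \<le> log_lik n ?A y ?P - hellinger_dist n ?P y Q' z / 2"
      by (simp flip: exp_add)
    moreover have "log_lik n ?A z Q \<le> log_lik n ?A z Q'"
      unfolding Q'_def by (rule log_lik_le_block_averages[OF Q])
    moreover have "log_lik n ?A y ?P \<le> ?L" by (rule log_lik_le_block_averages[OF P])
    ultimately have "log_lik n ?A z Q \<le> ?L - ?g * real (errors n z (\<sigma> \<circ> y))"
      using D by (simp add: algebra_simps)
    then show ?thesis using \<sigma> by blast
  qed
qed

lemma is_mle_iff:
  fixes Q :: "real^'k::finite^'k"
  shows "is_mle n A (Q, z) \<longleftrightarrow> admissible Q \<and> z \<in> labelings n \<and>
     (\<forall>(Q' :: real^'k^'k) z'. admissible Q' \<longrightarrow> z' \<in> labelings n \<longrightarrow> log_lik n A z' Q' \<le> log_lik n A z Q)"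
  unfolding is_mle_def is_arg_max_def
  by (simp only: split_paired_Ex prod.case snd_param_space not_ex de_Morgan_conj not_less
      imp_conv_disj conj_assoc disj_assoc)

text \<open>
  Besides the labels of every maximizer this gives the existence of one: it is attained at \<open>y\<close> because
  the block averages lie in the open parameter space.
\<close>

lemma is_mle_labels_recover:
  fixes y :: "nat \<Rightarrow> 'k::finite"
  assumes y: "y \<in> labelings n" and sep: "separated n A y g" and g: "0 < g"
    and adm: "admissible (block_averages n A y)"
  shows "is_mle_labels n A y" "is_mle_labels n A z \<Longrightarrow> same_up_to_relabeling n y z"
proof -
  let ?Q = "block_averages n A y"
  have le: "log_lik n A z Q \<le> log_lik n A y ?Q" if *: "admissible Q" "z \<in> labelings n" for Q :: "real^'k^'k" and z
  proof -
    obtain \<sigma> :: "'k \<Rightarrow> 'k" where "log_lik n A z Q \<le> log_lik n A y ?Q - g * real (errors n z (\<sigma> \<circ> y))"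
      using sep * unfolding separated_def by blast
    moreover have "0 \<le> g * real (errors n z (\<sigma> \<circ> y))" using g by simp
    ultimately show ?thesis by linarith
  qed
  have "is_mle n A (?Q, y)" unfolding is_mle_iff using adm y le by blast
  then show "is_mle_labels n A y" unfolding is_mle_labels_def by blast
  assume "is_mle_labels n A z"
  then obtain Q where "is_mle n A (Q, z)" unfolding is_mle_labels_def by blast
  then have Q: "admissible Q" "z \<in> labelings n" and ge: "log_lik n A y ?Q \<le> log_lik n A z Q"
    unfolding is_mle_iff using adm y by blast+
  obtain \<sigma> :: "'k \<Rightarrow> 'k" where \<sigma>: "bij \<sigma>" "log_lik n A z Q \<le> log_lik n A y ?Q - g * real (errors n z (\<sigma> \<circ> y))"
    using sep Q unfolding separated_def by blast
  then have "g * real (errors n z (\<sigma> \<circ> y)) \<le> 0" using ge by linarith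
  then have "errors n z (\<sigma> \<circ> y) = 0" using g by (simp add: mult_le_0_iff)
  with \<sigma> show "same_up_to_relabeling n y z" unfolding same_up_to_relabeling_iff_errors by blast
qed

section \<open>The variational objective as an evidence lower bound\<close>

text \<open>
  Probability vectors are used as functions instead of \<open>pmf\<close>s, so that the topology of function spaces
  is available for the compactness argument.
\<close>

definition prob_vec :: "('k::finite \<Rightarrow> real) \<Rightarrow> bool" where
  "prob_vec p \<longleftrightarrow> (\<forall>a. 0 \<le> p a) \<and> (\<Sum>a\<in>UNIV. p a) = 1"

lemma prob_vec_pmf: "prob_vec (pmf p)"
  by (simp add: prob_vec_def sum_pmf_eq_1)

lemma prob_vec_ex_pmf:
  assumes "prob_vec (p :: 'k::finite \<Rightarrow> real)" shows "\<exists>q. pmf q = p"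
proof -
  have nn: "0 \<le> p a" for a using assms by (simp add: prob_vec_def)
  have "(\<integral>\<^sup>+a. ennreal (p a) \<partial>count_space UNIV) = ennreal (\<Sum>a\<in>UNIV. p a)"
    using nn by (simp add: nn_integral_count_space_finite sum_ennreal)
  then have "pmf (embed_pmf p) = p"
    using assms nn by (intro ext pmf_embed_pmf) (auto simp: prob_vec_def)
  then show ?thesis by blast
qed

lemma prob_vec_le_1: "prob_vec p \<Longrightarrow> p a \<le> 1"
  using member_le_sum[of a UNIV p] by (auto simp: prob_vec_def)

definition labels_prob :: "nat \<Rightarrow> (nat \<Rightarrow> 'k \<Rightarrow> real) \<Rightarrow> (nat \<Rightarrow> 'k) \<Rightarrow> real" where
  "labels_prob n \<tau> z = (\<Prod>i\<in>{1..n}. \<tau> i (z i))"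

text \<open>
  Expectations of products of functions of single labels factorize under the product law; the
  special cases of no, one and two nodes follow.
\<close>

lemma sum_labels_prob_prod:
  fixes \<tau> :: "nat \<Rightarrow> 'k::finite \<Rightarrow> real"
  assumes tau: "\<And>i. i \<in> {1..n} \<Longrightarrow> prob_vec (\<tau> i)" and S: "S \<subseteq> {1..n}"
  shows "(\<Sum>z\<in>labelings n. labels_prob n \<tau> z * (\<Prod>x\<in>S. f x (z x))) = (\<Prod>x\<in>S. \<Sum>a\<in>UNIV. \<tau> x a * f x a)"
proof -
  let ?h = "\<lambda>x a. \<tau> x a * (if x \<in> S then f x a else 1)"
  have restr: "(\<Prod>x\<in>{1..n}. if x \<in> S then h x else 1) = (\<Prod>x\<in>S. h x)" for h :: "nat \<Rightarrow> real"
    using S by (simp add: prod.inter_restrict[symmetric] Int_absorb1)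
  have "(\<Sum>z\<in>labelings n. labels_prob n \<tau> z * (\<Prod>x\<in>S. f x (z x)))
      = (\<Sum>z\<in>labelings n. \<Prod>x\<in>{1..n}. ?h x (z x))"
    unfolding labels_prob_def by (simp add: prod.distrib flip: restr)
  also have "\<dots> = (\<Prod>x\<in>{1..n}. \<Sum>a\<in>UNIV. ?h x a)"
    unfolding labelings_def by (rule prod_sum_PiE[symmetric]) auto
  also have "\<dots> = (\<Prod>x\<in>{1..n}. if x \<in> S then \<Sum>a\<in>UNIV. \<tau> x a * f x a else 1)"
    using tau by (intro prod.cong) (auto simp: prob_vec_def)
  also have "\<dots> = (\<Prod>x\<in>S. \<Sum>a\<in>UNIV. \<tau> x a * f x a)" by (rule restr)
  finally show ?thesis .
qed

lemma sum_labels_prob: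
  assumes "\<And>i. i \<in> {1..n} \<Longrightarrow> prob_vec (\<tau> i)"
  shows "(\<Sum>z\<in>labelings n. labels_prob n \<tau> z) = 1"
  using sum_labels_prob_prod[of n \<tau> "{}"] assms by simp

lemma sum_labels_prob_single:
  assumes "\<And>i. i \<in> {1..n} \<Longrightarrow> prob_vec (\<tau> i)" "i \<in> {1..n}"
  shows "(\<Sum>z\<in>labelings n. labels_prob n \<tau> z * f (z i)) = (\<Sum>a\<in>UNIV. \<tau> i a * f a)"
  using sum_labels_prob_prod[of n \<tau> "{i}" "\<lambda>_. f"] assms by simp

lemma sum_labels_prob_pair:
  fixes \<tau> :: "nat \<Rightarrow> 'k::finite \<Rightarrow> real"
  assumes tau: "\<And>i. i \<in> {1..n} \<Longrightarrow> prob_vec (\<tau> i)" and ij: "i \<in> {1..n}" "j \<in> {1..n}" "i \<noteq> j"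
  shows "(\<Sum>z\<in>labelings n. labels_prob n \<tau> z * f (z i) (z j)) = (\<Sum>c\<in>UNIV. \<Sum>d\<in>UNIV. \<tau> i c * \<tau> j d * f c d)"
proof -
  have exp: "f (z i) (z j) = (\<Sum>c\<in>UNIV. \<Sum>d\<in>UNIV. (of_bool (z i = c) * of_bool (z j = d)) * f c d)" for z
    by (simp only: mult.assoc sum_of_bool_point flip: sum_distrib_left)
  have "(\<Sum>z\<in>labelings n. labels_prob n \<tau> z * f (z i) (z j))
     = (\<Sum>z\<in>labelings n. \<Sum>c\<in>UNIV. \<Sum>d\<in>UNIV. labels_prob n \<tau> z * (of_bool (z i = c) * of_bool (z j = d)) * f c d)"
    unfolding exp by (simp only: sum_distrib_left mult.assoc)
  also have "\<dots> = (\<Sum>c\<in>UNIV. \<Sum>d\<in>UNIV. \<Sum>z\<in>labelings n. labels_prob n \<tau> z * (of_bool (z i = c) * of_bool (z j = d)) * f c d)"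
    by (subst sum.swap, rule sum.cong[OF refl], rule sum.swap)
  also have "\<dots> = (\<Sum>c\<in>UNIV. \<Sum>d\<in>UNIV. \<tau> i c * \<tau> j d * f c d)"
  proof (rule sum.cong[OF refl], rule sum.cong[OF refl])
    fix c d
    have pt: "(\<Sum>a\<in>UNIV. \<tau> x a * of_bool (a = b)) = \<tau> x b" for x b
      by (subst sum.remove[of _ b]) auto
    show "(\<Sum>z\<in>labelings n. labels_prob n \<tau> z * (of_bool (z i = c) * of_bool (z j = d)) * f c d) = \<tau> i c * \<tau> j d * f c d"
      using sum_labels_prob_prod[of n \<tau> "{i, j}" "\<lambda>x a. of_bool (a = (if x = i then c else d))"] assms pt
      by (simp flip: sum_distrib_right)
  qed
  finally show ?thesis .
qed

text \<open>
  The evidence lower bound. The convention \<open>ln 0 = 0\<close> is harmless here, since \<open>ln (\<tau> i a)\<close> is multiplied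
  by \<open>\<tau> i a\<close>.
\<close>

definition elbo :: "nat \<Rightarrow> (nat \<Rightarrow> nat \<Rightarrow> real) \<Rightarrow> (nat \<Rightarrow> 'k::finite \<Rightarrow> real) \<Rightarrow> ('k \<Rightarrow> real) \<Rightarrow> real^'k^'k \<Rightarrow> real" where
  "elbo n A \<tau> \<alpha> Q = (\<Sum>z\<in>labelings n. labels_prob n \<tau> z * log_lik n A z Q)
     + (\<Sum>i\<in>{1..n}. \<Sum>a\<in>UNIV. \<tau> i a * (ln (\<alpha> a) - ln (\<tau> i a)))"

text \<open>
  The normalizing constant of the posterior cancels against the leading logarithm, and the product
  form of both laws turns the remaining divergence into a sum over the nodes.
\<close>

lemma variational_objective_eq_elbo:
  fixes \<alpha> :: "'k::finite pmf"
  assumes pos: "\<And>a. 0 < pmf \<alpha> a"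
  shows "variational_objective n A \<tau> \<alpha> Q = elbo n A (\<lambda>i. pmf (\<tau> i)) (pmf \<alpha>) Q"
proof -
  let ?t = "\<lambda>i. pmf (\<tau> i)" and ?m = "marginal_lik n A \<alpha> Q"
  have q: "pmf (product_law n \<tau>) z = labels_prob n ?t z" if "z \<in> labelings n" for z
    using that unfolding product_law_def labels_prob_def labelings_def
    by (subst pmf_Pi') (auto simp: PiE_def extensional_def)
  have term_eq: "labels_prob n ?t z * ln (labels_prob n ?t z / pmf (posterior n A \<alpha> Q) z) =
      labels_prob n ?t z * ln ?m - labels_prob n ?t z * log_lik n A z Q
        - (\<Sum>i\<in>{1..n}. labels_prob n ?t z * (ln (pmf \<alpha> (z i)) - ln (?t i (z i))))"
    if z: "z \<in> labelings n" for z
  proof (cases "labels_prob n ?t z = 0")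
    case False
    then have t: "0 < ?t i (z i)" if "i \<in> {1..n}" for i
      using that by (auto simp: labels_prob_def intro: pmf_pos)
    have Lp: "0 < labels_prob n ?t z" unfolding labels_prob_def by (intro prod_pos) (use t in auto)
    have Jp: "0 < joint_lik n A \<alpha> Q z" unfolding joint_lik_def by (intro mult_pos_pos prod_pos) (use pos in auto)
    have "ln (labels_prob n ?t z / pmf (posterior n A \<alpha> Q) z) = ln (labels_prob n ?t z) - ln (joint_lik n A \<alpha> Q z) + ln ?m"
      using z Lp Jp marginal_lik_pos[of n A \<alpha> Q] by (simp add: pmf_posterior ln_div ln_mult)
    also have "ln (labels_prob n ?t z) = (\<Sum>i\<in>{1..n}. ln (?t i (z i)))"
      unfolding labels_prob_def by (rule ln_prod) (simp, metis t order_less_irrefl)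
    also have "ln (joint_lik n A \<alpha> Q z) = (\<Sum>i\<in>{1..n}. ln (pmf \<alpha> (z i))) + log_lik n A z Q"
    proof -
      have "0 < (\<Prod>i\<in>{1..n}. pmf \<alpha> (z i))" by (intro prod_pos) (use pos in auto)
      then show ?thesis unfolding joint_lik_def using pos by (simp add: ln_mult ln_prod less_imp_neq[OF pos, symmetric])
    qed
    finally have "ln (labels_prob n ?t z / pmf (posterior n A \<alpha> Q) z) = (\<Sum>i\<in>{1..n}. ln (?t i (z i)))
        - ((\<Sum>i\<in>{1..n}. ln (pmf \<alpha> (z i))) + log_lik n A z Q) + ln ?m" .
    then show ?thesis
      by (simp only: sum_distrib_left[symmetric] sum_subtractf) (simp add: algebra_simps)
  qed simp
  have "variational_objective n A \<tau> \<alpha> Q = ln ?m - (\<Sum>z\<in>labelings n.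
      labels_prob n ?t z * ln (labels_prob n ?t z / pmf (posterior n A \<alpha> Q) z))"
    unfolding variational_objective_def KL_divergence_posterior[OF pos] by (simp add: q)
  also have "(\<Sum>z\<in>labelings n. labels_prob n ?t z * ln (labels_prob n ?t z / pmf (posterior n A \<alpha> Q) z))
     = (\<Sum>z\<in>labelings n. labels_prob n ?t z * ln ?m - labels_prob n ?t z * log_lik n A z Q
        - (\<Sum>i\<in>{1..n}. labels_prob n ?t z * (ln (pmf \<alpha> (z i)) - ln (?t i (z i)))))"
    by (intro sum.cong refl term_eq)
  also have "\<dots> = ln ?m - (\<Sum>z\<in>labelings n. labels_prob n ?t z * log_lik n A z Q)
      - (\<Sum>i\<in>{1..n}. \<Sum>z\<in>labelings n. labels_prob n ?t z * (ln (pmf \<alpha> (z i)) - ln (?t i (z i))))"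
    by (subst sum.swap[where A = "{1..n}" and B = "labelings n"]) (simp add: sum_subtractf sum_labels_prob prob_vec_pmf flip: sum_distrib_right)
  also have "(\<Sum>i\<in>{1..n}. \<Sum>z\<in>labelings n. labels_prob n ?t z * (ln (pmf \<alpha> (z i)) - ln (?t i (z i))))
     = (\<Sum>i\<in>{1..n}. \<Sum>a\<in>UNIV. ?t i a * (ln (pmf \<alpha> a) - ln (?t i a)))"
    by (rule sum.cong[OF refl], rule sum_labels_prob_single[where f = "\<lambda>a. ln (pmf \<alpha> a) - ln (?t i a)" for i])
       (auto simp: prob_vec_pmf)
  finally show ?thesis by (simp add: elbo_def)
qed

lemma log_lik_term_nonpos:
  assumes "admissible Q"
  shows "adjacency e i j * ln (Q $ a $ b) + (1 - adjacency e i j) * ln (1 - Q $ a $ b) \<le> 0"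
  using assms adjacency_cases[of e i j] by (auto intro: less_imp_le)

lemma log_lik_nonpos:
  assumes "admissible Q" shows "log_lik n (adjacency e) z Q \<le> 0"
  unfolding log_lik_def using log_lik_term_nonpos[OF assms] by (intro sum_nonpos) auto

section \<open>Localization of good variational candidates\<close>

text \<open>
  Unlike the number of errors, which involves an optimal relabeling that changes with \<open>z\<close>, this loss is
  invariant under relabelings and depends on two labels at a time. Its mean under a product law is
  therefore explicit.
\<close>

definition pair_disagreement :: "nat \<Rightarrow> (nat \<Rightarrow> 'k) \<Rightarrow> (nat \<Rightarrow> 'k) \<Rightarrow> real" where
  "pair_disagreement n y z =
     (\<Sum>i\<in>{1..n}. \<Sum>j\<in>{1..n}-{i}. (of_bool (y i = y j) - of_bool (z i = z j))\<^sup>2)"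

text \<open>
  Two correctly labeled nodes never disagree with \<open>y\<close>, and each error lies in at most \<open>2 n\<close> ordered
  pairs.
\<close>

lemma pair_disagreement_le_errors:
  assumes "inj \<sigma>"
  shows "pair_disagreement n y z \<le> 2 * real n * real (errors n z (\<sigma> \<circ> y))"
proof -
  let ?m = "\<lambda>i. of_bool (z i \<noteq> \<sigma> (y i)) :: real"
  have m: "(\<Sum>i\<in>{1..n}. ?m i) = real (errors n z (\<sigma> \<circ> y))"
    by (simp add: errors_def Int_def)
  have "pair_disagreement n y z \<le> (\<Sum>i\<in>{1..n}. \<Sum>j\<in>{1..n}-{i}. ?m i + ?m j)"
    unfolding pair_disagreement_def using injD[OF assms] by (intro sum_mono) auto
  also have "\<dots> \<le> (\<Sum>i\<in>{1..n}. \<Sum>j\<in>{1..n}. ?m i + ?m j)"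
    by (intro sum_mono sum_mono2) auto
  also have "\<dots> = 2 * real n * (\<Sum>i\<in>{1..n}. ?m i)"
    by (simp add: sum.distrib sum_distrib_left)
  finally show ?thesis unfolding m .
qed

text \<open>
  Entropy against a free reference level \<open>y\<close>. The level \<open>1 / n\<^sup>2\<close> makes the rest term summable over
  the nodes at the price of a factor \<open>2 ln n\<close>; the level \<open>1\<close> serves for the dominant label.
\<close>

lemma neg_x_ln_x_le:
  fixes x y :: real
  assumes "0 \<le> x" "0 < y" shows "- (x * ln x) \<le> x * ln (1 / y) + y - x"
proof (cases "x = 0")
  case False
  then have x: "0 < x" using assms by simp
  have "x * ln (y / x) \<le> x * (y / x - 1)"
    using x assms by (intro mult_left_mono ln_le_minus_one) auto
  also have "\<dots> = y - x" using x by (simp add: field_simps)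
  finally show ?thesis using x assms by (simp add: ln_div algebra_simps)
qed (use assms in simp)

text \<open>
  The event on which the estimators are analyzed; it is shown below to have probability tending to
  one. The inequality \<open>gap\<close> says that an error costs more likelihood than it can gain entropy: the right
  side is the cost per unit of misplaced mass, and the left side exceeds the gain in \<open>entropy_sum_le\<close>
  by \<open>3 k\<close>.
\<close>

locale recoverable =
  fixes n :: nat and e :: "nat \<times> nat \<Rightarrow> bool" and y :: "nat \<Rightarrow> 'k::finite" and \<beta> g :: real
  assumes labels: "y \<in> labelings n"
    and beta: "0 < \<beta>" "\<beta> \<le> 1" and balanced: "balanced \<beta> n y"
    and large: "2 * real CARD('k) \<le> \<beta> * real n"
    and g: "0 < g"
    and separated: "separated n (adjacency e) y g"
    and gap: "2 * ln (real n) + ln (1 / \<beta>) + 2 + 3 * real CARD('k) \<le> g * separation_const (real CARD('k)) \<beta> 1 / 2"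
    and averages: "admissible (block_averages n (adjacency e) y)"
begin

abbreviation "A \<equiv> adjacency e"
abbreviation "Lhat \<equiv> log_lik n A y (block_averages n A y)"

text \<open>
  The candidate of reference is the point mass at \<open>y\<close> with the class frequencies and the block averages;
  a maximizer does at least as well.
\<close>

definition freq :: "'k \<Rightarrow> real" where
  "freq a = real (card {i\<in>{1..n}. y i = a}) / real n"

definition reference :: real where
  "reference = Lhat + (\<Sum>i\<in>{1..n}. ln (freq (y i)))"

lemma n_pos: "0 < n"
  using large beta by (cases n) (auto simp: mult_le_0_iff)

lemma k_pos: "1 \<le> real CARD('k)"
  by (simp add: Suc_leI)

lemma freq_ge: "\<beta> \<le> freq a"
  using balanced n_pos by (simp add: balanced_def freq_def field_simps)

lemma freq_pos: "0 < freq a"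
  using freq_ge[of a] beta by simp

lemma sum_by_class:
  fixes f :: "'k \<Rightarrow> real"
  shows "(\<Sum>i\<in>{1..n}. f (y i)) = real n * (\<Sum>a\<in>UNIV. freq a * f a)"
proof -
  have "(\<Sum>i\<in>{1..n}. f (y i)) = (\<Sum>a\<in>UNIV. \<Sum>i\<in>{i\<in>{1..n}. y i = a}. f (y i))"
    by (rule sum.group[symmetric]) auto
  also have "\<dots> = (\<Sum>a\<in>UNIV. real n * (freq a * f a))"
    using n_pos by (intro sum.cong) (auto simp: freq_def)
  finally show ?thesis by (simp add: sum_distrib_left)
qed

lemma prob_vec_freq: "prob_vec freq"
  using sum_by_class[of "\<lambda>_. 1"] n_pos freq_pos by (auto simp: prob_vec_def intro: less_imp_le)

lemma reference_eq_elbo: "elbo n A (\<lambda>i a. of_bool (y i = a)) freq (block_averages n A y) = reference"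
proof -
  have P: "labels_prob n (\<lambda>i a. of_bool (y i = a)) z = of_bool (y = z)" if "z \<in> labelings n" for z
  proof (cases "y = z")
    case False
    then obtain i where i: "y i \<noteq> z i" by auto
    then have "i \<in> {1..n}" using PiE_arb[of y] PiE_arb[of z] labels that unfolding labelings_def by metis
    then show ?thesis using i False unfolding labels_prob_def by (auto intro!: prod_zero)
  qed (simp add: labels_prob_def)
  have "(\<Sum>z\<in>labelings n. labels_prob n (\<lambda>i a. of_bool (y i = a)) z * log_lik n A z (block_averages n A y))
     = (\<Sum>z\<in>labelings n. of_bool (y = z) * log_lik n A z (block_averages n A y))"
    by (intro sum.cong) (auto simp: P)
  also have "\<dots> = Lhat" using labels by (subst sum.remove[of _ y]) auto
  finally have 1: "(\<Sum>z\<in>labelings n. labels_prob n (\<lambda>i a. of_bool (y i = a)) z * log_lik n A z (block_averages n A y)) = Lhat" .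
  have 2: "(\<Sum>a\<in>UNIV. of_bool (y i = a) * (ln (freq a) - ln (of_bool (y i = a)))) = ln (freq (y i))" for i
    by (subst sum_of_bool_point) simp
  show ?thesis unfolding elbo_def 1 2 reference_def ..
qed

text \<open>
  The relabeling \<open>\<sigma>\<close> depends on \<open>\<tau>\<close> alone. For each \<open>z\<close> the number of errors, under a relabeling of its
  own, dominates the pair disagreement divided by \<open>2 n\<close>, and \<open>soft_separation\<close> for the identity matrix
  bounds the mean of the latter.
\<close>

lemma expected_log_lik_le:
  fixes \<tau> :: "nat \<Rightarrow> 'k \<Rightarrow> real"
  assumes tau: "\<And>i. i \<in> {1..n} \<Longrightarrow> prob_vec (\<tau> i)"
  shows "\<exists>\<sigma>. bij \<sigma> \<and> (\<forall>Q. admissible Q \<longrightarrow> (\<Sum>z\<in>labelings n. labels_prob n \<tau> z * log_lik n A z Q)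
     \<le> Lhat - g * separation_const (real CARD('k)) \<beta> 1 / 2 * (\<Sum>i\<in>{1..n}. 1 - \<tau> i (\<sigma> (y i))))"
proof -
  let ?s = "separation_const (real CARD('k)) \<beta> 1"
  let ?I = "\<lambda>a b. of_bool (a = b) :: real"
  obtain \<sigma> :: "'k \<Rightarrow> 'k" where \<sigma>: "bij \<sigma>" and le:
    "\<beta>\<^sup>2 * 1\<^sup>2 / (8 * (real CARD('k))\<^sup>2) * real (card {1..n}) * (\<Sum>i\<in>{1..n}. 1 - \<tau> i (\<sigma> (y i)))
      \<le> (\<Sum>i\<in>{1..n}. \<Sum>j\<in>{1..n}-{i}. \<Sum>c\<in>UNIV. \<Sum>d\<in>UNIV. \<tau> i c * \<tau> j d * (?I (y i) (y j) - ?I c d)\<^sup>2)"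
    using soft_separation[of "{1..n}" \<tau> \<beta> 1 y ?I ?I] tau beta large balanced
    by (force simp: balanced_def prob_vec_def)
  have "(\<Sum>i\<in>{1..n}. \<Sum>j\<in>{1..n}-{i}. \<Sum>c\<in>UNIV. \<Sum>d\<in>UNIV. \<tau> i c * \<tau> j d * (?I (y i) (y j) - ?I c d)\<^sup>2)
     = (\<Sum>i\<in>{1..n}. \<Sum>j\<in>{1..n}-{i}. \<Sum>z\<in>labelings n. labels_prob n \<tau> z * (?I (y i) (y j) - ?I (z i) (z j))\<^sup>2)"
    by (intro sum.cong refl sum_labels_prob_pair[symmetric] tau) auto
  also have "\<dots> = (\<Sum>i\<in>{1..n}. \<Sum>z\<in>labelings n. \<Sum>j\<in>{1..n}-{i}. labels_prob n \<tau> z * (?I (y i) (y j) - ?I (z i) (z j))\<^sup>2)"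
    by (rule sum.cong[OF refl], rule sum.swap)
  also have "\<dots> = (\<Sum>z\<in>labelings n. \<Sum>i\<in>{1..n}. \<Sum>j\<in>{1..n}-{i}. labels_prob n \<tau> z * (?I (y i) (y j) - ?I (z i) (z j))\<^sup>2)"
    by (rule sum.swap)
  also have "\<dots> = (\<Sum>z\<in>labelings n. labels_prob n \<tau> z * pair_disagreement n y z)"
    unfolding pair_disagreement_def sum_distrib_left ..
  finally have dis: "?s * real n * (\<Sum>i\<in>{1..n}. 1 - \<tau> i (\<sigma> (y i))) \<le> (\<Sum>z\<in>labelings n. labels_prob n \<tau> z * pair_disagreement n y z)"
    using le by (simp add: separation_const_def)
  have P0: "0 \<le> labels_prob n \<tau> z" for z
    unfolding labels_prob_def using tau by (intro prod_nonneg) (auto simp: prob_vec_def)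
  have "(\<Sum>z\<in>labelings n. labels_prob n \<tau> z * log_lik n A z Q)
     \<le> Lhat - g * ?s / 2 * (\<Sum>i\<in>{1..n}. 1 - \<tau> i (\<sigma> (y i)))" if Q: "admissible Q" for Q
  proof -
    have "log_lik n A z Q \<le> Lhat - g / (2 * real n) * pair_disagreement n y z" if z: "z \<in> labelings n" for z
    proof -
      obtain \<sigma>' :: "'k \<Rightarrow> 'k" where s': "bij \<sigma>'" and L: "log_lik n A z Q \<le> Lhat - g * real (errors n z (\<sigma>' \<circ> y))"
        using separated z Q unfolding separated_def by blast
      have "pair_disagreement n y z \<le> 2 * real n * real (errors n z (\<sigma>' \<circ> y))"
        by (rule pair_disagreement_le_errors[OF bij_is_inj[OF s']])
      then have "g / (2 * real n) * pair_disagreement n y z \<le> g / (2 * real n) * (2 * real n * real (errors n z (\<sigma>' \<circ> y)))"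
        using g by (intro mult_left_mono) auto
      also have "\<dots> = g * real (errors n z (\<sigma>' \<circ> y))" using n_pos by simp
      finally show ?thesis using L by simp
    qed
    then have "(\<Sum>z\<in>labelings n. labels_prob n \<tau> z * log_lik n A z Q)
       \<le> (\<Sum>z\<in>labelings n. labels_prob n \<tau> z * (Lhat - g / (2 * real n) * pair_disagreement n y z))"
      by (intro sum_mono mult_left_mono P0)
    also have "\<dots> = Lhat - g / (2 * real n) * (\<Sum>z\<in>labelings n. labels_prob n \<tau> z * pair_disagreement n y z)"
      using sum_labels_prob[of n \<tau>] tau
      by (simp add: right_diff_distrib sum_subtractf sum_distrib_left mult_ac flip: sum_distrib_right)
    also have "\<dots> \<le> Lhat - g / (2 * real n) * (?s * real n * (\<Sum>i\<in>{1..n}. 1 - \<tau> i (\<sigma> (y i))))"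
      using g by (intro diff_left_mono mult_left_mono dis) auto
    also have "\<dots> = Lhat - g * ?s / 2 * (\<Sum>i\<in>{1..n}. 1 - \<tau> i (\<sigma> (y i)))"
      using n_pos by simp
    finally show ?thesis .
  qed
  then show ?thesis using \<sigma> by blast
qed

lemma entropy_term_le:
  fixes p :: "'k \<Rightarrow> real"
  assumes p: "prob_vec p" and \<alpha>: "\<And>a. 0 < \<alpha> a" "\<And>a. \<alpha> a \<le> 1"
  shows "(\<Sum>a\<in>UNIV. p a * (ln (\<alpha> a) - ln (p a)))
    \<le> p t * ln (\<alpha> t) + (1 - p t) * (1 + 2 * ln (real n)) + real CARD('k) / (real n)\<^sup>2"
proof -
  have p0: "0 \<le> p a" for a using p by (simp add: prob_vec_def)
  have rest: "(\<Sum>a\<in>UNIV - {t}. p a) = 1 - p t"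
    using p sum.remove[of UNIV t p] by (auto simp: prob_vec_def)
  have one: "p a * (ln (\<alpha> a) - ln (p a)) \<le> p a * (2 * ln (real n)) + 1 / (real n)\<^sup>2" for a
  proof -
    have "p a * ln (\<alpha> a) \<le> 0"
      using p0[of a] \<alpha>[of a] by (intro mult_nonneg_nonpos) (auto simp: less_imp_le)
    moreover have "- (p a * ln (p a)) \<le> p a * ln (1 / (1 / (real n)\<^sup>2)) + 1 / (real n)\<^sup>2 - p a"
      using n_pos by (intro neg_x_ln_x_le p0) auto
    moreover have "ln (1 / (1 / (real n)\<^sup>2)) = 2 * ln (real n)"
      using n_pos by (simp add: ln_realpow)
    ultimately show ?thesis using p0[of a] by (simp add: right_diff_distrib)
  qed
  have "(\<Sum>a\<in>UNIV. p a * (ln (\<alpha> a) - ln (p a)))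
      = p t * (ln (\<alpha> t) - ln (p t)) + (\<Sum>a\<in>UNIV - {t}. p a * (ln (\<alpha> a) - ln (p a)))"
    by (rule sum.remove) auto
  also have "\<dots> \<le> (p t * ln (\<alpha> t) + (1 - p t)) + (\<Sum>a\<in>UNIV - {t}. p a * (2 * ln (real n)) + 1 / (real n)\<^sup>2)"
    using neg_x_ln_x_le[OF p0, of 1 t] by (intro add_mono sum_mono one) (simp add: right_diff_distrib)
  also have "(\<Sum>a\<in>UNIV - {t}. p a * (2 * ln (real n)) + 1 / (real n)\<^sup>2)
      = (1 - p t) * (2 * ln (real n)) + (\<Sum>a\<in>UNIV - {t}. 1 / (real n)\<^sup>2)"
    unfolding sum.distrib rest[symmetric] by (simp add: sum_distrib_right)
  also have "(\<Sum>a\<in>UNIV - {t}. 1 / (real n)\<^sup>2) \<le> (\<Sum>a\<in>(UNIV::'k set). 1 / (real n)\<^sup>2)"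
    by (rule sum_mono2) auto
  finally show ?thesis by (simp add: algebra_simps)
qed

text \<open>
  Against the reference, changing \<open>\<alpha>\<close> from the class frequencies gains nothing to first order,
  because the ratios \<open>r\<close> of the two have mean one over the nodes; what remains is proportional to the
  misplaced mass.
\<close>

lemma entropy_sum_le:
  fixes \<tau> :: "nat \<Rightarrow> 'k \<Rightarrow> real"
  assumes tau: "\<And>i. i \<in> {1..n} \<Longrightarrow> prob_vec (\<tau> i)" and \<alpha>: "prob_vec \<alpha>" "\<And>a. 0 < \<alpha> a" and \<sigma>: "bij \<sigma>"
  shows "(\<Sum>i\<in>{1..n}. \<Sum>a\<in>UNIV. \<tau> i a * (ln (\<alpha> a) - ln (\<tau> i a))) - (\<Sum>i\<in>{1..n}. ln (freq (y i)))
    \<le> (2 * ln (real n) + ln (1 / \<beta>) + 2) * (\<Sum>i\<in>{1..n}. 1 - \<tau> i (\<sigma> (y i))) + real CARD('k) / real n"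
proof -
  define \<epsilon> where "\<epsilon> i = 1 - \<tau> i (\<sigma> (y i))" for i
  define r where "r a = \<alpha> (\<sigma> a) / freq a" for a
  have eps: "0 \<le> \<epsilon> i" "\<epsilon> i \<le> 1" if "i \<in> {1..n}" for i
    using tau[OF that] prob_vec_le_1[OF tau[OF that]] by (auto simp: \<epsilon>_def prob_vec_def)
  have r0: "0 < r a" for a unfolding r_def by (simp add: \<alpha> freq_pos)
  have freq1: "freq a \<le> 1" for a using prob_vec_le_1[OF prob_vec_freq] .
  have one: "(\<Sum>a\<in>UNIV. \<tau> i a * (ln (\<alpha> a) - ln (\<tau> i a))) - ln (freq (y i))
      \<le> (r (y i) - 1) + \<epsilon> i * (2 * ln (real n) + ln (1 / \<beta>) + 2) + real CARD('k) / (real n)\<^sup>2"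
    if i: "i \<in> {1..n}" for i
  proof -
    have "(\<Sum>a\<in>UNIV. \<tau> i a * (ln (\<alpha> a) - ln (\<tau> i a)))
      \<le> (1 - \<epsilon> i) * ln (\<alpha> (\<sigma> (y i))) + \<epsilon> i * (1 + 2 * ln (real n)) + real CARD('k) / (real n)\<^sup>2"
      using entropy_term_le[OF tau[OF i], of \<alpha> "\<sigma> (y i)"] \<alpha>(2) prob_vec_le_1[OF \<alpha>(1)] by (simp add: \<epsilon>_def)
    moreover have "ln (\<alpha> (\<sigma> (y i))) = ln (r (y i)) + ln (freq (y i))"
      using \<alpha>(2)[of "\<sigma> (y i)"] freq_pos[of "y i"] by (simp add: r_def ln_div)
    moreover have "(1 - \<epsilon> i) * ln (r (y i)) \<le> (1 - \<epsilon> i) * (r (y i) - 1)"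
      using eps[OF i] r0 by (intro mult_left_mono ln_le_minus_one) auto
    moreover have "\<epsilon> i * (- ln (freq (y i))) \<le> \<epsilon> i * ln (1 / \<beta>)"
      using eps[OF i] freq_ge[of "y i"] freq_pos[of "y i"] beta by (intro mult_left_mono) (auto simp: ln_div)
    moreover have "0 \<le> \<epsilon> i * r (y i)" using eps[OF i] r0[of "y i"] by simp
    ultimately show ?thesis by (simp add: algebra_simps)
  qed
  have "(\<Sum>i\<in>{1..n}. r (y i)) = real n * (\<Sum>a\<in>UNIV. freq a * r a)" by (rule sum_by_class)
  also have "(\<Sum>a\<in>UNIV. freq a * r a) = (\<Sum>a\<in>UNIV. \<alpha> (\<sigma> a))"
    using freq_pos by (intro sum.cong) (auto simp: r_def less_imp_neq[OF freq_pos, symmetric])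
  also have "\<dots> = 1" using sum.reindex_bij_betw[OF \<sigma>, of \<alpha>] \<alpha>(1) by (simp add: prob_vec_def)
  finally have sr: "(\<Sum>i\<in>{1..n}. r (y i) - 1) = 0" by (simp add: sum_subtractf)
  have "(\<Sum>i\<in>{1..n}. \<Sum>a\<in>UNIV. \<tau> i a * (ln (\<alpha> a) - ln (\<tau> i a))) - (\<Sum>i\<in>{1..n}. ln (freq (y i)))
     = (\<Sum>i\<in>{1..n}. (\<Sum>a\<in>UNIV. \<tau> i a * (ln (\<alpha> a) - ln (\<tau> i a))) - ln (freq (y i)))"
    by (rule sum_subtractf[symmetric])
  also have "\<dots> \<le> (\<Sum>i\<in>{1..n}. (r (y i) - 1) + \<epsilon> i * (2 * ln (real n) + ln (1 / \<beta>) + 2) + real CARD('k) / (real n)\<^sup>2)"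
    by (intro sum_mono one)
  also have "\<dots> = (2 * ln (real n) + ln (1 / \<beta>) + 2) * (\<Sum>i\<in>{1..n}. \<epsilon> i) + real CARD('k) / real n"
    using n_pos unfolding sum.distrib sr by (simp add: power2_eq_square mult.commute flip: sum_distrib_right)
  finally show ?thesis by (simp add: \<epsilon>_def)
qed

text \<open>
  Gain and loss are both linear in the misplaced mass \<open>m\<close>, up to the rest term \<open>k / n\<close>; by \<open>gap\<close> the
  difference of the slopes is at least \<open>3 k\<close>, whence \<open>m \<le> 1 / (3 n)\<close>.
\<close>

lemma elbo_localizes:
  fixes \<tau> :: "nat \<Rightarrow> 'k \<Rightarrow> real"
  assumes tau: "\<And>i. i \<in> {1..n} \<Longrightarrow> prob_vec (\<tau> i)" and \<alpha>: "prob_vec \<alpha>" "\<And>a. 0 < \<alpha> a"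
    and Q: "admissible Q" and ge: "reference \<le> elbo n A \<tau> \<alpha> Q"
  shows "\<exists>\<sigma>. bij \<sigma> \<and> (\<forall>i\<in>{1..n}. 1 / 2 < \<tau> i (\<sigma> (y i)))"
proof -
  let ?k = "real CARD('k)"
  obtain \<sigma> :: "'k \<Rightarrow> 'k" where \<sigma>: "bij \<sigma>" and L: "(\<Sum>z\<in>labelings n. labels_prob n \<tau> z * log_lik n A z Q)
     \<le> Lhat - g * separation_const ?k \<beta> 1 / 2 * (\<Sum>i\<in>{1..n}. 1 - \<tau> i (\<sigma> (y i)))"
    using expected_log_lik_le[of \<tau>] tau Q by blast
  define m where "m = (\<Sum>i\<in>{1..n}. 1 - \<tau> i (\<sigma> (y i)))"
  have nn: "0 \<le> 1 - \<tau> i (\<sigma> (y i))" if "i \<in> {1..n}" for i using prob_vec_le_1[OF tau[OF that]] by simp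
  have m0: "0 \<le> m" unfolding m_def by (intro sum_nonneg nn)
  have "0 \<le> (2 * ln (real n) + ln (1 / \<beta>) + 2) * m + ?k / real n - g * separation_const ?k \<beta> 1 / 2 * m"
  proof -
    have "(\<Sum>i\<in>{1..n}. \<Sum>a\<in>UNIV. \<tau> i a * (ln (\<alpha> a) - ln (\<tau> i a))) - (\<Sum>i\<in>{1..n}. ln (freq (y i)))
      \<le> (2 * ln (real n) + ln (1 / \<beta>) + 2) * (\<Sum>i\<in>{1..n}. 1 - \<tau> i (\<sigma> (y i))) + ?k / real n"
      by (intro entropy_sum_le tau \<alpha> \<sigma>)
    then show ?thesis using L ge unfolding elbo_def reference_def m_def by linarith
  qed
  moreover have "(2 * ln (real n) + ln (1 / \<beta>) + 2 + 3 * ?k) * m \<le> g * separation_const ?k \<beta> 1 / 2 * m"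
    by (rule mult_right_mono[OF gap m0])
  moreover have "r * m \<le> s" if "0 \<le> X * m + s - Y * m" "(X + r) * m \<le> Y * m" for X Y r s
    using that by (simp add: distrib_right)
  ultimately have "3 * ?k * m \<le> ?k / real n" by blast
  also have "\<dots> \<le> ?k" using n_pos by (simp add: divide_le_eq)
  finally have m: "m \<le> 1 / 3" using k_pos by simp
  have "1 / 2 < \<tau> i (\<sigma> (y i))" if i: "i \<in> {1..n}" for i
  proof -
    have "1 - \<tau> i (\<sigma> (y i)) \<le> m" unfolding m_def using i nn by (intro member_le_sum) auto
    then show ?thesis using m by simp
  qed
  then show ?thesis using \<sigma> by blast
qed

end

section \<open>Existence of variational estimates\<close>

lemma compact_PiE_UNIV:
  fixes S :: "'i \<Rightarrow> 'a::topological_space set"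
  assumes "\<And>i. compact (S i)"
  shows "compact (PiE UNIV S)"
  using assms compactin_PiE[of "\<lambda>_. euclidean" UNIV S] by (simp add: euclidean_product_topology)

lemma compact_prob_vec: "compact (Collect (prob_vec :: ('k::finite \<Rightarrow> real) \<Rightarrow> bool))"
proof -
  have eq: "Collect prob_vec = PiE UNIV (\<lambda>_. {0..1}) \<inter> {p :: 'k \<Rightarrow> real. (\<Sum>a\<in>UNIV. p a) = 1}"
    using prob_vec_le_1 by (fastforce simp: prob_vec_def PiE_def)
  show ?thesis unfolding eq
    by (intro compact_Int_closed compact_PiE_UNIV closed_Collect_eq continuous_intros continuous_on_product_coordinates)
       auto
qed

lemma continuous_on_x_ln_x: "continuous_on {0..} (\<lambda>x :: real. x * ln x)"
proof (unfold continuous_on_def, intro ballI)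
  fix x :: real assume x: "x \<in> {0..}"
  show "((\<lambda>x. x * ln x) \<longlongrightarrow> x * ln x) (at x within {0..})"
  proof (cases "x = 0")
    case True
    have "((\<lambda>x :: real. x * ln x) \<longlongrightarrow> 0) (at_right 0)" by real_asymp
    then have "((\<lambda>x :: real. x * ln x) \<longlongrightarrow> 0) (at 0 within {0..})"
      by (simp add: at_within_Ici_at_right)
    then show ?thesis using True by simp
  next
    case False
    then have "isCont (\<lambda>x. x * ln x) x" using x by (intro continuous_intros) auto
    then show ?thesis by (simp add: isCont_def tendsto_within_subset[OF _ subset_UNIV])
  qed
qed

lemma compact_symmetric_box:
  "compact {Q :: real^'k::finite^'k. transpose Q = Q \<and> (\<forall>a b. l \<le> Q $ a $ b \<and> Q $ a $ b \<le> u)}" (is "compact ?S")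
proof -
  have "bounded ?S"
  proof (rule boundedI)
    fix Q assume Q: "Q \<in> ?S"
    have "norm Q \<le> (\<Sum>a\<in>UNIV. norm (Q $ a))" unfolding norm_vec_def by (rule L2_set_le_sum) auto
    also have "\<dots> \<le> (\<Sum>a\<in>UNIV. \<Sum>b\<in>UNIV. \<bar>Q $ a $ b\<bar>)" by (intro sum_mono norm_le_l1_cart)
    also have "\<dots> \<le> (\<Sum>a\<in>(UNIV::'k set). \<Sum>b\<in>(UNIV::'k set). \<bar>l\<bar> + \<bar>u\<bar>)"
    proof (intro sum_mono)
      fix a b
      have "l \<le> Q $ a $ b" "Q $ a $ b \<le> u" using Q by auto
      then show "\<bar>Q $ a $ b\<bar> \<le> \<bar>l\<bar> + \<bar>u\<bar>" by arith
    qed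
    finally show "norm Q \<le> (\<Sum>a\<in>(UNIV::'k set). \<Sum>b\<in>(UNIV::'k set). \<bar>l\<bar> + \<bar>u\<bar>)" .
  qed
  moreover have "closed ?S"
    unfolding transpose_eq_iff
    by (intro closed_Collect_conj closed_Collect_all closed_Collect_eq closed_Collect_le continuous_intros)
  ultimately show ?thesis by (simp add: compact_eq_bounded_closed)
qed

lemma is_variational_estimate_iff:
  fixes \<alpha> :: "'k::finite pmf"
  shows "is_variational_estimate n A (\<alpha>, Q, \<tau>) \<longleftrightarrow> (\<alpha>, Q) \<in> param_space \<and>
    (\<forall>(\<alpha>' :: 'k pmf) Q' \<tau>'. (\<alpha>', Q') \<in> param_space \<longrightarrow>
       variational_objective n A \<tau>' \<alpha>' Q' \<le> variational_objective n A \<tau> \<alpha> Q)"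
  unfolding is_variational_estimate_def is_arg_max_def
  by (simp only: split_paired_Ex prod.case not_ex de_Morgan_conj not_less imp_conv_disj)

context recoverable
begin

lemma averages_witness:
  "\<exists>i j. i \<in> {1..n} \<and> j \<in> {1..n} \<and> i \<noteq> j \<and> y i = a \<and> y j = b \<and> A i j = 1"
  "\<exists>i j. i \<in> {1..n} \<and> j \<in> {1..n} \<and> i \<noteq> j \<and> y i = a \<and> y j = b \<and> A i j = 0"
proof -
  let ?B = "block_pairs n y a b" and ?S = "{(i, j) \<in> block_pairs n y a b. A i j = 1}"
  have av: "0 < real (card ?S) / real (card ?B)" "real (card ?S) / real (card ?B) < 1"
    using averages unfolding block_averages_eq by auto
  then have "0 < card ?S" by (auto intro: gr0I)
  then have "?S \<noteq> {}" by (metis card.empty less_irrefl)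
  then show "\<exists>i j. i \<in> {1..n} \<and> j \<in> {1..n} \<and> i \<noteq> j \<and> y i = a \<and> y j = b \<and> A i j = 1"
    by (fastforce simp: block_pairs_def)
  have "?S \<noteq> ?B"
  proof
    assume "?S = ?B"
    then show False using av by (cases "card ?B = 0") auto
  qed
  then obtain i j where "(i, j) \<in> ?B" "A i j \<noteq> 1" by fastforce
  then show "\<exists>i j. i \<in> {1..n} \<and> j \<in> {1..n} \<and> i \<noteq> j \<and> y i = a \<and> y j = b \<and> A i j = 0"
    using adjacency_cases[of e i j] by (fastforce simp: block_pairs_def)
qed

text \<open>
  A level below which no parameter of a candidate better than the reference can fall. The factor
  \<open>2 ^ n\<close> is the inverse of the least probability that a localized \<open>\<tau>\<close> gives to the true labels.
\<close>

definition param_floor :: real where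
  "param_floor = exp (2 ^ n * (reference - real n * real CARD('k)))"

lemma param_floor_le:
  assumes "0 < x" "reference \<le> (1 / 2) ^ n * ln x + real n * real CARD('k)"
  shows "param_floor \<le> x"
proof -
  have "2 ^ n * (reference - real n * real CARD('k)) \<le> 2 ^ n * ((1 / 2) ^ n * ln x)"
    using assms by (intro mult_left_mono) auto
  also have "\<dots> = ln x" by (simp flip: mult.assoc power_mult_distrib)
  finally show ?thesis using assms by (simp add: param_floor_def ln_ge_iff)
qed

text \<open>
  By localization, each label has a node that gives it mass at least \<open>1 / 2\<close>, and the true labels have
  probability at least \<open>2 ^ (- n)\<close>. As every block contains both an edge and a missing edge, a class
  probability close to \<open>0\<close>, or a connection probability close to \<open>0\<close> or \<open>1\<close>, would make one term of
  the objective very negative, while the other terms sum to at most \<open>n k\<close>.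
\<close>

lemma elbo_localizes_params:
  fixes \<tau> :: "nat \<Rightarrow> 'k \<Rightarrow> real"
  assumes tau: "\<And>i. i \<in> {1..n} \<Longrightarrow> prob_vec (\<tau> i)" and \<alpha>: "prob_vec \<alpha>" "\<And>a. 0 < \<alpha> a"
    and Q: "admissible Q" and ge: "reference \<le> elbo n A \<tau> \<alpha> Q"
  shows "param_floor \<le> \<alpha> a" "param_floor \<le> Q $ a $ b" "Q $ a $ b \<le> 1 - param_floor"
proof -
  let ?k = "real CARD('k)"
  obtain \<sigma> :: "'k \<Rightarrow> 'k" where \<sigma>: "bij \<sigma>" and half: "\<And>i. i \<in> {1..n} \<Longrightarrow> 1 / 2 < \<tau> i (\<sigma> (y i))"
    using elbo_localizes[of \<tau> \<alpha> Q] tau \<alpha> Q ge by blast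
  have t0: "0 \<le> \<tau> i a" if "i \<in> {1..n}" for i a using tau[OF that] by (simp add: prob_vec_def)
  have lna: "ln (\<alpha> a) \<le> 0" for a using \<alpha>(2)[of a] prob_vec_le_1[OF \<alpha>(1), of a] by simp
  have P0: "0 \<le> labels_prob n \<tau> z" for z
    unfolding labels_prob_def by (intro prod_nonneg) (auto simp: t0)
  let ?F = "\<Sum>z\<in>labelings n. labels_prob n \<tau> z * log_lik n A z Q"
  have ent: "(\<Sum>i\<in>{1..n}. \<Sum>b\<in>UNIV. - (\<tau> i b * ln (\<tau> i b))) \<le> real n * ?k"
  proof -
    have "- (\<tau> i b * ln (\<tau> i b)) \<le> 1" if "i \<in> {1..n}" for i b
      using neg_x_ln_x_le[OF t0[OF that], of 1 b] t0[OF that, of b] by simp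
    then have "(\<Sum>i\<in>{1..n}. \<Sum>b\<in>UNIV. - (\<tau> i b * ln (\<tau> i b))) \<le> (\<Sum>i\<in>{1..n}. \<Sum>b\<in>(UNIV::'k set). 1)"
      by (intro sum_mono)
    then show ?thesis by simp
  qed
  have split: "elbo n A \<tau> \<alpha> Q = ?F + (\<Sum>i\<in>{1..n}. \<Sum>b\<in>UNIV. \<tau> i b * ln (\<alpha> b))
      + (\<Sum>i\<in>{1..n}. \<Sum>b\<in>UNIV. - (\<tau> i b * ln (\<tau> i b)))"
    by (simp add: elbo_def right_diff_distrib sum_subtractf sum_negf)
  have nonpos: "\<tau> i b * ln (\<alpha> b) \<le> 0" if "i \<in> {1..n}" for i b
    using t0[OF that] lna by (intro mult_nonneg_nonpos)
  have FQ: "?F \<le> 0" using P0 log_lik_nonpos[OF Q] by (intro sum_nonpos mult_nonneg_nonpos)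
  have pw: "(1 / 2 :: real) ^ n \<le> 1 / 2" using n_pos power_decreasing[of 1 n "1/2 :: real"] by simp
  have z0: "restrict (\<sigma> \<circ> y) {1..n} \<in> labelings n" by (simp add: labelings_def)
  have Pz0: "(1 / 2) ^ n \<le> labels_prob n \<tau> (restrict (\<sigma> \<circ> y) {1..n})"
  proof -
    have "(\<Prod>i\<in>{1..n}. 1 / 2 :: real) \<le> (\<Prod>i\<in>{1..n}. \<tau> i (\<sigma> (y i)))"
      using half by (intro prod_mono) (auto simp: less_imp_le)
    then show ?thesis by (simp add: labels_prob_def)
  qed
  define T where "T i j = A i j * ln (Q $ \<sigma> (y i) $ \<sigma> (y j)) + (1 - A i j) * ln (1 - Q $ \<sigma> (y i) $ \<sigma> (y j))" for i j
  have T0: "T i j \<le> 0" for i j unfolding T_def by (rule log_lik_term_nonpos[OF Q])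
  have pair_le: "reference \<le> (1 / 2) ^ n * T i j + real n * ?k" if ij: "i \<in> {1..n}" "j \<in> {1..n}" "i \<noteq> j" for i j
  proof -
    have ord: "log_lik n A (restrict (\<sigma> \<circ> y) {1..n}) Q \<le> T i j" if "(i, j) \<in> node_pairs n" for i j
    proof -
      have "(case (i, j) of (i, j) \<Rightarrow> - T i j) \<le> (\<Sum>x\<in>node_pairs n. case x of (i, j) \<Rightarrow> - T i j)"
        by (rule member_le_sum[OF that]) (auto simp: T0)
      moreover have "log_lik n A (restrict (\<sigma> \<circ> y) {1..n}) Q = (\<Sum>x\<in>node_pairs n. case x of (i, j) \<Rightarrow> T i j)"
        unfolding log_lik_def T_def by (intro sum.cong) (auto simp: node_pairs_def)
      ultimately show ?thesis by (simp add: case_prod_beta sum_negf)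
    qed
    have sym: "T i j = T j i" using Q by (simp add: T_def transpose_eq_iff adjacency_sym)
    have "log_lik n A (restrict (\<sigma> \<circ> y) {1..n}) Q \<le> T i j"
    proof (cases "i < j")
      case True
      then show ?thesis using ij by (intro ord) (auto simp: node_pairs_def)
    next
      case False
      then show ?thesis unfolding sym using ij by (intro ord) (auto simp: node_pairs_def)
    qed
    then have "labels_prob n \<tau> (restrict (\<sigma> \<circ> y) {1..n}) * log_lik n A (restrict (\<sigma> \<circ> y) {1..n}) Q
        \<le> labels_prob n \<tau> (restrict (\<sigma> \<circ> y) {1..n}) * T i j"
      by (intro mult_left_mono P0)
    also have "\<dots> \<le> (1 / 2) ^ n * T i j"
      by (intro mult_right_mono_neg Pz0 T0)
    finally have "labels_prob n \<tau> (restrict (\<sigma> \<circ> y) {1..n}) * log_lik n A (restrict (\<sigma> \<circ> y) {1..n}) Q \<le> (1 / 2) ^ n * T i j" .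
    moreover have "?F \<le> labels_prob n \<tau> (restrict (\<sigma> \<circ> y) {1..n}) * log_lik n A (restrict (\<sigma> \<circ> y) {1..n}) Q"
    proof -
      have "(\<Sum>z\<in>labelings n - {restrict (\<sigma> \<circ> y) {1..n}}. labels_prob n \<tau> z * log_lik n A z Q) \<le> 0"
        using P0 log_lik_nonpos[OF Q] by (intro sum_nonpos mult_nonneg_nonpos)
      then show ?thesis by (subst sum.remove[OF finite_labelings z0]) simp
    qed
    moreover have "(\<Sum>i\<in>{1..n}. \<Sum>b\<in>UNIV. \<tau> i b * ln (\<alpha> b)) \<le> 0" by (intro sum_nonpos nonpos) auto
    ultimately show ?thesis using ge ent unfolding split by linarith
  qed
  { obtain a' where a': "a = \<sigma> a'" using \<sigma> by (metis bij_pointE)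
    obtain i where i: "i \<in> {1..n}" "y i = a'" using averages_witness(1)[of a' a'] by blast
    have "(\<Sum>i\<in>{1..n}. \<Sum>b\<in>UNIV. \<tau> i b * ln (\<alpha> b)) \<le> (\<Sum>b\<in>UNIV. \<tau> i b * ln (\<alpha> b))"
      using i nonpos by (subst sum.remove[of _ i]) (auto intro!: sum_nonpos)
    also have "\<dots> \<le> \<tau> i a * ln (\<alpha> a)"
      using i nonpos by (subst sum.remove[of _ a]) (auto intro!: sum_nonpos)
    also have "\<dots> \<le> 1 / 2 * ln (\<alpha> a)"
      using half[OF i(1)] lna[of a] a' i by (intro mult_right_mono_neg) auto
    also have "\<dots> \<le> (1 / 2) ^ n * ln (\<alpha> a)" using lna[of a] pw by (intro mult_right_mono_neg) auto
    finally have "reference \<le> (1 / 2) ^ n * ln (\<alpha> a) + real n * ?k"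
      using ge ent FQ unfolding split by linarith
    then show "param_floor \<le> \<alpha> a" by (rule param_floor_le[OF \<alpha>(2)]) }
  obtain a' b' where ab: "a = \<sigma> a'" "b = \<sigma> b'" using \<sigma> by (metis bij_pointE)
  obtain i j where "i \<in> {1..n}" "j \<in> {1..n}" "i \<noteq> j" "y i = a'" "y j = b'" "A i j = 1"
    using averages_witness(1)[of a' b'] by blast
  then have "reference \<le> (1 / 2) ^ n * ln (Q $ a $ b) + real n * ?k" using pair_le[of i j] ab by (simp add: T_def)
  then show "param_floor \<le> Q $ a $ b" using Q by (intro param_floor_le) auto
  obtain i j where "i \<in> {1..n}" "j \<in> {1..n}" "i \<noteq> j" "y i = a'" "y j = b'" "A i j = 0"
    using averages_witness(2)[of a' b'] by blast
  then have "reference \<le> (1 / 2) ^ n * ln (1 - Q $ a $ b) + real n * ?k" using pair_le[of i j] ab by (simp add: T_def)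
  then have "param_floor \<le> 1 - Q $ a $ b" using Q by (intro param_floor_le) auto
  then show "Q $ a $ b \<le> 1 - param_floor" by simp
qed

text \<open>
  The values of \<open>\<tau>\<close> outside \<open>{1..n}\<close> are fixed to make the region compact.
\<close>

definition param_region :: "(('k \<Rightarrow> real) \<times> (real^'k^'k) \<times> (nat \<Rightarrow> 'k \<Rightarrow> real)) set" where
  "param_region = {\<alpha>. prob_vec \<alpha> \<and> (\<forall>a. param_floor \<le> \<alpha> a)}
     \<times> {Q. transpose Q = Q \<and> (\<forall>a b. param_floor \<le> Q $ a $ b \<and> Q $ a $ b \<le> 1 - param_floor)}
     \<times> PiE UNIV (\<lambda>i. if i \<in> {1..n} then Collect prob_vec else {freq})"

lemma param_floor_pos: "0 < param_floor"
  by (simp add: param_floor_def)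

lemma compact_param_region: "compact param_region"
proof -
  have "{\<alpha> :: 'k \<Rightarrow> real. prob_vec \<alpha> \<and> (\<forall>a. param_floor \<le> \<alpha> a)} = Collect prob_vec \<inter> {\<alpha>. \<forall>a. param_floor \<le> \<alpha> a}"
    by auto
  then have "compact {\<alpha> :: 'k \<Rightarrow> real. prob_vec \<alpha> \<and> (\<forall>a. param_floor \<le> \<alpha> a)}"
    by (simp only:) (intro compact_Int_closed compact_prob_vec closed_Collect_all closed_Collect_le
        continuous_intros continuous_on_product_coordinates)
  then show ?thesis
    unfolding param_region_def
    by (intro compact_Times compact_symmetric_box compact_PiE_UNIV) (auto intro: compact_prob_vec)
qed

lemma continuous_on_elbo: "continuous_on param_region (\<lambda>(\<alpha>, Q, \<tau>). elbo n A \<tau> \<alpha> Q)"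
proof -
  have tau: "continuous_on param_region (\<lambda>x. snd (snd x) i a)" for i a
    by (rule continuous_on_product_then_coordinatewise, rule continuous_on_product_then_coordinatewise)
       (intro continuous_intros)
  have al: "continuous_on param_region (\<lambda>x. fst x a)" for a
    by (rule continuous_on_product_then_coordinatewise) (intro continuous_intros)
  have Q: "continuous_on param_region (\<lambda>x. fst (snd x) $ a $ b)" for a b
    by (intro continuous_intros)
  have pos: "0 < fst x a" "0 < fst (snd x) $ a $ b" "fst (snd x) $ a $ b < 1" "i \<in> {1..n} \<Longrightarrow> 0 \<le> snd (snd x) i a"
    if x: "x \<in> param_region" for x a b i
  proof -
    obtain \<alpha> Q' \<tau> where eq: "x = (\<alpha>, Q', \<tau>)" by (cases x)
    have *: "param_floor \<le> \<alpha> a" "param_floor \<le> Q' $ a $ b" "Q' $ a $ b \<le> 1 - param_floor"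
      using x unfolding eq param_region_def by auto
    have "\<tau> \<in> PiE UNIV (\<lambda>i. if i \<in> {1..n} then Collect prob_vec else {freq})"
      using x unfolding eq param_region_def by (simp only: mem_Sigma_iff)
    then have "\<tau> i \<in> (if i \<in> {1..n} then Collect prob_vec else {freq})" by (rule PiE_mem) simp
    then have t: "i \<in> {1..n} \<Longrightarrow> prob_vec (\<tau> i)" by auto
    show "0 < fst x a" "0 < fst (snd x) $ a $ b" "fst (snd x) $ a $ b < 1"
      using * param_floor_pos unfolding eq by auto
    show "i \<in> {1..n} \<Longrightarrow> 0 \<le> snd (snd x) i a" using t unfolding eq by (auto simp: prob_vec_def)
  qed
  have ne: "fst x a \<noteq> 0" "fst (snd x) $ a $ b \<noteq> 0" "1 - fst (snd x) $ a $ b \<noteq> 0" if "x \<in> param_region" for x a b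
    using pos(1)[OF that, of a] pos(2,3)[OF that, of a b] by auto
  have xlnx: "continuous_on param_region (\<lambda>x. snd (snd x) i a * ln (snd (snd x) i a))" if "i \<in> {1..n}" for i a
    by (rule continuous_on_compose2[OF continuous_on_x_ln_x tau]) (use pos(4) that in auto)
  have "continuous_on param_region (\<lambda>x. elbo n A (snd (snd x)) (fst x) (fst (snd x)))"
    unfolding elbo_def labels_prob_def log_lik_def right_diff_distrib case_prod_beta
    by (intro continuous_on_add continuous_on_sum continuous_on_mult continuous_on_prod continuous_on_diff
        continuous_on_const continuous_on_ln tau al Q xlnx ballI ne) auto
  then show ?thesis by (simp add: case_prod_beta)
qed

end

lemma elbo_cong:
  assumes "\<And>i. i \<in> {1..n} \<Longrightarrow> \<tau> i = \<tau>' i"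
  shows "elbo n A \<tau> \<alpha> Q = elbo n A \<tau>' \<alpha> Q"
proof -
  have "labels_prob n \<tau> z = labels_prob n \<tau>' z" for z
    unfolding labels_prob_def using assms by (intro prod.cong) auto
  then show ?thesis unfolding elbo_def using assms by simp
qed

context recoverable
begin

lemma reference_attained:
  obtains \<alpha> :: "'k pmf" and Q \<tau> where "(\<alpha>, Q) \<in> param_space" "variational_objective n A \<tau> \<alpha> Q = reference"
proof -
  obtain q where q: "pmf q = freq" using prob_vec_ex_pmf[OF prob_vec_freq] by blast
  have "elbo n A (\<lambda>i. pmf (return_pmf (y i))) freq (block_averages n A y) = reference"
    unfolding reference_eq_elbo[symmetric] by (intro elbo_cong) (auto simp: fun_eq_iff indicator_def)
  then have "variational_objective n A (\<lambda>i. return_pmf (y i)) q (block_averages n A y) = reference"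
    using q freq_pos by (subst variational_objective_eq_elbo) auto
  moreover have "(q, block_averages n A y) \<in> param_space"
    using averages freq_pos q unfolding param_space_iff by auto
  ultimately show ?thesis using that by blast
qed

lemma above_reference_in_region:
  fixes \<tau> :: "nat \<Rightarrow> 'k pmf"
  assumes "(\<alpha>, Q) \<in> param_space" "reference \<le> variational_objective n A \<tau> \<alpha> Q"
  shows "(pmf \<alpha>, Q, \<lambda>i. if i \<in> {1..n} then pmf (\<tau> i) else freq) \<in> param_region"
proof -
  have p: "\<And>a. 0 < pmf \<alpha> a" "admissible Q" using assms(1) unfolding param_space_iff by blast+
  then have "reference \<le> elbo n A (\<lambda>i. pmf (\<tau> i)) (pmf \<alpha>) Q"
    using assms(2) by (simp add: variational_objective_eq_elbo)
  note loc = elbo_localizes_params[of "\<lambda>i. pmf (\<tau> i)" "pmf \<alpha>" Q, OF prob_vec_pmf prob_vec_pmf p this]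
  have "pmf \<alpha> \<in> {\<alpha>. prob_vec \<alpha> \<and> (\<forall>a. param_floor \<le> \<alpha> a)}" using loc(1) by (simp add: prob_vec_pmf)
  moreover have "Q \<in> {Q. transpose Q = Q \<and> (\<forall>a b. param_floor \<le> Q $ a $ b \<and> Q $ a $ b \<le> 1 - param_floor)}"
    using loc(2,3) p(2) by simp
  moreover have "(\<lambda>i. if i \<in> {1..n} then pmf (\<tau> i) else freq) \<in> PiE UNIV (\<lambda>i. if i \<in> {1..n} then Collect prob_vec else {freq})"
    by (auto simp: prob_vec_pmf)
  ultimately show ?thesis unfolding param_region_def by (simp only: mem_Sigma_iff)
qed

text \<open>
  The continuous objective has a maximum on the compact region. Candidates outside the region are worse
  than the reference, which is inside.
\<close>

lemma variational_estimate_exists: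
  "\<exists>(\<alpha> :: 'k pmf) Q \<tau>. is_variational_estimate n A (\<alpha>, Q, \<tau>)"
proof -
  obtain \<alpha>r :: "'k pmf" and Qr \<tau>r where r: "(\<alpha>r, Qr) \<in> param_space" "variational_objective n A \<tau>r \<alpha>r Qr = reference"
    by (rule reference_attained)
  have "param_region \<noteq> {}" using above_reference_in_region[OF r(1), of \<tau>r] r(2) by auto
  then obtain x where x: "x \<in> param_region"
    and max: "\<And>x'. x' \<in> param_region \<Longrightarrow> (\<lambda>(\<alpha>, Q, \<tau>). elbo n A \<tau> \<alpha> Q) x' \<le> (\<lambda>(\<alpha>, Q, \<tau>). elbo n A \<tau> \<alpha> Q) x"
    using continuous_attains_sup[OF compact_param_region _ continuous_on_elbo] by blast
  obtain \<alpha>v Q \<tau>v where xe: "x = (\<alpha>v, Q, \<tau>v)" by (cases x)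
  have xa: "prob_vec \<alpha>v" "\<And>a. param_floor \<le> \<alpha>v a" and xQ: "transpose Q = Q"
    "\<And>a b. param_floor \<le> Q $ a $ b" "\<And>a b. Q $ a $ b \<le> 1 - param_floor"
    using x unfolding xe param_region_def mem_Sigma_iff mem_Collect_eq by simp_all
  have av: "prob_vec \<alpha>v" "\<And>a. 0 < \<alpha>v a"
    by (rule xa(1)) (rule less_le_trans[OF param_floor_pos xa(2)])
  have "0 < Q $ a $ b \<and> Q $ a $ b < 1" for a b
    using xQ(2,3)[of a b] param_floor_pos by linarith
  with xQ(1) have Q: "admissible Q" by blast
  have "\<tau>v \<in> PiE UNIV (\<lambda>i. if i \<in> {1..n} then Collect prob_vec else {freq})"
    using x unfolding xe param_region_def by (simp only: mem_Sigma_iff)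
  then have ti: "\<tau>v i \<in> (if i \<in> {1..n} then Collect prob_vec else {freq})" for i by (rule PiE_mem) simp
  have "prob_vec (\<tau>v i)" for i using ti[of i] prob_vec_freq by (cases "i \<in> {1..n}") auto
  then have "\<exists>\<tau>. \<forall>i. pmf (\<tau> i) = \<tau>v i" by (intro choice allI prob_vec_ex_pmf)
  then obtain \<tau> where t: "\<And>i. pmf (\<tau> i) = \<tau>v i" by blast
  obtain \<alpha> where a: "pmf \<alpha> = \<alpha>v" using prob_vec_ex_pmf[OF av(1)] by blast
  have obj: "variational_objective n A \<tau> \<alpha> Q = elbo n A \<tau>v \<alpha>v Q"
    using av(2) by (subst variational_objective_eq_elbo) (auto simp: a t)
  have best: "variational_objective n A \<tau>' \<alpha>' Q' \<le> variational_objective n A \<tau> \<alpha> Q"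
    if "reference \<le> variational_objective n A \<tau>' \<alpha>' Q'" and p: "(\<alpha>', Q') \<in> param_space" for \<alpha>' :: "'k pmf" and Q' \<tau>'
  proof -
    have "variational_objective n A \<tau>' \<alpha>' Q' = elbo n A (\<lambda>i. pmf (\<tau>' i)) (pmf \<alpha>') Q'"
      using p by (intro variational_objective_eq_elbo) (simp add: param_space_iff)
    also have "\<dots> = elbo n A (\<lambda>i. if i \<in> {1..n} then pmf (\<tau>' i) else freq) (pmf \<alpha>') Q'"
      by (rule elbo_cong) simp
    also have "\<dots> \<le> elbo n A \<tau>v \<alpha>v Q"
      using max[OF above_reference_in_region[OF p that(1)]] by (simp add: xe)
    finally show ?thesis by (simp add: obj)
  qed
  have "reference \<le> variational_objective n A \<tau> \<alpha> Q" using best[of \<tau>r \<alpha>r Qr] r by simp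
  then have "variational_objective n A \<tau>' \<alpha>' Q' \<le> variational_objective n A \<tau> \<alpha> Q"
    if "(\<alpha>', Q') \<in> param_space" for \<alpha>' :: "'k pmf" and Q' \<tau>'
    using best[OF _ that, of \<tau>'] by linarith
  moreover have "(\<alpha>, Q) \<in> param_space" using av(2) Q unfolding param_space_iff a by blast
  ultimately have "is_variational_estimate n A (\<alpha>, Q, \<tau>)" unfolding is_variational_estimate_iff by blast
  then show ?thesis by blast
qed

lemma variational_labels_exist: "\<exists>z :: nat \<Rightarrow> 'k. is_variational_labels n A z"
proof -
  obtain \<alpha> :: "'k pmf" and Q \<tau> where est: "is_variational_estimate n A (\<alpha>, Q, \<tau>)"
    using variational_estimate_exists by blast
  have "\<exists>a. is_arg_max (pmf (\<tau> i)) (\<lambda>_. True) a" for i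
  proof -
    have "Max (range (pmf (\<tau> i))) \<in> range (pmf (\<tau> i))" by (rule Max_in) auto
    then obtain a where "pmf (\<tau> i) a = Max (range (pmf (\<tau> i)))" by force
    then show ?thesis by (intro exI[of _ a]) (auto simp: is_arg_max_def not_less)
  qed
  then obtain z :: "nat \<Rightarrow> 'k" where "\<And>i. is_arg_max (pmf (\<tau> i)) (\<lambda>_. True) (z i)" by metis
  then have "is_variational_labels n A (restrict z {1..n})"
    unfolding is_variational_labels_def using est by (auto simp: labelings_def)
  then show ?thesis by (rule exI[of _ "restrict z {1..n}"])
qed

text \<open>
  An estimate beats the reference, hence is localized; more than half of the mass on one label makes
  it the only most likely one.
\<close>

lemma variational_labels_recover:
  assumes "is_variational_labels n A z"
  shows "same_up_to_relabeling n y z"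
proof -
  obtain \<alpha> :: "'k pmf" and Q \<tau> where est: "is_variational_estimate n A (\<alpha>, Q, \<tau>)"
    and z: "\<And>i. i \<in> {1..n} \<Longrightarrow> is_arg_max (pmf (\<tau> i)) (\<lambda>_. True) (z i)"
    using assms unfolding is_variational_labels_def by blast
  obtain \<alpha>r :: "'k pmf" and Qr \<tau>r where r: "(\<alpha>r, Qr) \<in> param_space" "variational_objective n A \<tau>r \<alpha>r Qr = reference"
    by (rule reference_attained)
  have "(\<alpha>, Q) \<in> param_space" using est unfolding is_variational_estimate_iff by blast
  then have p: "\<And>a. 0 < pmf \<alpha> a" "admissible Q" unfolding param_space_iff by blast+
  have "reference \<le> variational_objective n A \<tau> \<alpha> Q"
    using est r unfolding is_variational_estimate_iff r(2)[symmetric] by blast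
  then have "reference \<le> elbo n A (\<lambda>i. pmf (\<tau> i)) (pmf \<alpha>) Q" by (simp add: variational_objective_eq_elbo p(1))
  from elbo_localizes[of "\<lambda>i. pmf (\<tau> i)" "pmf \<alpha>" Q, OF prob_vec_pmf prob_vec_pmf p this]
  obtain \<sigma> :: "'k \<Rightarrow> 'k" where \<sigma>: "bij \<sigma>" "\<And>i. i \<in> {1..n} \<Longrightarrow> 1 / 2 < pmf (\<tau> i) (\<sigma> (y i))" by blast
  have "z i = \<sigma> (y i)" if i: "i \<in> {1..n}" for i
  proof (rule ccontr)
    assume ne: "z i \<noteq> \<sigma> (y i)"
    have "1 / 2 < pmf (\<tau> i) (z i)"
    proof -
      have "\<not> pmf (\<tau> i) (z i) < pmf (\<tau> i) (\<sigma> (y i))" using z[OF i] by (simp add: is_arg_max_def)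
      then show ?thesis using \<sigma>(2)[OF i] by linarith
    qed
    then have "1 < (\<Sum>a\<in>{z i, \<sigma> (y i)}. pmf (\<tau> i) a)" using \<sigma>(2)[OF i] ne by simp
    also have "\<dots> \<le> (\<Sum>a\<in>UNIV. pmf (\<tau> i) a)" by (rule sum_mono2) auto
    also have "\<dots> = 1" by (simp add: sum_pmf_eq_1)
    finally show False by simp
  qed
  then show ?thesis using \<sigma>(1) by (auto simp: same_up_to_relabeling_def)
qed

lemma estimators_recover:
  fixes zvar zml :: "(nat \<Rightarrow> nat \<Rightarrow> real) \<Rightarrow> nat \<Rightarrow> 'k"
  assumes "selects (is_variational_labels n) zvar" "selects (is_mle_labels n) zml"
  shows "same_up_to_relabeling n y (zvar A)" "same_up_to_relabeling n (zvar A) (zml A)"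
proof -
  show var: "same_up_to_relabeling n y (zvar A)"
    using assms(1) variational_labels_exist unfolding selects_def by (intro variational_labels_recover) blast
  have "is_mle_labels n A (zml A)"
    using assms(2) is_mle_labels_recover(1)[OF labels separated g averages] unfolding selects_def by blast
  then have "same_up_to_relabeling n y (zml A)"
    by (rule is_mle_labels_recover(2)[OF labels separated g averages])
  then show "same_up_to_relabeling n (zvar A) (zml A)"
    using var same_up_to_relabeling_sym same_up_to_relabeling_trans by blast
qed

end

section \<open>Probability of the good event\<close>

lemma prob_bind_pmf_le:
  assumes "\<And>x. x \<in> set_pmf p \<Longrightarrow> x \<in> S \<Longrightarrow> measure_pmf.prob (f x) B \<le> \<epsilon>" and eps: "0 \<le> \<epsilon>"
  shows "measure_pmf.prob (bind_pmf p f) B \<le> measure_pmf.prob p (- S) + \<epsilon>"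
proof -
  have "emeasure (bind_pmf p f) B = (\<integral>\<^sup>+x. emeasure (f x) B \<partial>p)" by simp
  also have "\<dots> \<le> (\<integral>\<^sup>+x. indicator (- S) x + ennreal \<epsilon> \<partial>p)"
  proof (rule nn_integral_mono_AE, rule AE_pmfI)
    fix x assume x: "x \<in> set_pmf p"
    show "emeasure (f x) B \<le> indicator (- S) x + ennreal \<epsilon>"
    proof (cases "x \<in> S")
      case True
      then show ?thesis using assms(1)[OF x] by (simp add: measure_pmf.emeasure_eq_measure ennreal_leI)
    next
      case False
      have "emeasure (f x) B \<le> 1" by (rule measure_pmf.emeasure_le_1)
      also have "\<dots> \<le> indicator (- S) x + ennreal \<epsilon>" using False by simp
      finally show ?thesis .
    qed
  qed
  also have "\<dots> = emeasure p (- S) + ennreal \<epsilon>"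
    by (subst nn_integral_add) auto
  also have "\<dots> = ennreal (measure_pmf.prob p (- S) + \<epsilon>)"
    using eps by (simp add: measure_pmf.emeasure_eq_measure)
  finally show ?thesis using eps
    by (simp add: measure_pmf.emeasure_eq_measure ennreal_le_iff del: ennreal_plus)
qed

text \<open>
  Chernoff's bound with the exponential moment at \<open>- 1\<close>, together with \<open>1 - exp (- 1) \<ge> 1 / 2\<close>.
\<close>

lemma prob_small_class_le:
  fixes \<alpha> :: "'k::finite pmf"
  shows "measure_pmf.prob (Pi_pmf {1..n} undefined (\<lambda>_. \<alpha>))
      {z. real (card {i\<in>{1..n}. z i = a}) \<le> b * real n} \<le> exp (real n * (b - pmf \<alpha> a / 2))"
proof -
  let ?P = "Pi_pmf {1..n} undefined (\<lambda>_. \<alpha>)"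
  define f where "f z = (\<Prod>i\<in>{1..n}. exp (- of_bool (z i = a)) :: real)" for z :: "nat \<Rightarrow> 'k"
  have feq: "f z = exp (- real (card {i\<in>{1..n}. z i = a}))" for z
    unfolding f_def by (simp add: sum_negf Int_def flip: exp_sum)
  have fin: "finite (set_pmf ?P)"
    by (rule finite_subset[OF set_Pi_pmf_subset']) (auto intro!: finite_PiE_dflt)
  have "measure_pmf.expectation ?P f = (\<Prod>i\<in>{1..n}. measure_pmf.expectation \<alpha> (\<lambda>v. exp (- of_bool (v = a))))"
    unfolding f_def by (rule expectation_prod_Pi_pmf) (auto intro: integrable_measure_pmf_finite)
  also have "measure_pmf.expectation \<alpha> (\<lambda>v. exp (- of_bool (v = a)) :: real) \<le> exp (- (pmf \<alpha> a / 2))"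
  proof -
    have "measure_pmf.expectation \<alpha> (\<lambda>v. exp (- of_bool (v = a)) :: real) = (\<Sum>v\<in>UNIV. exp (- of_bool (v = a)) * pmf \<alpha> v)"
      by (rule integral_measure_pmf_real) auto
    also have "\<dots> = (\<Sum>v\<in>UNIV. pmf \<alpha> v - of_bool (a = v) * ((1 - exp (- 1)) * pmf \<alpha> v))"
      by (intro sum.cong) (auto simp: algebra_simps)
    also have "\<dots> = 1 - (1 - exp (- 1)) * pmf \<alpha> a"
      unfolding sum_subtractf sum_of_bool_point by (simp add: sum_pmf_eq_1)
    also have "\<dots> \<le> 1 + - (pmf \<alpha> a / 2)"
    proof -
      have "2 \<le> exp (1 :: real)" using exp_ge_add_one_self[of 1] by simp
      then have "exp (- 1 :: real) \<le> 1 / 2" by (simp add: exp_minus field_simps)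
      then have "1 / 2 * pmf \<alpha> a \<le> (1 - exp (- 1)) * pmf \<alpha> a" by (intro mult_right_mono) auto
      then show ?thesis by simp
    qed
    also have "\<dots> \<le> exp (- (pmf \<alpha> a / 2))" by (rule exp_ge_add_one_self)
    finally show ?thesis .
  qed
  then have "(\<Prod>i\<in>{1..n}. measure_pmf.expectation \<alpha> (\<lambda>v. exp (- of_bool (v = a)) :: real))
      \<le> (\<Prod>i\<in>{1..n}. exp (- (pmf \<alpha> a / 2)))"
    by (intro prod_mono conjI integral_nonneg_AE) auto
  also have "\<dots> = exp (- (real n * (pmf \<alpha> a / 2)))" by (simp flip: exp_of_nat_mult)
  finally have E: "measure_pmf.expectation ?P f \<le> exp (- (real n * (pmf \<alpha> a / 2)))" .
  have f0: "0 \<le> f z" for z by (simp add: feq)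
  have set_eq: "{z. real (card {i\<in>{1..n}. z i = a}) \<le> b * real n} = {z. exp (- (b * real n)) \<le> f z}"
    by (simp add: feq)
  have "measure_pmf.prob ?P {z. real (card {i\<in>{1..n}. z i = a}) \<le> b * real n}
      \<le> measure_pmf.expectation ?P f / exp (- (b * real n))"
    unfolding set_eq
    using integral_Markov_inequality_measure[of "measure_pmf ?P" f "{}" "exp (- (b * real n))",
        OF integrable_measure_pmf_finite[OF fin]]
    by (simp add: f0)
  also have "\<dots> \<le> exp (- (real n * (pmf \<alpha> a / 2))) / exp (- (b * real n))"
    by (intro divide_right_mono E) auto
  also have "\<dots> = exp (real n * (b - pmf \<alpha> a / 2))" by (simp add: algebra_simps flip: exp_diff)
  finally show ?thesis .
qed

lemma prob_unbalanced_le: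
  fixes \<alpha> :: "'k::finite pmf"
  assumes "\<And>a. 4 * \<beta> \<le> pmf \<alpha> a"
  shows "measure_pmf.prob (Pi_pmf {1..n} undefined (\<lambda>_. \<alpha>)) (- Collect (balanced \<beta> n))
     \<le> real CARD('k) * exp (- (\<beta> * real n))"
proof -
  let ?P = "Pi_pmf {1..n} undefined (\<lambda>_. \<alpha>)"
  let ?S = "\<lambda>a. {z. real (card {i\<in>{1..n}. z i = a}) \<le> \<beta> * real n}"
  have "measure_pmf.prob ?P (- Collect (balanced \<beta> n)) \<le> measure_pmf.prob ?P (\<Union>a\<in>UNIV. ?S a)"
    by (rule measure_pmf.finite_measure_mono) (fastforce simp: balanced_def not_le intro: less_imp_le)+
  also have "\<dots> \<le> (\<Sum>a\<in>UNIV. measure_pmf.prob ?P (?S a))"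
    by (rule measure_pmf.finite_measure_subadditive_finite) auto
  also have "\<dots> \<le> (\<Sum>a\<in>(UNIV :: 'k set). exp (- (\<beta> * real n)))"
  proof (rule sum_mono)
    fix a
    have "measure_pmf.prob ?P (?S a) \<le> exp (real n * (\<beta> - pmf \<alpha> a / 2))" by (rule prob_small_class_le)
    also have "real n * (\<beta> - pmf \<alpha> a / 2) \<le> real n * (- \<beta>)"
      using assms[of a] by (intro mult_left_mono) auto
    then have "exp (real n * (\<beta> - pmf \<alpha> a / 2)) \<le> exp (- (\<beta> * real n))" by (simp add: mult.commute)
    finally show "measure_pmf.prob ?P (?S a) \<le> exp (- (\<beta> * real n))" .
  qed
  finally show ?thesis by simp
qed

abbreviation edge_law :: "nat \<Rightarrow> real^'k^'k \<Rightarrow> (nat \<Rightarrow> 'k::finite) \<Rightarrow> (nat \<times> nat \<Rightarrow> bool) pmf" where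
  "edge_law n P y \<equiv> Pi_pmf (node_pairs n) False (\<lambda>(i, j). bernoulli_pmf (block_matrix P y i j))"

lemma edge_law_eq:
  "edge_law n P y = Pi_pmf (node_pairs n) False (\<lambda>x. bernoulli_pmf (sbm_edge_prob P y x))"
  by (rule Pi_pmf_cong) (auto simp: sbm_edge_prob_def block_matrix_def node_pairs_def)

text \<open>
  The event of \<open>hellinger_test\<close>: the competitor \<open>(z, Q)\<close> comes too close to the true likelihood.
\<close>

definition test_accepts :: "nat \<Rightarrow> real^'k^'k \<Rightarrow> (nat \<Rightarrow> 'k::finite) \<Rightarrow> (nat \<Rightarrow> 'k) \<times> (real^'k^'k) \<Rightarrow> (nat \<times> nat \<Rightarrow> bool) \<Rightarrow> bool" where
  "test_accepts n P y = (\<lambda>(z, Q) e.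
     edge_lik (node_pairs n) (sbm_edge_prob P y) e * exp (- (hellinger_dist n P y Q z / 2))
       \<le> edge_lik (node_pairs n) (sbm_edge_prob Q z) e)"

lemma prob_test_accepts_le:
  assumes P: "admissible P" and Q: "Q \<in> average_grid n"
  shows "measure_pmf.prob (edge_law n P y) {e. test_accepts n P y (z, Q) e} \<le> exp (- (hellinger_dist n P y Q z / 4))"
  unfolding edge_law_eq test_accepts_def hellinger_dist_def prod.case
  by (rule hellinger_test) (use P average_grid_bounds[OF Q] in \<open>auto simp: sbm_edge_prob_def\<close>)

text \<open>
  The competitors of the union bound: all grid matrices at wrong labels, and at the true labels the
  grid matrices that are far from the truth. The former are needed for the recovery of the labels, the
  latter for the accuracy of the block averages.
\<close>

definition rivals :: "nat \<Rightarrow> real^'k^'k \<Rightarrow> (nat \<Rightarrow> 'k::finite) \<Rightarrow> real \<Rightarrow> ((nat \<Rightarrow> 'k) \<times> (real^'k^'k)) set" where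
  "rivals n P y T = {z\<in>labelings n. \<not> same_up_to_relabeling n y z} \<times> average_grid n
     \<union> {y} \<times> {Q\<in>average_grid n. T < hellinger_dist n P y Q y}"

lemma finite_rivals: "finite (rivals n P y T)"
  unfolding rivals_def by (simp add: average_grid_card(1))

text \<open>
  The value of the union bound: the size of the grid times the sum over the wrong labelings, where
  \<open>k powr k\<close> counts the relabelings, plus the single term for the true labels.
\<close>

definition error_bound :: "real \<Rightarrow> real \<Rightarrow> real \<Rightarrow> real \<Rightarrow> real" where
  "error_bound n k x T = 
     ((n\<^sup>2 + 1)\<^sup>2) powr (k\<^sup>2) * (k powr k * (exp (n * (k * exp (- x))) - 1) + exp (- (T / 4)))"

text \<open>
  A wrong labeling is charged to the relabeling that \<open>hellinger_dist_ge_errors\<close> provides for it. As that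
  relabeling is unknown, the sum runs over all of them, and \<open>sum_exp_errors_le\<close> applies to each.
\<close>

lemma prob_some_rival_le:
  fixes Q0 :: "real^'k::finite^'k"
  assumes P: "admissible (\<rho> *\<^sub>R Q0)" and rho: "0 < \<rho>"
    and beta: "0 < \<beta>" "\<beta> \<le> 1" and delta: "0 < \<delta>"
    and bal: "balanced \<beta> n y" and big: "2 * real CARD('k) \<le> \<beta> * real n"
    and sep: "\<And>a a'. a \<noteq> a' \<Longrightarrow> \<exists>b. \<delta> \<le> \<bar>sqrt (Q0 $ a $ b) - sqrt (Q0 $ a' $ b)\<bar>"
  defines "x \<equiv> \<rho> / 8 * separation_const (real CARD('k)) \<beta> \<delta> * real n"
  shows "measure_pmf.prob (edge_law n (\<rho> *\<^sub>R Q0) y) {e. \<exists>r\<in>rivals n (\<rho> *\<^sub>R Q0) y T. test_accepts n (\<rho> *\<^sub>R Q0) y r e}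
    \<le> error_bound (real n) (real CARD('k)) x T"
proof -
  let ?P = "\<rho> *\<^sub>R Q0" and ?k = "real CARD('k)" and ?G = "average_grid n :: (real^'k^'k) set"
  let ?Z = "{z\<in>labelings n. \<not> same_up_to_relabeling n y z}" and ?M = "edge_law n (\<rho> *\<^sub>R Q0) y"
  let ?D = "\<lambda>z Q. hellinger_dist n ?P y Q z" and ?B = "{\<sigma> :: 'k \<Rightarrow> 'k. bij \<sigma>}"
  have symQ0: "transpose Q0 = Q0" using P rho by (auto simp: transpose_eq_iff)
  have "measure_pmf.prob ?M {e. \<exists>r\<in>rivals n ?P y T. test_accepts n ?P y r e}
      = measure_pmf.prob ?M (\<Union>r\<in>rivals n ?P y T. {e. test_accepts n ?P y r e})"
    by (rule arg_cong[where f = "measure_pmf.prob ?M"]) auto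
  also have "\<dots> \<le> (\<Sum>r\<in>rivals n ?P y T. measure_pmf.prob ?M {e. test_accepts n ?P y r e})"
    by (rule measure_pmf.finite_measure_subadditive_finite[OF finite_rivals]) auto
  also have "\<dots> \<le> (\<Sum>(z, Q)\<in>rivals n ?P y T. exp (- (?D z Q / 4)))"
  proof (rule sum_mono, clarify)
    fix z Q assume "(z, Q) \<in> rivals n ?P y T"
    then have "Q \<in> ?G" by (auto simp: rivals_def)
    then show "measure_pmf.prob ?M {e. test_accepts n ?P y (z, Q) e} \<le> exp (- (?D z Q / 4))"
      by (rule prob_test_accepts_le[OF P])
  qed
  also have "\<dots> \<le> (\<Sum>(z, Q)\<in>?Z \<times> ?G. exp (- (?D z Q / 4)))
      + (\<Sum>(z, Q)\<in>{y} \<times> {Q\<in>?G. T < ?D y Q}. exp (- (?D z Q / 4)))"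
    unfolding rivals_def
    by (rule order_trans[OF eq_refl[OF sum.union_disjoint]])
       (auto simp: average_grid_card(1) same_up_to_relabeling_def intro: exI[of _ id])
  also have "\<dots> \<le> real (card ?G) * (?k powr ?k * (exp (real n * (?k * exp (- x))) - 1)) + real (card ?G) * exp (- (T / 4))"
  proof (rule add_mono)
    have "(\<Sum>(z, Q)\<in>?Z \<times> ?G. exp (- (?D z Q / 4))) \<le> (\<Sum>(z, Q)\<in>?Z \<times> ?G.
        \<Sum>\<sigma>\<in>?B. if errors n z (\<sigma> \<circ> y) \<noteq> 0 then exp (- (x * real (errors n z (\<sigma> \<circ> y)))) else 0)"
    proof (rule sum_mono, clarify)
      fix z Q assume z: "z \<in> labelings n" "\<not> same_up_to_relabeling n y z" and Q: "Q \<in> ?G"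
      have "transpose Q = Q" using Q by (simp add: average_grid_def)
      from hellinger_dist_ge_errors[OF symQ0 this rho beta delta bal big sep]
      obtain \<sigma> :: "'k \<Rightarrow> 'k" where s: "bij \<sigma>"
        and D: "\<rho> / 2 * separation_const ?k \<beta> \<delta> * real n * real (errors n z (\<sigma> \<circ> y)) \<le> ?D z Q" by metis
      have ne: "errors n z (\<sigma> \<circ> y) \<noteq> 0" using z(2) s by (auto simp: same_up_to_relabeling_iff_errors)
      have "exp (- (?D z Q / 4)) \<le> exp (- (x * real (errors n z (\<sigma> \<circ> y))))"
        using D by (simp add: x_def mult_ac)
      also have "\<dots> = (if errors n z (\<sigma> \<circ> y) \<noteq> 0 then exp (- (x * real (errors n z (\<sigma> \<circ> y)))) else 0)"
        using ne by simp
      also have "\<dots> \<le> (\<Sum>\<sigma>\<in>?B. if errors n z (\<sigma> \<circ> y) \<noteq> 0 then exp (- (x * real (errors n z (\<sigma> \<circ> y)))) else 0)"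
        using s by (intro member_le_sum) auto
      finally show "exp (- (?D z Q / 4)) \<le> (\<Sum>\<sigma>\<in>?B. if errors n z (\<sigma> \<circ> y) \<noteq> 0 then exp (- (x * real (errors n z (\<sigma> \<circ> y)))) else 0)" .
    qed
    also have "\<dots> = real (card ?G) * (\<Sum>z\<in>?Z. \<Sum>\<sigma>\<in>?B.
        if errors n z (\<sigma> \<circ> y) \<noteq> 0 then exp (- (x * real (errors n z (\<sigma> \<circ> y)))) else 0)"
      by (simp add: sum.cartesian_product[symmetric] sum_distrib_left)
    also have "\<dots> \<le> real (card ?G) * (\<Sum>z\<in>labelings n. \<Sum>\<sigma>\<in>?B.
        if errors n z (\<sigma> \<circ> y) \<noteq> 0 then exp (- (x * real (errors n z (\<sigma> \<circ> y)))) else 0)"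
      by (intro mult_left_mono sum_mono2 sum_nonneg) auto
    also have "(\<Sum>z\<in>labelings n. \<Sum>\<sigma>\<in>?B.
        if errors n z (\<sigma> \<circ> y) \<noteq> 0 then exp (- (x * real (errors n z (\<sigma> \<circ> y)))) else 0)
      = (\<Sum>\<sigma>\<in>?B. \<Sum>z\<in>{z\<in>labelings n. errors n z (\<sigma> \<circ> y) \<noteq> 0}. exp (- (x * real (errors n z (\<sigma> \<circ> y)))))"
      by (subst sum.swap) (intro sum.cong refl sum.inter_filter[symmetric] finite_labelings)
    also have "\<dots> \<le> (\<Sum>\<sigma>\<in>?B. exp (real n * (?k * exp (- x))) - 1)"
      by (intro sum_mono sum_exp_errors_le)
    also have "\<dots> \<le> ?k powr ?k * (exp (real n * (?k * exp (- x))) - 1)"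
    proof -
      have "card ?B \<le> card (UNIV :: ('k \<Rightarrow> 'k) set)" by (rule card_mono) auto
      then have "real (card ?B) \<le> ?k powr ?k"
        by (simp add: card_fun powr_realpow flip: of_nat_power)
      then show ?thesis by (simp add: mult_right_mono)
    qed
    finally show "(\<Sum>(z, Q)\<in>?Z \<times> ?G. exp (- (?D z Q / 4))) \<le> real (card ?G) * (?k powr ?k * (exp (real n * (?k * exp (- x))) - 1))"
      by (simp add: mult_left_mono)
  next
    have "(\<Sum>(z, Q)\<in>{y} \<times> {Q\<in>?G. T < ?D y Q}. exp (- (?D z Q / 4))) = (\<Sum>Q\<in>{Q\<in>?G. T < ?D y Q}. exp (- (?D y Q / 4)))"
      by (simp add: sum.cartesian_product[symmetric])
    also have "\<dots> \<le> (\<Sum>Q\<in>{Q\<in>?G. T < ?D y Q}. exp (- (T / 4)))" by (intro sum_mono) auto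
    also have "\<dots> \<le> (\<Sum>Q\<in>?G. exp (- (T / 4)))" by (intro sum_mono2) (auto simp: average_grid_card(1))
    finally show "(\<Sum>(z, Q)\<in>{y} \<times> {Q\<in>?G. T < ?D y Q}. exp (- (?D z Q / 4))) \<le> real (card ?G) * exp (- (T / 4))" by simp
  qed
  also have "\<dots> = real (card ?G) * (?k powr ?k * (exp (real n * (?k * exp (- x))) - 1) + exp (- (T / 4)))"
    by (simp add: algebra_simps)
  also have "\<dots> \<le> error_bound (real n) ?k x T"
  proof -
    have "real (card ?G) \<le> real (((n\<^sup>2 + 1)\<^sup>2) ^ (CARD('k)\<^sup>2))"
      using average_grid_card(2)[where 'k = 'k, of n] by (simp only: of_nat_le_iff)
    also have "\<dots> = ((real n)\<^sup>2 + 1)\<^sup>2 ^ (CARD('k)\<^sup>2)" by (simp add: add.commute)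
    also have "\<dots> = (((real n)\<^sup>2 + 1)\<^sup>2) powr ?k\<^sup>2"
    proof -
      have "0 < (real n)\<^sup>2 + 1" by (rule add_nonneg_pos) auto
      then have "0 < ((real n)\<^sup>2 + 1)\<^sup>2" by simp
      from powr_realpow[OF this, of "CARD('k)\<^sup>2"] show ?thesis by simp
    qed
    finally show ?thesis unfolding error_bound_def by (intro mult_right_mono) auto
  qed
  finally show ?thesis .
qed

section \<open>Accuracy of the block averages\<close>

lemma card_block_pairs_ge:
  "real (card {i\<in>{1..n}. z i = a}) * (real (card {j\<in>{1..n}. z j = b}) - 1) \<le> real (card (block_pairs n z a b))"
proof -
  let ?I = "{i\<in>{1..n}. z i = a}" and ?J = "{j\<in>{1..n}. z j = b}"
  have "block_pairs n z a b = Sigma ?I (\<lambda>i. ?J - {i})" by (auto simp: block_pairs_def)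
  then have "real (card (block_pairs n z a b)) = (\<Sum>i\<in>?I. real (card (?J - {i})))"
    by (simp add: card_SigmaI)
  also have "\<dots> \<ge> (\<Sum>i\<in>?I. real (card ?J) - 1)"
  proof (rule sum_mono)
    fix i
    have "card ?J \<le> card (?J - {i}) + 1"
      using diff_card_le_card_Diff[of "{i}" ?J] by simp
    then show "real (card ?J) - 1 \<le> real (card (?J - {i}))" by linarith
  qed
  finally show ?thesis by simp
qed

lemma balanced_block_pairs_ge:
  assumes bal: "balanced \<beta> n y" and big: "2 \<le> \<beta> * real n"
  shows "(\<beta> * real n)\<^sup>2 / 2 \<le> real (card (block_pairs n y a b))"
proof -
  have *: "\<beta> * real n \<le> real (card {i\<in>{1..n}. y i = a})" "\<beta> * real n \<le> real (card {i\<in>{1..n}. y i = b})"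
    using bal by (auto simp: balanced_def)
  have "(\<beta> * real n)\<^sup>2 / 2 = \<beta> * real n * (\<beta> * real n / 2)" by (simp add: power2_eq_square)
  also have "\<dots> \<le> real (card {i\<in>{1..n}. y i = a}) * (real (card {j\<in>{1..n}. y j = b}) - 1)"
    using * big by (intro mult_mono) auto
  also have "\<dots> \<le> real (card (block_pairs n y a b))" by (rule card_block_pairs_ge)
  finally show ?thesis .
qed

lemma hellinger_dist_ge_block:
  assumes sym: "transpose P = P" "transpose Q = Q" and bal: "balanced \<beta> n y" and big: "2 \<le> \<beta> * real n"
  shows "(\<beta> * real n)\<^sup>2 / 4 * (sqrt (P $ a $ b) - sqrt (Q $ a $ b))\<^sup>2 \<le> hellinger_dist n P y Q y"
proof -
  let ?f = "\<lambda>(i, j). (sqrt (P $ y i $ y j) - sqrt (Q $ y i $ y j))\<^sup>2"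
  have "(\<beta> * real n)\<^sup>2 / 2 * (sqrt (P $ a $ b) - sqrt (Q $ a $ b))\<^sup>2
     \<le> real (card (block_pairs n y a b)) * (sqrt (P $ a $ b) - sqrt (Q $ a $ b))\<^sup>2"
    by (intro mult_right_mono balanced_block_pairs_ge[OF bal big]) simp
  also have "\<dots> = (\<Sum>x\<in>block_pairs n y a b. (sqrt (P $ a $ b) - sqrt (Q $ a $ b))\<^sup>2)" by simp
  also have "\<dots> = (\<Sum>x\<in>block_pairs n y a b. ?f x)"
    by (intro sum.cong) (auto simp: block_pairs_def)
  also have "\<dots> \<le> (\<Sum>x\<in>ordered_pairs n. ?f x)"
    by (intro sum_mono2 finite_ordered_pairs) (auto simp: block_pairs_def ordered_pairs_def)
  also have "\<dots> = 2 * hellinger_dist n P y Q y" by (rule hellinger_dist_ordered[OF sym, symmetric])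
  finally show ?thesis by simp
qed

lemma frobenius_norm_sq_ordered:
  assumes "\<And>i. i \<in> {1..n} \<Longrightarrow> M i i = 0"
  shows "(frobenius_norm n M)\<^sup>2 = (\<Sum>(i, j)\<in>ordered_pairs n. (M i j)\<^sup>2)"
proof -
  have "(frobenius_norm n M)\<^sup>2 = (\<Sum>i\<in>{1..n}. \<Sum>j\<in>{1..n}. (M i j)\<^sup>2)"
    unfolding frobenius_norm_def by (rule real_sqrt_pow2) (intro sum_nonneg, auto)
  also have "\<dots> = (\<Sum>i\<in>{1..n}. \<Sum>j\<in>{1..n}-{i}. (M i j)\<^sup>2)"
  proof (rule sum.cong[OF refl])
    fix i assume i: "i \<in> {1..n}"
    show "(\<Sum>j\<in>{1..n}. (M i j)\<^sup>2) = (\<Sum>j\<in>{1..n}-{i}. (M i j)\<^sup>2)"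
      using i assms[OF i] by (subst sum.remove[of _ i]) auto
  qed
  finally show ?thesis unfolding sum_ordered_pairs_nested .
qed

text \<open>
  Every block has at least \<open>(\<beta> n)\<^sup>2 / 2\<close> ordered pairs, so a total distance of \<open>T\<close> forces the square roots
  of the entries to be within \<open>sqrt (4 T / (\<beta> n)\<^sup>2)\<close> of each other. When this is small against the entries
  of \<open>P\<close>, the sum of the two roots is at most \<open>3 sqrt P\<close>, and multiplying by it turns the
  distance of the roots into that of the entries; the constant is \<open>18 = 2 * 3\<^sup>2\<close>.
\<close>

lemma close_averages:
  fixes n :: nat and e :: "nat \<times> nat \<Rightarrow> bool" and y :: "nat \<Rightarrow> 'k::finite" and P :: "real^'k^'k"
  defines "Q \<equiv> block_averages n (adjacency e) y"
  assumes P: "admissible P" and bal: "balanced \<beta> n y" and beta: "0 < \<beta>" and big: "2 \<le> \<beta> * real n"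
    and dist: "hellinger_dist n P y Q y \<le> T"
    and below: "\<And>a b. sqrt (4 * T / (\<beta> * real n)\<^sup>2) < sqrt (P $ a $ b)"
    and above: "\<And>a b. sqrt (P $ a $ b) + sqrt (4 * T / (\<beta> * real n)\<^sup>2) < 1"
    and max: "\<And>a b. P $ a $ b \<le> p"
  shows "admissible Q"
    and "same_up_to_relabeling n y z \<Longrightarrow>
      (frobenius_norm n (\<lambda>i j. block_matrix P y i j - estimated_probs n (adjacency e) z i j))\<^sup>2 \<le> 18 * T * p"
proof -
  have sym: "transpose P = P" "transpose Q = Q" using P by (auto simp: Q_def transpose_block_averages)
  have q0: "0 \<le> Q $ a $ b" for a b
    using average_grid_bounds[OF block_averages_in_grid[of n e y]] by (simp add: Q_def)
  have bn: "0 < (\<beta> * real n)\<^sup>2" using big by (simp add: power2_eq_square)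
  have close: "\<bar>sqrt (P $ a $ b) - sqrt (Q $ a $ b)\<bar> \<le> sqrt (4 * T / (\<beta> * real n)\<^sup>2)" for a b
  proof -
    have "(\<beta> * real n)\<^sup>2 / 4 * (sqrt (P $ a $ b) - sqrt (Q $ a $ b))\<^sup>2 \<le> T"
      using hellinger_dist_ge_block[OF sym bal big, of a b] dist by linarith
    then have "(sqrt (P $ a $ b) - sqrt (Q $ a $ b))\<^sup>2 \<le> 4 * T / (\<beta> * real n)\<^sup>2"
      using bn by (simp add: field_simps)
    then show ?thesis by (metis real_sqrt_abs real_sqrt_le_iff)
  qed
  have "0 < Q $ a $ b \<and> Q $ a $ b < 1" for a b
  proof
    have "0 < sqrt (Q $ a $ b)" using close[of a b] below[of a b] by linarith
    then show "0 < Q $ a $ b" by simp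
    have "sqrt (Q $ a $ b) < 1" using close[of a b] above[of a b] by linarith
    then show "Q $ a $ b < 1" by simp
  qed
  then show adm: "admissible Q" using sym by blast
  assume same: "same_up_to_relabeling n y z"
  have p0: "0 \<le> p" using max[of undefined undefined] P by (meson less_imp_le order_trans)
  have sq: "(P $ a $ b - Q $ a $ b)\<^sup>2 \<le> (sqrt (P $ a $ b) - sqrt (Q $ a $ b))\<^sup>2 * (9 * p)" for a b
  proof -
    have "P $ a $ b - Q $ a $ b = (sqrt (P $ a $ b) - sqrt (Q $ a $ b)) * (sqrt (P $ a $ b) + sqrt (Q $ a $ b))"
      using P q0[of a b] by (simp add: algebra_simps less_imp_le)
    then have "(P $ a $ b - Q $ a $ b)\<^sup>2 = (sqrt (P $ a $ b) - sqrt (Q $ a $ b))\<^sup>2 * (sqrt (P $ a $ b) + sqrt (Q $ a $ b))\<^sup>2"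
      by (simp add: power_mult_distrib)
    also have "(sqrt (P $ a $ b) + sqrt (Q $ a $ b))\<^sup>2 \<le> (3 * sqrt (P $ a $ b))\<^sup>2"
    proof (rule power_mono)
      show "sqrt (P $ a $ b) + sqrt (Q $ a $ b) \<le> 3 * sqrt (P $ a $ b)"
        using close[of a b] below[of a b] by linarith
      show "0 \<le> sqrt (P $ a $ b) + sqrt (Q $ a $ b)" using P q0[of a b] by (simp add: less_imp_le)
    qed
    also have "(3 * sqrt (P $ a $ b))\<^sup>2 = 9 * P $ a $ b" using P by (simp add: power_mult_distrib less_imp_le)
    also have "\<dots> \<le> 9 * p" using max[of a b] by simp
    finally show ?thesis by (simp add: mult_left_mono)
  qed
  let ?E = "estimated_probs n (adjacency e) z"
  have "(frobenius_norm n (\<lambda>i j. block_matrix P y i j - ?E i j))\<^sup>2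
     = (\<Sum>(i, j)\<in>ordered_pairs n. (block_matrix P y i j - ?E i j)\<^sup>2)"
    by (rule frobenius_norm_sq_ordered) (simp add: block_matrix_def estimated_probs_def)
  also have "\<dots> = (\<Sum>(i, j)\<in>ordered_pairs n. (P $ y i $ y j - Q $ y i $ y j)\<^sup>2)"
  proof (rule sum.cong[OF refl], clarify)
    fix i j assume "(i, j) \<in> ordered_pairs n"
    then have ij: "i \<in> {1..n}" "j \<in> {1..n}" "i \<noteq> j" by (auto simp: ordered_pairs_def)
    show "(block_matrix P y i j - ?E i j)\<^sup>2 = (P $ y i $ y j - Q $ y i $ y j)\<^sup>2"
      using ij(3) unfolding estimated_probs_relabel[OF same ij(1,2)]
      by (simp add: estimated_probs_def block_matrix_def Q_def)
  qed
  also have "\<dots> \<le> (\<Sum>(i, j)\<in>ordered_pairs n. (sqrt (P $ y i $ y j) - sqrt (Q $ y i $ y j))\<^sup>2 * (9 * p))"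
    by (intro sum_mono) (auto intro: sq)
  also have "\<dots> = (\<Sum>(i, j)\<in>ordered_pairs n. (sqrt (P $ y i $ y j) - sqrt (Q $ y i $ y j))\<^sup>2) * (9 * p)"
    by (simp add: sum_distrib_right case_prod_beta)
  also have "\<dots> = 18 * hellinger_dist n P y Q y * p"
    unfolding hellinger_dist_ordered[OF sym, symmetric] by simp
  also have "\<dots> \<le> 18 * T * p" using dist p0 by (intro mult_right_mono) auto
  finally show "(frobenius_norm n (\<lambda>i j. block_matrix P y i j - ?E i j))\<^sup>2 \<le> 18 * T * p" .
qed

text \<open>
  For balanced true labels, the event that no rival passes its test implies \<open>recoverable\<close> and the
  accuracy of the block averages; the block averages at \<open>y\<close> pass their own test, because they maximize the
  likelihood, so they cannot be a far rival.
\<close>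

lemma estimators_succeed_prob:
  fixes Q0 :: "real^'k::finite^'k" and \<alpha> :: "'k pmf"
    and zvar zml :: "(nat \<Rightarrow> nat \<Rightarrow> real) \<Rightarrow> nat \<Rightarrow> 'k"
  defines "k \<equiv> real CARD('k)"
  assumes sel: "selects (is_variational_labels n) zvar" "selects (is_mle_labels n) zml"
    and P: "admissible (\<rho> *\<^sub>R Q0)" and rho: "0 < \<rho>"
    and beta: "0 < \<beta>" "\<And>a. 4 * \<beta> \<le> pmf \<alpha> a" and delta: "0 < \<delta>"
    and sep: "\<And>a a'. a \<noteq> a' \<Longrightarrow> \<exists>b. \<delta> \<le> \<bar>sqrt (Q0 $ a $ b) - sqrt (Q0 $ a' $ b)\<bar>"
    and big: "2 * k \<le> \<beta> * real n"
    and gap: "2 * ln (real n) + ln (1 / \<beta>) + 2 + 3 * k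
       \<le> \<rho> / 4 * separation_const k \<beta> \<delta> * real n * separation_const k \<beta> 1 / 2"
    and below: "\<And>a b. sqrt (4 * T / (\<beta> * real n)\<^sup>2) < sqrt (\<rho> * Q0 $ a $ b)"
    and above: "\<And>a b. sqrt (\<rho> * Q0 $ a $ b) + sqrt (4 * T / (\<beta> * real n)\<^sup>2) < 1"
    and max: "\<And>a b. Q0 $ a $ b \<le> m"
  shows "measure_pmf.prob (sbm n \<alpha> (\<rho> *\<^sub>R Q0)) {(y, A).
      \<not> (same_up_to_relabeling n (zvar A) (zml A) \<and>
         (frobenius_norm n (\<lambda>i j. block_matrix (\<rho> *\<^sub>R Q0) y i j - estimated_probs n A (zvar A) i j))\<^sup>2 \<le> 18 * T * (\<rho> * m))}
    \<le> k * exp (- (\<beta> * real n)) + error_bound (real n) k (\<rho> / 8 * separation_const k \<beta> \<delta> * real n) T"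
    (is "measure_pmf.prob _ ?F \<le> _ + ?err")
proof -
  let ?P = "\<rho> *\<^sub>R Q0" and ?g = "\<rho> / 4 * separation_const k \<beta> \<delta> * real n"
  have k1: "1 \<le> k" by (simp add: k_def Suc_leI)
  have beta1: "\<beta> \<le> 1" using beta(1) beta(2)[of undefined] pmf_le_1[of \<alpha> undefined] by linarith
  have big2: "2 \<le> \<beta> * real n" using big k1 by linarith
  have n0: "0 < n" using big2 by (cases n) auto
  have sc: "0 < separation_const k \<beta> \<delta>" using k1 beta(1) delta by (simp add: separation_const_def)
  have key: "measure_pmf.prob (map_pmf (\<lambda>e. (y, adjacency e)) (edge_law n ?P y)) ?F \<le> ?err"
    if y: "y \<in> set_pmf (Pi_pmf {1..n} undefined (\<lambda>_. \<alpha>))" and bal: "y \<in> Collect (balanced \<beta> n)" for y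
  proof -
    have lab: "y \<in> labelings n"
      using set_Pi_pmf_subset[of "{1..n}" undefined "\<lambda>_. \<alpha>"] y by (auto simp: labelings_def PiE_def extensional_def)
    have bal: "balanced \<beta> n y" using bal by simp
    have fine: "(y, adjacency e) \<notin> ?F" if no: "\<not> (\<exists>r\<in>rivals n ?P y T. test_accepts n ?P y r e)" for e
    proof -
      let ?Q = "block_averages n (adjacency e) y"
      have sepd: "separated n (adjacency e) y ?g"
        unfolding k_def
      proof (rule separatedI[OF P rho beta(1) beta1 delta bal _ sep])
        show "2 * real CARD('k) \<le> \<beta> * real n" using big by (simp add: k_def)
        fix z :: "nat \<Rightarrow> 'k" and Q :: "real^'k^'k" assume "z \<in> labelings n" "\<not> same_up_to_relabeling n y z" "Q \<in> average_grid n"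
        then have "\<not> test_accepts n ?P y (z, Q) e" using no by (auto simp: rivals_def)
        then show "edge_lik (node_pairs n) (sbm_edge_prob Q z) e
           \<le> edge_lik (node_pairs n) (sbm_edge_prob ?P y) e * exp (- (hellinger_dist n ?P y Q z / 2))"
          by (simp add: test_accepts_def)
      qed
      have dist: "hellinger_dist n ?P y ?Q y \<le> T"
      proof (rule ccontr)
        assume "\<not> hellinger_dist n ?P y ?Q y \<le> T"
        then have "(y, ?Q) \<in> rivals n ?P y T" by (simp add: rivals_def block_averages_in_grid)
        then have "\<not> test_accepts n ?P y (y, ?Q) e" using no by blast
        then have "exp (log_lik n (adjacency e) y ?Q)
            < exp (log_lik n (adjacency e) y ?P) * exp (- (hellinger_dist n ?P y ?Q y / 2))"
          by (simp add: test_accepts_def edge_lik_block_averages edge_lik_admissible[OF P])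
        also have "\<dots> \<le> exp (log_lik n (adjacency e) y ?P)"
          by (simp add: hellinger_dist_def sum_nonneg)
        also have "\<dots> \<le> exp (log_lik n (adjacency e) y ?Q)"
          using log_lik_le_block_averages[OF P] by simp
        finally show False by simp
      qed
      have adm: "admissible ?Q" and frob: "same_up_to_relabeling n y z \<Longrightarrow>
        (frobenius_norm n (\<lambda>i j. block_matrix ?P y i j - estimated_probs n (adjacency e) z i j))\<^sup>2 \<le> 18 * T * (\<rho> * m)" for z
      proof -
        have b: "sqrt (4 * T / (\<beta> * real n)\<^sup>2) < sqrt (?P $ a $ b)" "sqrt (?P $ a $ b) + sqrt (4 * T / (\<beta> * real n)\<^sup>2) < 1"
          "?P $ a $ b \<le> \<rho> * m" for a b
          using below[of a b] above[of a b] max[of a b] rho by auto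
        show "admissible ?Q" by (rule close_averages(1)[OF P bal beta(1) big2 dist b])
        show "same_up_to_relabeling n y z \<Longrightarrow>
          (frobenius_norm n (\<lambda>i j. block_matrix ?P y i j - estimated_probs n (adjacency e) z i j))\<^sup>2 \<le> 18 * T * (\<rho> * m)"
          by (rule close_averages(2)[OF P bal beta(1) big2 dist b])
      qed
      interpret recoverable n e y \<beta> ?g
        by unfold_locales (use lab beta(1) beta1 bal big sc rho n0 sepd gap adm in \<open>auto simp: k_def\<close>)
      show ?thesis using estimators_recover[OF sel] frob by simp
    qed
    have "measure_pmf.prob (map_pmf (\<lambda>e. (y, adjacency e)) (edge_law n ?P y)) ?F
      \<le> measure_pmf.prob (edge_law n ?P y) {e. \<exists>r\<in>rivals n ?P y T. test_accepts n ?P y r e}"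
      unfolding measure_map_pmf using fine by (intro measure_pmf.finite_measure_mono) (force, simp)
    also have "\<dots> \<le> ?err" unfolding k_def
      by (rule prob_some_rival_le[OF P rho beta(1) beta1 delta bal _ sep]) (use big in \<open>simp_all add: k_def\<close>)
    finally show ?thesis .
  qed
  have err0: "0 \<le> ?err" unfolding error_bound_def using k1
    by (intro mult_nonneg_nonneg add_nonneg_nonneg) auto
  have "measure_pmf.prob (sbm n \<alpha> ?P) ?F
     \<le> measure_pmf.prob (Pi_pmf {1..n} undefined (\<lambda>_. \<alpha>)) (- Collect (balanced \<beta> n)) + ?err"
    unfolding sbm_def by (rule prob_bind_pmf_le[OF key err0])
  also have "measure_pmf.prob (Pi_pmf {1..n} undefined (\<lambda>_. \<alpha>)) (- Collect (balanced \<beta> n)) \<le> k * exp (- (\<beta> * real n))"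
    unfolding k_def by (rule prob_unbalanced_le[OF beta(2)])
  finally show ?thesis by simp
qed

section \<open>The asymptotic regime\<close>

lemma error_bound_mono:
  assumes "x' \<le> x" "0 \<le> n" "0 \<le> k"
  shows "error_bound n k x T \<le> error_bound n k x' T"
  unfolding error_bound_def using assms
  by (intro mult_left_mono add_right_mono diff_right_mono) (auto intro!: mult_left_mono)

text \<open>
  The grid has order \<open>n ^ (4 k\<^sup>2)\<close> elements. The coefficients of \<open>ln n\<close> are chosen so that the sum over the
  labelings, which carries an extra factor \<open>n\<close>, and the term of the true labels both have order
  \<open>n ^ (- 4 k\<^sup>2 - 1)\<close>; the product has order \<open>1 / n\<close>.
\<close>

lemma error_bound_tendsto_0:
  fixes k :: real
  assumes k: "1 \<le> k"
  shows "(\<lambda>n. error_bound (real n) k ((4 * k\<^sup>2 + 2) * ln (real n)) (4 * ((4 * k\<^sup>2 + 1) * ln (real n)))) \<longlonglongrightarrow> 0"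
proof (rule tendsto_sandwich[OF always_eventually eventually_mono[OF eventually_ge_at_top[of "nat \<lceil>k\<rceil>"]]
      tendsto_const])
  define E c where "E = k\<^sup>2" and "c = k powr k"
  have E: "0 \<le> E" and c: "0 \<le> c" and k0: "0 < k" using k by (auto simp: E_def c_def)
  let ?T = "\<lambda>n :: nat. error_bound (real n) k ((4 * k\<^sup>2 + 2) * ln (real n)) (4 * ((4 * k\<^sup>2 + 1) * ln (real n)))"
  show "\<forall>n. 0 \<le> ?T n" unfolding error_bound_def using k0 by (intro allI mult_nonneg_nonneg add_nonneg_nonneg) auto
  show "(\<lambda>n. 4 powr k\<^sup>2 * (2 * k * k powr k + 1) * (1 / real n)) \<longlonglongrightarrow> 0"
    by (rule tendsto_mult_right_zero) real_asymp
  fix n :: nat assume n: "nat \<lceil>k\<rceil> \<le> n"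
  then have nk: "k \<le> real n" by (simp add: nat_le_iff ceiling_le_iff)
  then have n1: "1 \<le> real n" using k by simp
  have ex: "exp (- (a * ln (real n))) = real n powr (- a)" for a using n1 by (simp add: powr_def)
  have grid: "(((real n)\<^sup>2 + 1)\<^sup>2) powr E \<le> 4 powr E * real n powr (4 * E)"
  proof -
    have "(real n)\<^sup>2 + 1 \<le> 2 * (real n)\<^sup>2" using n1 by (simp add: one_le_power)
    then have "((real n)\<^sup>2 + 1)\<^sup>2 \<le> (2 * (real n)\<^sup>2)\<^sup>2" by (intro power_mono) auto
    also have "\<dots> = 4 * real n ^ 4" by (simp add: power_mult_distrib flip: power_mult)
    finally have "(((real n)\<^sup>2 + 1)\<^sup>2) powr E \<le> (4 * real n ^ 4) powr E" by (intro powr_mono2 E) auto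
    also have "\<dots> = 4 powr E * (real n ^ 4) powr E" by (simp add: powr_mult)
    also have "(real n ^ 4) powr E = real n powr (4 * E)"
      using n1 by (simp add: powr_powr flip: powr_numeral)
    finally show ?thesis .
  qed
  let ?u = "real n * (k * exp (- ((4 * E + 2) * ln (real n))))"
  have u: "?u = k * real n powr (- (4 * E + 1))"
  proof -
    have "real n * real n powr (- (4 * E + 2)) = real n powr (- (4 * E + 1))"
      using n1 powr_add[of "real n" 1 "- (4 * E + 2)"] by (simp add: algebra_simps)
    then show ?thesis unfolding ex by simp
  qed
  have "real n powr (- (4 * E + 1)) \<le> real n powr (- 1)" using n1 E by (intro powr_mono) auto
  also have "\<dots> = 1 / real n" using n1 by (simp add: powr_minus_divide)
  finally have "?u \<le> k * (1 / real n)" unfolding u using k0 by (intro mult_left_mono) auto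
  also have "\<dots> \<le> 1" using nk n1 by simp
  finally have u1: "?u \<le> 1" .
  have u0: "0 \<le> ?u" using k0 by simp
  have "exp ?u \<le> 1 + ?u + ?u\<^sup>2" by (rule exp_bound[OF u0 u1])
  also have "?u\<^sup>2 \<le> ?u" using mult_left_mono[OF u1 u0] by (simp add: power2_eq_square)
  finally have eu: "exp ?u - 1 \<le> 2 * ?u" by linarith
  have "?T n \<le> (4 powr E * real n powr (4 * E)) * (c * (2 * ?u) + real n powr (- (4 * E + 1)))"
    unfolding error_bound_def E_def[symmetric] c_def[symmetric]
  proof (rule mult_mono[OF grid add_mono])
    show "c * (exp ?u - 1) \<le> c * (2 * ?u)" by (intro mult_left_mono eu c)
    show "exp (- (4 * ((4 * E + 1) * ln (real n)) / 4)) \<le> real n powr (- (4 * E + 1))"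
      using ex[of "4 * E + 1"] by simp
  qed (use c u0 in \<open>auto intro!: add_nonneg_nonneg mult_nonneg_nonneg\<close>)
  also have "\<dots> = 4 powr E * (2 * k * c + 1) * (real n powr (4 * E) * real n powr (- (4 * E + 1)))"
    unfolding u by (simp add: algebra_simps)
  also have "real n powr (4 * E) * real n powr (- (4 * E + 1)) = 1 / real n"
    using n1 powr_add[of "real n" "4 * E" "- (4 * E + 1)"] by (simp add: powr_minus_divide)
  finally show "?T n \<le> 4 powr k\<^sup>2 * (2 * k * k powr k + 1) * (1 / real n)"
    by (simp add: E_def c_def)
qed

text \<open>
  Different columns are different rows by symmetry, and finitely many positive differences have a
  positive minimum.
\<close>

lemma sqrt_separation:
  fixes Q0 :: "real^'k::finite^'k"
  assumes sym: "transpose Q0 = Q0" and pos: "\<forall>a b. 0 < Q0 $ a $ b"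
    and cols: "\<forall>a b. a \<noteq> b \<longrightarrow> column a Q0 \<noteq> column b Q0"
  shows "\<exists>\<delta>>0. \<forall>a a'. a \<noteq> a' \<longrightarrow> (\<exists>b. \<delta> \<le> \<bar>sqrt (Q0 $ a $ b) - sqrt (Q0 $ a' $ b)\<bar>)"
proof -
  define d where "d = (\<lambda>(a, a', b). \<bar>sqrt (Q0 $ a $ b) - sqrt (Q0 $ a' $ b)\<bar>)"
  define \<delta> where "\<delta> = Min (insert 1 {x \<in> range d. 0 < x})"
  have fin: "finite (insert 1 {x \<in> range d. 0 < x})" by simp
  have "\<delta> \<in> insert 1 {x \<in> range d. 0 < x}" unfolding \<delta>_def by (rule Min_in[OF fin]) simp
  then have "0 < \<delta>" by auto
  moreover have "\<exists>b. \<delta> \<le> \<bar>sqrt (Q0 $ a $ b) - sqrt (Q0 $ a' $ b)\<bar>" if "a \<noteq> a'" for a a'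
  proof -
    have "column a Q0 \<noteq> column a' Q0" using cols that by blast
    then obtain b where "Q0 $ b $ a \<noteq> Q0 $ b $ a'" by (auto simp: column_def vec_eq_iff)
    then have "Q0 $ a $ b \<noteq> Q0 $ a' $ b" using sym unfolding transpose_eq_iff by metis
    then have "0 < d (a, a', b)" by (simp add: d_def)
    then have "\<delta> \<le> d (a, a', b)" unfolding \<delta>_def by (intro Min_le[OF fin]) auto
    then show ?thesis by (auto simp: d_def)
  qed
  ultimately show ?thesis by blast
qed

lemma sbm_regime_eventually:
  assumes "sbm_regime \<alpha> Q0 \<rho>"
  shows "eventually (\<lambda>n. M * ln (real n) \<le> \<rho> n * real n) sequentially"
proof -
  have "filterlim (\<lambda>n. \<rho> n * real n / ln (real n)) at_top sequentially"
    using assms by (simp add: sbm_regime_def)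
  then have "eventually (\<lambda>n. M \<le> \<rho> n * real n / ln (real n)) sequentially"
    by (simp add: filterlim_at_top)
  then show ?thesis using eventually_ge_at_top[of 2]
  proof eventually_elim
    case (elim n)
    then have "0 < ln (real n)" by simp
    then show ?case using elim(1) by (simp add: pos_le_divide_eq)
  qed
qed

text \<open>
  The accuracy \<open>18 T \<rho> m\<close> with \<open>T\<close> of order \<open>ln n\<close> is eventually below \<open>\<rho> n ln 2\<close>, which yields the rate of the
  theorem for \<open>k \<ge> 2\<close> without a constant. The thresholds hold eventually because \<open>\<rho> n\<close>
  exceeds every multiple of \<open>ln n\<close> in the regime.
\<close>

lemma estimators_succeed_tendsto:
  fixes Q0 :: "real^'k::finite^'k" and \<alpha> :: "'k pmf"
    and zvar zml :: "nat \<Rightarrow> (nat \<Rightarrow> nat \<Rightarrow> real) \<Rightarrow> nat \<Rightarrow> 'k"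
  assumes sym: "transpose Q0 = Q0" and pos: "\<forall>a b. 0 < Q0 $ a $ b"
    and cols: "\<forall>a b. a \<noteq> b \<longrightarrow> column a Q0 \<noteq> column b Q0"
    and regime: "sbm_regime \<alpha> Q0 \<rho>"
    and sel: "\<And>n. selects (is_variational_labels n) (zvar n)" "\<And>n. selects (is_mle_labels n) (zml n)"
  shows "(\<lambda>n. measure_pmf.prob (sbm n \<alpha> (\<rho> n *\<^sub>R Q0)) {(y, A).
      same_up_to_relabeling n (zvar n A) (zml n A) \<and>
      (frobenius_norm n (\<lambda>i j. block_matrix (\<rho> n *\<^sub>R Q0) y i j - estimated_probs n A (zvar n A) i j))\<^sup>2
        \<le> \<rho> n * (real n * ln 2)}) \<longlonglongrightarrow> 1"
    (is "(\<lambda>n. measure_pmf.prob (?M n) (?E n)) \<longlonglongrightarrow> 1")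
proof -
  define k where "k = real CARD('k)"
  have k1: "1 \<le> k" by (simp add: k_def Suc_leI)
  obtain \<delta> where delta: "0 < \<delta>"
    and sep': "\<forall>a a'. a \<noteq> a' \<longrightarrow> (\<exists>b. \<delta> \<le> \<bar>sqrt (Q0 $ a $ b) - sqrt (Q0 $ a' $ b)\<bar>)"
    using sqrt_separation[OF sym pos cols] by (elim exE conjE)
  have sep: "\<exists>b. \<delta> \<le> \<bar>sqrt (Q0 $ a $ b) - sqrt (Q0 $ a' $ b)\<bar>" if "a \<noteq> a'" for a a'
    using sep' that by simp
  \<comment> \<open>A class has about \<open>pmf \<alpha> a * n\<close> nodes; a quarter of the smallest fraction leaves room for
    \<open>prob_unbalanced_le\<close>.\<close>
  define \<beta> where "\<beta> = Min (range (pmf \<alpha>)) / 4"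
  have "Min (range (pmf \<alpha>)) \<in> range (pmf \<alpha>)" by (rule Min_in) auto
  then obtain a where "Min (range (pmf \<alpha>)) = pmf \<alpha> a" by blast
  moreover have "0 < pmf \<alpha> a" using regime unfolding sbm_regime_def by blast
  ultimately have beta0: "0 < \<beta>" by (simp add: \<beta>_def)
  have beta: "4 * \<beta> \<le> pmf \<alpha> a" for a by (simp add: \<beta>_def)
  define entries where "entries = range (\<lambda>(a, b). Q0 $ a $ b)"
  have ent: "finite entries" "entries \<noteq> {}" "Q0 $ a $ b \<in> entries" for a b
    by (auto simp: entries_def)
  define m q where "m = Max entries" and "q = Min entries"
  have m: "Q0 $ a $ b \<le> m" and q: "q \<le> Q0 $ a $ b" for a b
    using ent by (auto simp: m_def q_def)
  have "m \<in> entries" "q \<in> entries" unfolding m_def q_def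
    by (rule Max_in[OF ent(1,2)], rule Min_in[OF ent(1,2)])
  then obtain a b a' b' where ab: "m = Q0 $ a $ b" "q = Q0 $ a' $ b'" by (auto simp: entries_def)
  have q0: "0 < q" and m0: "0 < m" and m1: "\<rho> 1 * m < 1"
    using pos regime unfolding ab sbm_regime_def by blast+
  have rho: "0 < \<rho> n" and rho_le: "\<rho> n \<le> \<rho> 1"
    and adm: "admissible (\<rho> n *\<^sub>R Q0)" if n: "1 \<le> n" for n
  proof -
    have anti: "antimono_on {1..} \<rho>"
      and reg: "\<And>n. 1 \<le> n \<Longrightarrow> 0 < \<rho> n"
        "\<And>n a b. 1 \<le> n \<Longrightarrow> 0 < \<rho> n * Q0 $ a $ b \<and> \<rho> n * Q0 $ a $ b < 1"
      using regime unfolding sbm_regime_def by blast+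
    show "0 < \<rho> n" by (rule reg(1)[OF n])
    show "\<rho> n \<le> \<rho> 1" using monotone_onD[OF anti, of 1 n] n by simp
    have "transpose (\<rho> n *\<^sub>R Q0) = \<rho> n *\<^sub>R Q0"
      using sym by (simp add: transpose_eq_iff)
    then show "admissible (\<rho> n *\<^sub>R Q0)" using reg(2)[OF n] by simp
  qed
  define L where "L = 4 * k\<^sup>2 + 1"
  have L0: "0 < L" by (simp add: L_def add_nonneg_pos)
  define T where "T n = 4 * (L * ln (real n))" for n :: nat
  define sc where "sc = separation_const k \<beta> \<delta>"
  have sc: "0 < sc" "0 < separation_const k \<beta> 1"
    using k1 beta0 delta by (auto simp: sc_def separation_const_def)
  define err where "err n = k * exp (- (\<beta> * real n)) + error_bound (real n) k ((4 * k\<^sup>2 + 2) * ln (real n)) (T n)" for n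
  note ev = sbm_regime_eventually[OF regime]
  have ev_big: "eventually (\<lambda>n. 2 * k \<le> \<beta> * real n) sequentially"
    using beta0 by real_asymp
  have ev_gap: "eventually (\<lambda>n. 2 * ln (real n) + ln (1 / \<beta>) + 2 + 3 * k
       \<le> \<rho> n / 4 * sc * real n * separation_const k \<beta> 1 / 2) sequentially"
  proof -
    define c where "c = sc * separation_const k \<beta> 1 / 8"
    have c0: "0 < c" using sc by (simp add: c_def)
    have "eventually (\<lambda>n. 2 * ln (real n) + ln (1 / \<beta>) + 2 + 3 * k \<le> 3 * ln (real n)) sequentially"
      by real_asymp
    then show ?thesis using ev[of "3 / c"]
    proof eventually_elim
      case (elim n)
      have "3 * ln (real n) \<le> \<rho> n * real n * c"
        using mult_right_mono[OF elim(2), of c] c0 by simp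
      also have "\<dots> = \<rho> n / 4 * sc * real n * separation_const k \<beta> 1 / 2" by (simp add: c_def)
      finally show ?case using elim(1) by linarith
    qed
  qed
  have ev_x: "eventually (\<lambda>n. (4 * k\<^sup>2 + 2) * ln (real n) \<le> \<rho> n / 8 * sc * real n) sequentially"
  proof -
    define c where "c = sc / 8"
    have c0: "0 < c" using sc by (simp add: c_def)
    show ?thesis using ev[of "(4 * k\<^sup>2 + 2) / c"]
    proof eventually_elim
      case (elim n)
      have "(4 * k\<^sup>2 + 2) * ln (real n) \<le> \<rho> n * real n * c"
        using mult_right_mono[OF elim, of c] c0 by simp
      also have "\<dots> = \<rho> n / 8 * sc * real n" by (simp add: c_def)
      finally show ?case .
    qed
  qed
  have ev_below: "eventually (\<lambda>n. 4 * T n / (\<beta> * real n)\<^sup>2 < \<rho> n * q) sequentially"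
    using ev[of "16 * L / (\<beta>\<^sup>2 * q)"] eventually_ge_at_top[of 2]
  proof eventually_elim
    case (elim n)
    have "16 * L * ln (real n) \<le> \<rho> n * real n * (\<beta>\<^sup>2 * q)"
      using mult_right_mono[OF elim(1), of "\<beta>\<^sup>2 * q"] beta0 q0 by simp
    also have "\<dots> < \<rho> n * real n * (\<beta>\<^sup>2 * q) * real n"
      using elim(2) rho[of n] beta0 q0 by simp
    finally have "16 * L * ln (real n) < \<rho> n * q * (\<beta> * real n)\<^sup>2"
      by (simp add: power2_eq_square mult_ac)
    then show ?case using elim(2) beta0 by (simp add: T_def divide_less_eq mult_ac)
  qed
  have ev_above: "eventually (\<lambda>n. sqrt (4 * T n / (\<beta> * real n)\<^sup>2) < 1 - sqrt (\<rho> 1 * m)) sequentially"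
  proof -
    have "(\<lambda>n. sqrt (4 * T n / (\<beta> * real n)\<^sup>2)) \<longlonglongrightarrow> 0"
      unfolding T_def using L0 beta0 by real_asymp
    moreover have "0 < 1 - sqrt (\<rho> 1 * m)" using m1 by simp
    ultimately show ?thesis by (rule order_tendstoD)
  qed
  have ev_frob: "eventually (\<lambda>n. 18 * T n * m \<le> real n * ln 2) sequentially"
    unfolding T_def using L0 m0 by real_asymp
  have lower: "eventually (\<lambda>n. 1 - err n \<le> measure_pmf.prob (?M n) (?E n)) sequentially"
    using ev_big ev_gap ev_x ev_below ev_above ev_frob eventually_ge_at_top[of 1]
  proof eventually_elim
    case (elim n)
    have r: "0 < \<rho> n" "\<rho> n \<le> \<rho> 1" using rho rho_le elim(7) by auto
    have below: "sqrt (4 * T n / (\<beta> * real n)\<^sup>2) < sqrt (\<rho> n * Q0 $ a $ b)" for a b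
    proof -
      have "\<rho> n * q \<le> \<rho> n * Q0 $ a $ b" using r q[of a b] by simp
      then show ?thesis using elim(4) by simp
    qed
    have above: "sqrt (\<rho> n * Q0 $ a $ b) + sqrt (4 * T n / (\<beta> * real n)\<^sup>2) < 1" for a b
    proof -
      have "\<rho> n * Q0 $ a $ b \<le> \<rho> 1 * m" using r m[of a b] pos by (intro mult_mono) (auto intro: less_imp_le)
      then have "sqrt (\<rho> n * Q0 $ a $ b) \<le> sqrt (\<rho> 1 * m)" by simp
      then show ?thesis using elim(5) by linarith
    qed
    have "measure_pmf.prob (?M n) {(y, A).
      \<not> (same_up_to_relabeling n (zvar n A) (zml n A) \<and>
         (frobenius_norm n (\<lambda>i j. block_matrix (\<rho> n *\<^sub>R Q0) y i j - estimated_probs n A (zvar n A) i j))\<^sup>2 \<le> 18 * T n * (\<rho> n * m))}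
      \<le> k * exp (- (\<beta> * real n)) + error_bound (real n) k (\<rho> n / 8 * sc * real n) (T n)"
      unfolding k_def sc_def
      by (rule estimators_succeed_prob[OF sel adm[OF elim(7)] r(1) beta0 beta delta sep
            elim(1)[unfolded k_def] elim(2)[unfolded k_def sc_def] below above m])
    also have "\<dots> \<le> err n" unfolding err_def
      using k1 by (intro add_left_mono error_bound_mono elim(3)) auto
    finally have bad: "measure_pmf.prob (?M n) {(y, A).
      \<not> (same_up_to_relabeling n (zvar n A) (zml n A) \<and>
         (frobenius_norm n (\<lambda>i j. block_matrix (\<rho> n *\<^sub>R Q0) y i j - estimated_probs n A (zvar n A) i j))\<^sup>2 \<le> 18 * T n * (\<rho> n * m))} \<le> err n" .
    have le: "18 * T n * (\<rho> n * m) \<le> \<rho> n * (real n * ln 2)"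
      using mult_left_mono[OF elim(6), of "\<rho> n"] r(1) by (simp add: mult_ac)
    have "measure_pmf.prob (?M n) (- ?E n) \<le> err n"
    proof (rule order_trans[OF measure_pmf.finite_measure_mono bad])
      show "- ?E n \<subseteq> {(y, A). \<not> (same_up_to_relabeling n (zvar n A) (zml n A) \<and>
         (frobenius_norm n (\<lambda>i j. block_matrix (\<rho> n *\<^sub>R Q0) y i j - estimated_probs n A (zvar n A) i j))\<^sup>2 \<le> 18 * T n * (\<rho> n * m))}"
        by (clarsimp simp del: not_le) (blast intro: order_trans[OF _ le])
    qed simp
    moreover have "measure_pmf.prob (?M n) (- ?E n) = 1 - measure_pmf.prob (?M n) (?E n)"
      using measure_pmf.prob_compl[of "?E n" "?M n"] by (simp add: Compl_eq_Diff_UNIV)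
    ultimately show ?case by linarith
  qed
  have "(\<lambda>n. k * exp (- (\<beta> * real n))) \<longlonglongrightarrow> 0" using beta0 by real_asymp
  then have "(\<lambda>n. 1 - err n) \<longlonglongrightarrow> 1 - (0 + 0)"
    unfolding err_def T_def L_def
    by (rule tendsto_diff[OF tendsto_const tendsto_add[OF _ error_bound_tendsto_0[OF k1]]])
  then have "(\<lambda>n. 1 - err n) \<longlonglongrightarrow> 1" by simp
  moreover have "eventually (\<lambda>n. measure_pmf.prob (?M n) (?E n) \<le> 1) sequentially" by simp
  ultimately show ?thesis by (rule tendsto_sandwich[OF lower _ _ tendsto_const, rotated])
qed

theorem theorem3:
  fixes Q0 :: "real^'k::finite^'k"
  assumes "transpose Q0 = Q0"
    and "\<forall>a b. 0 < Q0 $ a $ b"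
    and "\<forall>a b. a \<noteq> b \<longrightarrow> column a Q0 \<noteq> column b Q0"
  shows "\<exists>C>0. \<forall>(\<alpha>0 :: 'k pmf) (\<rho> :: nat \<Rightarrow> real)
      (zvar :: nat \<Rightarrow> (nat \<Rightarrow> nat \<Rightarrow> real) \<Rightarrow> nat \<Rightarrow> 'k)
      (zml :: nat \<Rightarrow> (nat \<Rightarrow> nat \<Rightarrow> real) \<Rightarrow> nat \<Rightarrow> 'k).
    sbm_regime \<alpha>0 Q0 \<rho> \<and>
    (\<forall>n. selects (is_variational_labels n) (zvar n)) \<and>
    (\<forall>n. selects (is_mle_labels n) (zml n)) \<longrightarrow>
      ((\<lambda>n. measure_pmf.prob (sbm n \<alpha>0 (\<rho> n *\<^sub>R Q0))
          {(z, A). same_up_to_relabeling n (zvar n A) (zml n A)}) \<longlonglongrightarrow> 1) \<and>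
      (CARD('k) \<ge> 2 \<longrightarrow>
        (\<lambda>n. measure_pmf.prob (sbm n \<alpha>0 (\<rho> n *\<^sub>R Q0))
          {(z, A). (frobenius_norm n (\<lambda>i j.
               block_matrix (\<rho> n *\<^sub>R Q0) z i j - estimated_probs n A (zvar n A) i j))\<^sup>2
             \<le> C * \<rho> n * ((real CARD('k))\<^sup>2 + real n * ln (real CARD('k)))}) \<longlonglongrightarrow> 1)"
proof (intro exI[of _ "1 :: real"] conjI allI impI; (elim conjE)?)
  fix \<alpha> :: "'k pmf" and \<rho> :: "nat \<Rightarrow> real" and zvar zml :: "nat \<Rightarrow> (nat \<Rightarrow> nat \<Rightarrow> real) \<Rightarrow> nat \<Rightarrow> 'k"
  assume regime: "sbm_regime \<alpha> Q0 \<rho>"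
    and sel: "\<forall>n. selects (is_variational_labels n) (zvar n)" "\<forall>n. selects (is_mle_labels n) (zml n)"
  let ?M = "\<lambda>n. sbm n \<alpha> (\<rho> n *\<^sub>R Q0)"
  let ?frob = "\<lambda>n y A. (frobenius_norm n (\<lambda>i j. block_matrix (\<rho> n *\<^sub>R Q0) y i j - estimated_probs n A (zvar n A) i j))\<^sup>2"
  let ?E = "\<lambda>n. {(y, A). same_up_to_relabeling n (zvar n A) (zml n A) \<and> ?frob n y A \<le> \<rho> n * (real n * ln 2)}"
  have lim: "(\<lambda>n. measure_pmf.prob (?M n) (?E n)) \<longlonglongrightarrow> 1"
    by (rule estimators_succeed_tendsto[OF assms regime]) (use sel in auto)
  have grow: "(\<lambda>n. measure_pmf.prob (?M n) (F n)) \<longlonglongrightarrow> 1" if "\<And>n. 1 \<le> n \<Longrightarrow> ?E n \<subseteq> F n" for F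
  proof (rule tendsto_sandwich[OF _ always_eventually lim tendsto_const])
    show "eventually (\<lambda>n. measure_pmf.prob (?M n) (?E n) \<le> measure_pmf.prob (?M n) (F n)) sequentially"
      by (rule eventually_mono[OF eventually_ge_at_top[of 1]])
         (rule measure_pmf.finite_measure_mono[OF that], auto)
  qed auto
  show "(\<lambda>n. measure_pmf.prob (?M n) {(z, A). same_up_to_relabeling n (zvar n A) (zml n A)}) \<longlonglongrightarrow> 1"
    by (rule grow) auto
  assume k2: "2 \<le> CARD('k)"
  show "(\<lambda>n. measure_pmf.prob (?M n) {(z, A). ?frob n z A
      \<le> 1 * \<rho> n * ((real CARD('k))\<^sup>2 + real n * ln (real CARD('k)))}) \<longlonglongrightarrow> 1"
  proof (rule grow)
    fix n :: nat assume "1 \<le> n"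
    then have rho: "0 < \<rho> n" using regime by (simp add: sbm_regime_def)
    have "real n * ln 2 \<le> real n * ln (real CARD('k))" using k2 by (intro mult_left_mono) auto
    then have "\<rho> n * (real n * ln 2) \<le> 1 * \<rho> n * ((real CARD('k))\<^sup>2 + real n * ln (real CARD('k)))"
      using rho by (simp add: add_increasing)
    then show "?E n \<subseteq> {(z, A). ?frob n z A \<le> 1 * \<rho> n * ((real CARD('k))\<^sup>2 + real n * ln (real CARD('k)))}"
      by auto
  qed
qed simp

end
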